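(* Let $\{a_k\}\subset\mathbb{C}$ be a sequence without finite limit points (each point may occur with finite multiplicity). Then $\{a_k\}$ is the zero set of some function $f$ in the class $D$ if and only if all of the following hold: (i) the limit $\lim_{R\to\infty}\sum_{0<|a_k|<R} a_k^{-1}$ exists; (ii) $n(0,t)=O(t)$ as $t\to\infty$; (iii) $n(0,t+1)-n(0,t)=o(t)$ as $t\to\infty$; (iv) $$\sup_{x\in\mathbb{R}}\left|\int_1^\infty [n(0,t)-n(x,t)]\,t^{-1}\,dt\right|<\infty .$$
   Context: The class $D$ consists of entire functions $f$ of exponential type (i.e. $|f(z)|\le Ae^{B|z|}$ for some constants $A,B$) with the property: for every sequence $h_m\in\mathbb{R}$ there exist a subsequence $h'_m$ and an entire function $\tilde f\not\equiv 0$ such that $f(z+h'_m)\to\tilde f(z)$ uniformly on every compact subset of $\mathbb{C}$. For $c\in\mathbb{C}$ and $t\ge 0$, $n(c,t)=\mathrm{card}\{a_k:\,|a_k-c|\le t\}$, counted with multiplicity. A sequence $\{a_k\}$ is the zero set of an entire function $f$ if $f(a)\ne 0$ for $a\notin\{a_k\}$ and, for each $a$ occurring in $\{a_k\}$ with multiplicity $p$, $f(a)=\dots=f^{(p-1)}(a)=0$ and $f^{(p)}(a)\ne0$. *)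

theory Defs
  imports "HOL-Analysis.Analysis" "HOL-Library.Landau_Symbols"
begin

text \<open>A sequence without finite limit points, each point of finite multiplicity,
  is represented by its multiplicity function m: m a is the number of indices k
  with a_k = a.  Having no finite limit points means every closed disc contains
  only finitely many points with positive multiplicity.\<close>

definition locally_finite_mult :: "(complex \<Rightarrow> nat) \<Rightarrow> bool" where
  "locally_finite_mult m \<longleftrightarrow> (\<forall>R::real. finite {a. 0 < m a \<and> norm a \<le> R})"

definition count_fn :: "(complex \<Rightarrow> nat) \<Rightarrow> complex \<Rightarrow> real \<Rightarrow> nat" where
  "count_fn m c t = (\<Sum>a\<in>{a. 0 < m a \<and> dist a c \<le> t}. m a)"

definition exp_type :: "(complex \<Rightarrow> complex) \<Rightarrow> bool" where
  "exp_type f \<longleftrightarrow> (\<exists>A B::real. \<forall>z. norm (f z) \<le> A * exp (B * norm z))"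

definition class_D :: "(complex \<Rightarrow> complex) set" where
  "class_D = {f. f holomorphic_on UNIV \<and> exp_type f \<and>
     (\<forall>h::nat \<Rightarrow> real. \<exists>r g. strict_mono r \<and> g holomorphic_on UNIV \<and> (\<exists>z. g z \<noteq> 0) \<and>
        (\<forall>K. compact K \<longrightarrow>
           uniform_limit K (\<lambda>k z. f (z + complex_of_real (h (r k)))) g sequentially))}"

definition is_zero_set :: "(complex \<Rightarrow> complex) \<Rightarrow> (complex \<Rightarrow> nat) \<Rightarrow> bool" where
  "is_zero_set f m \<longleftrightarrow>
     (\<forall>a. (\<forall>j<m a. (deriv ^^ j) f a = 0) \<and> (deriv ^^ m a) f a \<noteq> 0)"

end

theory Submission
  imports Defs "HOL-Complex_Analysis.Complex_Analysis" "HOL-Real_Asymp.Real_Asymp"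
begin

text \<open>
Both directions rest on the quantity \<open>jensen f m x\<close>, whose logarithm is the mean of \<open>ln \<bar>f\<bar>\<close>
over the unit circle about \<open>x\<close>.  By Jensen's formula the integral in (iv) equals
\<open>ln (jensen f m x / jensen f m 0)\<close> whenever \<open>f\<close> is the limit of its partial products over discs
up to a factor of modulus \<open>1\<close> on the real line; condition (iii) makes the boundary terms vanish.

Sufficiency: for the product \<open>f\<close> over the given zeros, (iv) bounds \<open>jensen f m\<close> on the real line from
both sides.  It dominates \<open>\<bar>f\<bar>\<close>, so \<open>f\<close> is bounded on the real line and, by Phragmen--Lindelof, on
strips; Montel's theorem yields limits of translates, and these do not vanish because
\<open>jensen f m x\<close> is at most the maximum of \<open>\<bar>f\<bar>\<close> on the unit circle about \<open>x\<close>.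

Necessity: \<open>f\<close> is bounded on the real line and \<open>jensen f m\<close> is bounded below there, so discs of
radius \<open>r\<close> with real centre contain \<open>O(r)\<close> zeros; with the Blaschke condition in both half planes
this gives (ii) and (iii).  For (i) and (iv) one has to show that \<open>f\<close> needs no real exponential factor.
Reflecting the zeros of the upper half plane yields a function \<open>F\<close> without zeros there, bounded by
\<open>M exp (B Im z)\<close>, and by the Schwarz--Pick lemma \<open>Re (F' / F)\<close> tends to \<open>0\<close> away from the real axis.
The mean of the partial fraction expansion of \<open>Re (F' / F)\<close> over a semicircle of radius \<open>R\<close> is, up
to small errors, the exponent left over by the partial product over the disc of radius \<open>R\<close>.
\<close>

subsection \<open>Phragmen--Lindelof theorems\<close>

text \<open>Zeros may lie on or near the real line, so |f(x)| has no positive lower bound there.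
  Averaging over unit circles removes this obstacle, and radius 1 matches the lower limit of the
  integral in (iv). That limits of translates do not vanish is what keeps this average away from 0.
  In the necessity part the difficulty is that the sums in (i) converge only conditionally. Their
  imaginary parts converge absolutely by the Blaschke condition. For the real parts, Re (1 / a) is
  unchanged by reflection in the real axis, so zeros may be moved out of the upper half plane.
  Moving all of them at once would call for an infinite Blaschke product; instead finitely many are
  moved at a time, with bounds that do not depend on how many, and \<open>F\<close> is a limit of
  the resulting normal family. A mean over a semicircle is taken, not a value at a point, because
  the mean of 1 / (z - s) acts for s near the real axis almost like a sharp cutoff at |s| = R. It
  therefore isolates the partial sum over a disc, and only zeros near the corners R and -R need a
  separate count.\<close>

lemma maximum_modulus_barrier:
  fixes f h :: "complex \<Rightarrow> complex"
  assumes S: "closed S" and holf: "f holomorphic_on interior S" and contf: "continuous_on S f"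
    and holh: "h holomorphic_on interior S" and conth: "continuous_on S h"
    and fr: "\<And>z. z \<in> frontier S \<Longrightarrow> norm (f z) \<le> M"
    and h0: "\<And>z. z \<in> S \<Longrightarrow> 0 \<le> Re (h z)" and M: "0 \<le> M"
    and growth: "\<And>\<epsilon>. 0 < \<epsilon> \<Longrightarrow>
      \<exists>R. \<forall>z\<in>S. R \<le> norm z \<longrightarrow> norm (f z) * exp (- \<epsilon> * Re (h z)) \<le> M"
    and z: "z \<in> S"
  shows "norm (f z) \<le> M"
proof -
  have *: "norm (f z) \<le> M * exp (\<epsilon> * Re (h z))" if e: "0 < \<epsilon>" for \<epsilon>
  proof -
    obtain R0 where R0: "\<And>z. z \<in> S \<Longrightarrow> R0 \<le> norm z \<Longrightarrow> norm (f z) * exp (- \<epsilon> * Re (h z)) \<le> M"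
      using growth[OF e] by blast
    define R where "R = max R0 (norm z + 1)"
    define T where "T = S \<inter> cball 0 R"
    \<comment> \<open>The factor has modulus at most 1 on \<open>S\<close>, so it preserves the
      bound on the frontier, and beyond \<open>R0\<close> it beats the growth of \<open>f\<close>.
      The maximum principle applies on the bounded set \<open>T\<close>; at the end \<epsilon> tends
      to 0.\<close>
    define g where "g = (\<lambda>z. f z * exp (- of_real \<epsilon> * h z))"
    have ng: "norm (g w) = norm (f w) * exp (- \<epsilon> * Re (h w))" for w
      by (simp add: g_def norm_mult)
    have closT: "closed T" using S by (simp add: T_def closed_Int)
    have "norm (g z) \<le> M"
    proof (rule maximum_modulus_frontier[of g T])
      show "g holomorphic_on interior T"
        unfolding g_def T_def interior_Int
        by (intro holomorphic_intros holomorphic_on_subset[OF holf] holomorphic_on_subset[OF holh]) auto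
      show "continuous_on (closure T) g"
        unfolding closure_closed[OF closT] unfolding g_def T_def
        by (intro continuous_intros continuous_on_subset[OF contf] continuous_on_subset[OF conth]) auto
      show "bounded T" unfolding T_def by (simp add: bounded_Int)
      show "z \<in> T" using z by (simp add: T_def R_def)
      show "norm (g w) \<le> M" if w: "w \<in> frontier T" for w
      proof -
        have wT: "w \<in> T" using w closT frontier_subset_closed by blast
        then have wS: "w \<in> S" by (simp add: T_def)
        show ?thesis
        proof (cases "w \<in> frontier S")
          case True
          have "exp (- \<epsilon> * Re (h w)) \<le> 1" using h0[OF wS] e by simp
          then have "norm (f w) * exp (- \<epsilon> * Re (h w)) \<le> norm (f w) * 1"
            by (intro mult_left_mono) auto
          then show ?thesis using fr[OF True] ng[of w] by simp
        next
          case False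
          then have "w \<in> interior S" using wS S by (simp add: frontier_def)
          moreover have "w \<notin> interior T" using w by (simp add: frontier_def)
          ultimately have "w \<notin> ball 0 R" by (simp add: T_def)
          then have "R0 \<le> norm w" by (simp add: R_def)
          then show ?thesis using R0[OF wS] ng[of w] by simp
        qed
      qed
    qed
    then have "norm (f z) * exp (- \<epsilon> * Re (h z)) * exp (\<epsilon> * Re (h z)) \<le> M * exp (\<epsilon> * Re (h z))"
      unfolding ng by (intro mult_right_mono) auto
    then show ?thesis by (simp add: mult.assoc flip: exp_add)
  qed
  have "((\<lambda>\<epsilon>. M * exp (\<epsilon> * Re (h z))) \<longlongrightarrow> M * exp (0 * Re (h z))) (at_right 0)"
    by (intro tendsto_intros)
  moreover have "eventually (\<lambda>\<epsilon>. norm (f z) \<le> M * exp (\<epsilon> * Re (h z))) (at_right 0)"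
    using eventually_at_right_less[of "0::real"] by eventually_elim (rule *)
  ultimately show ?thesis
    using tendsto_lowerbound[of "\<lambda>\<epsilon>. M * exp (\<epsilon> * Re (h z))" M "at_right 0" "norm (f z)"] by simp
qed

text \<open>The barrier is w^(3/2) with w = (1 - i) z + 1. This w has argument at most pi / 4 in
  modulus on the quadrant, so w^(3/2) has argument at most 3 pi / 8 and real part of order
  |z|^(3/2), which dominates every exponential type.\<close>

lemma Phragmen_Lindelof_quadrant:
  fixes f :: "complex \<Rightarrow> complex"
  assumes holf: "f holomorphic_on UNIV" and f: "\<And>z. norm (f z) \<le> A * exp (B * norm z)"
    and M: "0 < M" and re: "\<And>x. 0 \<le> x \<Longrightarrow> norm (f (of_real x)) \<le> M"
    and im: "\<And>y. 0 \<le> y \<Longrightarrow> norm (f (\<i> * of_real y)) \<le> M"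
    and z: "0 \<le> Re z" "0 \<le> Im z"
  shows "norm (f z) \<le> M"
proof -
  define S where "S = {z. 0 \<le> Re z} \<inter> {z. 0 \<le> Im z}"
  define w where "w = (\<lambda>z. (1 - \<i>) * z + 1)"
  define h where "h = (\<lambda>z. w z * csqrt (w z))"
  have rw: "Re (w z) = Re z + Im z + 1" "Im (w z) = Im z - Re z" for z by (simp_all add: w_def)
  have A0: "0 \<le> A" using f[of 0] norm_ge_zero[of "f 0"] by (simp del: norm_ge_zero)
  have nonneg: "w z \<notin> \<real>\<^sub>\<le>\<^sub>0" if "z \<in> S" for z
    using that by (auto simp: complex_nonpos_Reals_iff rw S_def)
  have hh: "norm z * sqrt (norm z) / 4 \<le> Re (h z)" if "z \<in> S" for z
  proof -
    define q where "q = csqrt (w z)"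
    define p where "p = Re q"
    define r where "r = Im q"
    have q2: "q^2 = w z" by (simp add: q_def)
    have p0: "0 \<le> p" unfolding p_def q_def by (rule Re_csqrt)
    have 1: "p^2 - r^2 = Re (w z)" and 2: "2 * p * r = Im (w z)"
      using arg_cong[OF q2, of Re] arg_cong[OF q2, of Im] by (simp_all add: p_def r_def power2_eq_square mult_ac)
    \<comment> \<open>This encodes that the argument of \<open>w z\<close> is at most pi / 4 in
      modulus.\<close>
    have le: "2 * p * \<bar>r\<bar> \<le> p^2 - r^2"
    proof -
      have "\<bar>Im (w z)\<bar> \<le> Re (w z)" using that by (auto simp: rw S_def)
      moreover have "\<bar>Im (w z)\<bar> = 2 * p * \<bar>r\<bar>" using p0 by (simp flip: 2 add: abs_mult)
      ultimately show ?thesis using 1 by simp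
    qed
    have zz: "norm z \<le> p^2 - r^2"
    proof -
      have "norm z \<le> \<bar>Re z\<bar> + \<bar>Im z\<bar>" by (rule cmod_le)
      then show ?thesis using that 1 by (auto simp: rw S_def)
    qed
    \<comment> \<open>Correspondingly the argument of \<open>q\<close> is at most pi / 8, and tan
      (pi / 8) < 1 / 2.\<close>
    have rp: "r^2 \<le> p^2 / 4"
    proof -
      have "\<bar>r\<bar> \<le> p / 2"
      proof (rule ccontr)
        assume "\<not> \<bar>r\<bar> \<le> p / 2"
        then have "p / 2 < \<bar>r\<bar>" by simp
        then have "p * p \<le> p * (2 * \<bar>r\<bar>)" using p0 by (intro mult_left_mono) auto
        moreover have "p * (2 * \<bar>r\<bar>) = 2 * p * \<bar>r\<bar>" by simp
        ultimately have "r^2 \<le> 0" using le power2_eq_square[of p] by linarith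
        then show False using \<open>p / 2 < \<bar>r\<bar>\<close> p0 by simp
      qed
      then have "\<bar>r\<bar>^2 \<le> (p/2)^2" by (intro power_mono) auto
      then show ?thesis by (simp add: power_divide)
    qed
    have "h z = q^2 * q" by (simp add: h_def q_def)
    then have "Re (h z) = p^3 - 3 * p * r^2"
      by (simp add: p_def r_def power2_eq_square power3_eq_cube algebra_simps)
    moreover have "p * r^2 \<le> p * (p^2/4)" using rp p0 by (intro mult_left_mono) auto
    ultimately have "p^2 * p / 4 \<le> Re (h z)" by (simp add: power2_eq_square power3_eq_cube)
    moreover have "norm z * sqrt (norm z) \<le> p^2 * p"
    proof (rule mult_mono)
      show "norm z \<le> p^2" using zz zero_le_power2[of r] by linarith
      then show "sqrt (norm z) \<le> p" using p0 by (simp add: real_le_lsqrt)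
    qed (use p0 in auto)
    ultimately show ?thesis by linarith
  qed
  show ?thesis
  proof (rule maximum_modulus_barrier[where S = S and h = h and f = f and z = z])
    show "closed S" unfolding S_def by (intro closed_Int closed_halfspace_Re_ge closed_halfspace_Im_ge)
    show "f holomorphic_on interior S" using holf by (rule holomorphic_on_subset) auto
    show "continuous_on S f" using holf holomorphic_on_imp_continuous_on continuous_on_subset by blast
    have "h holomorphic_on S" unfolding h_def
      using nonneg by (auto simp: w_def intro!: holomorphic_intros)
    then show "h holomorphic_on interior S" "continuous_on S h"
      using interior_subset holomorphic_on_subset holomorphic_on_imp_continuous_on by blast+
    show "norm (f z) \<le> M" if "z \<in> frontier S" for z
    proof -
      have "open ({z. 0 < Re z} \<inter> {z. 0 < Im z})"
        by (intro open_Int open_halfspace_Re_gt open_halfspace_Im_gt)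
      then have "{z. 0 < Re z} \<inter> {z. 0 < Im z} \<subseteq> interior S"
        by (intro interior_maximal) (auto simp: S_def)
      moreover have "z \<in> S" using that \<open>closed S\<close> frontier_subset_closed by blast
      moreover have "z \<notin> interior S" using that by (simp add: frontier_def)
      ultimately have "Im z = 0 \<and> 0 \<le> Re z \<or> Re z = 0 \<and> 0 \<le> Im z"
        unfolding S_def by force
      then consider "Im z = 0" "0 \<le> Re z" | "Re z = 0" "0 \<le> Im z" by blast
      then show ?thesis
      proof cases
        case 1
        then have "z = of_real (Re z)" by (simp add: complex_eq_iff)
        then show ?thesis using re[OF 1(2)] by simp
      next
        case 2
        then have "z = \<i> * of_real (Im z)" by (simp add: complex_eq_iff)
        then show ?thesis using im[OF 2(2)] by simp
      qed
    qed
    show "0 \<le> M" using M by simp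
    show "0 \<le> Re (h z)" if "z \<in> S" for z
      by (rule order_trans[OF _ hh[OF that]]) simp
    show "z \<in> S" using z by (simp add: S_def)
    show "\<exists>R. \<forall>z\<in>S. R \<le> norm z \<longrightarrow> norm (f z) * exp (- \<epsilon> * Re (h z)) \<le> M" if e: "0 < \<epsilon>" for \<epsilon>
    proof -
      \<comment> \<open>The squared term makes \<epsilon> times the barrier at least (|B| + 1) |z|,
        which leaves a spare factor exp (- |z|); the term A / M lets that factor absorb the constant
        \<open>A\<close>.\<close>
      define R where "R = max 1 (max ((4 * (\<bar>B\<bar> + 1) / \<epsilon>)^2) (A / M))"
      have "norm (f z) * exp (- \<epsilon> * Re (h z)) \<le> M" if "z \<in> S" "R \<le> norm z" for z
      proof -
        define r where "r = norm z"
        have r: "r \<ge> 1" "(4 * (\<bar>B\<bar> + 1) / \<epsilon>)^2 \<le> r" "A / M \<le> r" using that by (auto simp: R_def r_def)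
        have "4 * (\<bar>B\<bar> + 1) / \<epsilon> \<le> sqrt r" using r(2) by (rule real_le_rsqrt)
        then have "4 * (\<bar>B\<bar> + 1) \<le> \<epsilon> * sqrt r" using e by (simp add: pos_divide_le_eq mult.commute)
        then have "r * (4 * (\<bar>B\<bar> + 1)) \<le> r * (\<epsilon> * sqrt r)" using r by (intro mult_left_mono) auto
        moreover have "\<epsilon> * (r * sqrt r / 4) \<le> \<epsilon> * Re (h z)"
          using hh[OF \<open>z \<in> S\<close>] e unfolding r_def by (intro mult_left_mono) auto
        moreover have "B * r \<le> \<bar>B\<bar> * r" using r by (intro mult_right_mono) auto
        ultimately have ex: "B * r - \<epsilon> * Re (h z) \<le> - r" by (simp add: algebra_simps)
        have "norm (f z) * exp (- \<epsilon> * Re (h z)) \<le> A * exp (B * r) * exp (- \<epsilon> * Re (h z))"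
          using f[of z] by (intro mult_right_mono) (auto simp: r_def)
        also have "\<dots> = A * exp (B * r - \<epsilon> * Re (h z))" by (simp add: exp_diff exp_minus field_simps)
        also have "\<dots> \<le> A * exp (- r)" using ex A0 by (intro mult_left_mono) auto
        also have "\<dots> \<le> M"
        proof -
          have "A \<le> M * r" using r(3) M by (simp add: divide_le_eq mult.commute)
          also have "\<dots> \<le> M * exp r" using M exp_ge_add_one_self[of r] by (intro mult_left_mono) linarith+
          finally show ?thesis by (simp add: exp_minus field_simps)
        qed
        finally show ?thesis .
      qed
      then show ?thesis by blast
    qed
  qed
qed

text \<open>For a bounded function a barrier that merely tends to infinity suffices. The number 1 -
  i z has positive real part on the half plane, so its square root has real part at least of order
  |z|^(1/2).\<close>

lemma Phragmen_Lindelof_half_plane_bounded: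
  fixes f :: "complex \<Rightarrow> complex"
  assumes holf: "f holomorphic_on UNIV" and f: "\<And>z. 0 \<le> Im z \<Longrightarrow> norm (f z) \<le> K"
    and M: "0 < M" and re: "\<And>x. norm (f (of_real x)) \<le> M"
    and z: "0 \<le> Im z"
  shows "norm (f z) \<le> M"
proof -
  define S where "S = {z. 0 \<le> Im z}"
  define h where "h = (\<lambda>z. csqrt (1 - \<i> * z))"
  have nonneg: "1 - \<i> * z \<notin> \<real>\<^sub>\<le>\<^sub>0" if "z \<in> S" for z
    using that by (auto simp: complex_nonpos_Reals_iff S_def)
  have hh: "sqrt ((norm z - 1) / 2) \<le> Re (h z)" if "z \<in> S" for z
  proof -
    define q where "q = csqrt (1 - \<i> * z)"
    have q2: "q^2 = 1 - \<i> * z" by (simp add: q_def)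
    have p0: "0 \<le> Re q" unfolding q_def by (rule Re_csqrt)
    have "(Re q)^2 - (Im q)^2 = 1 + Im z" using arg_cong[OF q2, of Re] by (simp add: power2_eq_square)
    then have "(Im q)^2 \<le> (Re q)^2" using that by (simp add: S_def)
    moreover have "(Re q)^2 + (Im q)^2 = norm (1 - \<i> * z)"
      using arg_cong[OF q2, of norm] by (simp add: norm_power cmod_power2)
    moreover have "norm z - 1 \<le> norm (1 - \<i> * z)"
      using norm_triangle_ineq3[of "\<i> * z" 1] by (simp add: norm_mult norm_minus_commute)
    ultimately have "(norm z - 1) / 2 \<le> (Re q)^2" by simp
    then show ?thesis using p0 by (simp add: h_def q_def real_le_lsqrt)
  qed
  show ?thesis
  proof (rule maximum_modulus_barrier[where S = S and h = h and f = f and z = z])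
    show "closed S" unfolding S_def by (intro closed_halfspace_Im_ge)
    show "f holomorphic_on interior S" using holf by (rule holomorphic_on_subset) auto
    show "continuous_on S f" using holf holomorphic_on_imp_continuous_on continuous_on_subset by blast
    have "h holomorphic_on S" unfolding h_def
      using nonneg by (auto intro!: holomorphic_intros)
    then show "h holomorphic_on interior S" "continuous_on S h"
      using interior_subset holomorphic_on_subset holomorphic_on_imp_continuous_on by blast+
    show "norm (f z) \<le> M" if "z \<in> frontier S" for z
    proof -
      have "{z. 0 < Im z} \<subseteq> interior S"
        by (intro interior_maximal open_halfspace_Im_gt) (auto simp: S_def)
      moreover have "z \<in> S" using that \<open>closed S\<close> frontier_subset_closed by blast
      moreover have "z \<notin> interior S" using that by (simp add: frontier_def)
      ultimately have "Im z = 0" unfolding S_def by force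
      then have "z = of_real (Re z)" by (simp add: complex_eq_iff)
      then show ?thesis using re[of "Re z"] by simp
    qed
    show "0 \<le> M" using M by simp
    show "0 \<le> Re (h z)" if "z \<in> S" for z unfolding h_def by (rule Re_csqrt)
    show "z \<in> S" using z by (simp add: S_def)
    show "\<exists>R. \<forall>z\<in>S. R \<le> norm z \<longrightarrow> norm (f z) * exp (- \<epsilon> * Re (h z)) \<le> M" if e: "0 < \<epsilon>" for \<epsilon>
    proof -
      define t where "t = max 0 (K / M) / \<epsilon>"
      have "norm (f z) * exp (- \<epsilon> * Re (h z)) \<le> M" if "z \<in> S" "2 * t^2 + 1 \<le> norm z" for z
      proof -
        have "t^2 \<le> (norm z - 1) / 2" using that by simp
        then have "t \<le> sqrt ((norm z - 1) / 2)" by (rule real_le_rsqrt)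
        then have "t \<le> Re (h z)" using hh[OF \<open>z \<in> S\<close>] by simp
        then have "max 0 (K / M) \<le> \<epsilon> * Re (h z)" using e by (simp add: t_def pos_divide_le_eq mult.commute)
        then have "K / M \<le> exp (\<epsilon> * Re (h z))" using exp_ge_add_one_self[of "\<epsilon> * Re (h z)"] by linarith
        then have "K \<le> M * exp (\<epsilon> * Re (h z))" using M by (simp add: divide_le_eq mult.commute)
        then have "norm (f z) \<le> M * exp (\<epsilon> * Re (h z))" using f[of z] that by (simp add: S_def)
        then show ?thesis by (simp add: exp_minus field_simps)
      qed
      then show ?thesis by blast
    qed
  qed
qed

text \<open>The factor exp (i B z) removes the growth along the positive imaginary axis and has
  modulus 1 on the real line. The quadrant theorem, used on both quadrants, then gives a crude bound
  \<open>K\<close>, which the bounded case sharpens to \<open>M\<close>.\<close>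

lemma Phragmen_Lindelof_half_plane:
  fixes f :: "complex \<Rightarrow> complex"
  assumes holf: "f holomorphic_on UNIV" and f: "\<And>z. norm (f z) \<le> A * exp (B * norm z)"
    and M: "0 < M" and re: "\<And>x. norm (f (of_real x)) \<le> M" and B: "0 \<le> B"
    and z: "0 \<le> Im z"
  shows "norm (f z) \<le> M * exp (B * Im z)"
proof -
  define g where "g = (\<lambda>z. f z * exp (\<i> * of_real B * z))"
  \<comment> \<open>The rotated function brings the second quadrant into the first.\<close>
  define g' where "g' = (\<lambda>z. g (\<i> * z))"
  have ng: "norm (g z) = norm (f z) * exp (- B * Im z)" for z by (simp add: g_def norm_mult)
  have holg: "g holomorphic_on UNIV" unfolding g_def by (intro holomorphic_intros holf)
  have holg': "g' holomorphic_on UNIV" unfolding g'_def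
    using holomorphic_on_compose_gen[of "(*) \<i>" UNIV g UNIV] holg by (auto simp: o_def intro!: holomorphic_intros)
  have A0: "0 \<le> A" using f[of 0] norm_ge_zero[of "f 0"] by (simp del: norm_ge_zero)
  have g1: "norm (g z) \<le> A * exp (2 * B * norm z)" for z
  proof -
    have "norm (g z) \<le> (A * exp (B * norm z)) * exp (B * norm z)" unfolding ng
    proof (rule mult_mono[OF f])
      have "- Im z \<le> norm z" using abs_Im_le_cmod[of z] by linarith
      then have "B * - Im z \<le> B * norm z" by (rule mult_left_mono[OF _ B])
      then show "exp (- B * Im z) \<le> exp (B * norm z)" by simp
    qed (use A0 in auto)
    then show ?thesis by (simp add: mult.assoc flip: exp_add)
  qed
  define K where "K = max A M"
  have K: "0 < K" using M by (simp add: K_def)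
  have gr: "norm (g (of_real x)) \<le> K" for x using re[of x] by (simp add: ng K_def)
  have gi: "norm (g (\<i> * of_real y)) \<le> K" if "0 \<le> y" for y
  proof -
    have "norm (g (\<i> * of_real y)) \<le> A * exp (B * y) * exp (- B * y)" unfolding ng
      using f[of "\<i> * of_real y"] that A0 by (intro mult_mono) (auto simp: norm_mult)
    then show ?thesis by (simp add: K_def mult.assoc flip: exp_add)
  qed
  have gK: "norm (g z) \<le> K" if "0 \<le> Im z" for z
  proof (cases "0 \<le> Re z")
    case True
    show ?thesis using Phragmen_Lindelof_quadrant[OF holg g1 K gr gi True that] by simp
  next
    case False
    have "norm (g' (-\<i> * z)) \<le> K"
    proof (rule Phragmen_Lindelof_quadrant[OF holg' _ K])
      show "norm (g' z) \<le> A * exp (2 * B * norm z)" for z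
        using g1[of "\<i> * z"] by (simp add: g'_def norm_mult)
      show "norm (g' (of_real x)) \<le> K" if "0 \<le> x" for x using gi[OF that] by (simp add: g'_def)
      show "norm (g' (\<i> * of_real x)) \<le> K" for x using gr[of "-x"] by (simp add: g'_def flip: mult.assoc)
    qed (use False that in auto)
    then show ?thesis by (simp add: g'_def flip: mult.assoc)
  qed
  have "norm (g z) \<le> M"
  proof (rule Phragmen_Lindelof_half_plane_bounded[OF holg gK M _ z])
    show "norm (g (of_real x)) \<le> M" for x using re[of x] by (simp add: ng)
  qed
  then have "norm (f z) * exp (- B * Im z) * exp (B * Im z) \<le> M * exp (B * Im z)"
    unfolding ng by (intro mult_right_mono) auto
  then show ?thesis by (simp add: mult.assoc flip: exp_add)
qed

subsection \<open>The Schwarz--Pick lemma in the upper half plane\<close>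

text \<open>Schwarz's lemma for the composite \<psi> after \<open>Q\<close> after \<phi>: here
  \<phi> maps the unit disc to the upper half plane with 0 going to \<open>w\<close>, and \<psi>
  maps the right half plane to the unit disc with \<open>Q w\<close> going to 0.\<close>

lemma Schwarz_Pick_half_plane:
  fixes Q :: "complex \<Rightarrow> complex"
  assumes holQ: "Q holomorphic_on {z. 0 < Im z}" and ReQ: "\<And>z. 0 < Im z \<Longrightarrow> 0 < Re (Q z)"
    and z: "0 < Im z" and w: "0 < Im w"
  shows "norm (Q z - Q w) * norm (z - cnj w) \<le> norm (Q z + cnj (Q w)) * norm (z - w)"
proof -
  define \<phi> where "\<phi> = (\<lambda>\<zeta>. (w - \<zeta> * cnj w) / (1 - \<zeta>))"
  define \<psi> where "\<psi> = (\<lambda>u. (u - Q w) / (u + cnj (Q w)))"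
  have Im\<phi>: "0 < Im (\<phi> \<zeta>)" if "norm \<zeta> < 1" for \<zeta>
  proof -
    have "\<zeta> \<noteq> 1" using that by auto
    then have n0: "0 < (norm (1 - \<zeta>))\<^sup>2" by simp
    have "\<phi> \<zeta> = (w - \<zeta> * cnj w) * cnj (1 - \<zeta>) / of_real ((norm (1 - \<zeta>))\<^sup>2)"
      unfolding \<phi>_def by (rule complex_div_cnj)
    then have "Im (\<phi> \<zeta>) = Im ((w - \<zeta> * cnj w) * cnj (1 - \<zeta>)) / (norm (1 - \<zeta>))\<^sup>2"
      by (metis Im_divide_of_real)
    also have "Im ((w - \<zeta> * cnj w) * cnj (1 - \<zeta>)) = Im w * (1 - (norm \<zeta>)\<^sup>2)"
      unfolding cmod_power2 by (simp add: algebra_simps power2_eq_square)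
    finally have "Im (\<phi> \<zeta>) = Im w * (1 - (norm \<zeta>)\<^sup>2) / (norm (1 - \<zeta>))\<^sup>2" .
    moreover have "(norm \<zeta>)\<^sup>2 < 1" using that by (simp add: power_less_one_iff)
    ultimately show ?thesis using w n0 by (simp add: zero_less_mult_iff)
  qed
  have nz: "u + cnj (Q w) \<noteq> 0" if "0 < Re u" for u
    using that ReQ[OF w] by (auto simp: complex_eq_iff)
  have \<psi>1: "norm (\<psi> u) < 1" if "0 < Re u" for u
  proof -
    have "(norm (u - Q w))\<^sup>2 < (norm (u + cnj (Q w)))\<^sup>2"
      using mult_pos_pos[OF that ReQ[OF w]] unfolding cmod_power2 by (simp add: power2_eq_square algebra_simps)
    then have "norm (u - Q w) < norm (u + cnj (Q w))" by (simp add: power2_less_imp_less)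
    then show ?thesis using nz[OF that] by (simp add: \<psi>_def norm_divide divide_less_eq)
  qed
  define F where "F = (\<lambda>\<zeta>. \<psi> (Q (\<phi> \<zeta>)))"
  have hol\<phi>: "\<phi> holomorphic_on ball 0 1" unfolding \<phi>_def by (intro holomorphic_intros) auto
  have "(Q \<circ> \<phi>) holomorphic_on ball 0 1"
    by (rule holomorphic_on_compose_gen[OF hol\<phi> holQ]) (use Im\<phi> in auto)
  then have holF: "F holomorphic_on ball 0 1" unfolding F_def \<psi>_def o_def
    by (intro holomorphic_intros) (use nz ReQ Im\<phi> in auto)
  define \<zeta> where "\<zeta> = (z - w) / (z - cnj w)"
  have zw: "z - cnj w \<noteq> 0" using z w by (auto simp: complex_eq_iff)
  have "\<phi> \<zeta> = z"
  proof -
    have "1 - \<zeta> = (w - cnj w) / (z - cnj w)" using zw by (simp add: \<zeta>_def field_simps)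
    moreover have "w - \<zeta> * cnj w = z * (w - cnj w) / (z - cnj w)" using zw by (simp add: \<zeta>_def field_simps)
    moreover have "w - cnj w \<noteq> 0" using w by (auto simp: complex_eq_iff)
    ultimately show ?thesis using zw by (simp add: \<phi>_def)
  qed
  have \<zeta>1: "norm \<zeta> < 1"
  proof -
    have "(norm (z - w))\<^sup>2 < (norm (z - cnj w))\<^sup>2"
      using mult_pos_pos[OF z w] unfolding cmod_power2 by (simp add: power2_eq_square algebra_simps)
    then have "norm (z - w) < norm (z - cnj w)" by (simp add: power2_less_imp_less)
    then show ?thesis using zw by (simp add: \<zeta>_def norm_divide divide_less_eq)
  qed
  have "norm (F \<zeta>) \<le> norm \<zeta>"
  proof (rule Schwarz_Lemma(1)[OF holF])
    show "F 0 = 0" by (simp add: F_def \<psi>_def \<phi>_def)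
    show "norm (F \<zeta>) < 1" if "norm \<zeta> < 1" for \<zeta> unfolding F_def using \<psi>1 ReQ Im\<phi>[OF that] by auto
  qed (rule \<zeta>1)
  then have "norm (Q z - Q w) / norm (Q z + cnj (Q w)) \<le> norm (z - w) / norm (z - cnj w)"
    using \<open>\<phi> \<zeta> = z\<close> by (simp add: F_def \<psi>_def \<zeta>_def norm_divide)
  then show ?thesis using zw nz[OF ReQ[OF z]] by (simp add: divide_simps mult.commute split: if_splits)
qed

text \<open>Schwarz--Pick bounds the pseudohyperbolic distance of \<open>Q z\<close> and
  \<open>Q w\<close> by a / b. Discarding imaginary parts leaves an inequality between p = Re (Q z)
  and q = Re (Q w), which is solved for p with b^2 - a^2 = 4 Im z Im w. Adding \<epsilon> supplies
  strict positivity.\<close>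

lemma Harnack_half_plane:
  fixes Q :: "complex \<Rightarrow> complex"
  assumes holQ: "Q holomorphic_on {z. 0 < Im z}" and ReQ: "\<And>z. 0 < Im z \<Longrightarrow> 0 \<le> Re (Q z)"
    and z: "0 < Im z" and w: "0 < Im w"
  shows "Re (Q z) \<le> Re (Q w) * (norm (z - cnj w))\<^sup>2 / (Im z * Im w)"
proof -
  define a where "a = norm (z - w)"
  define b where "b = norm (z - cnj w)"
  have ab: "b\<^sup>2 - a\<^sup>2 = 4 * Im z * Im w"
    unfolding a_def b_def cmod_power2 by (simp add: power2_eq_square algebra_simps)
  have yy: "0 < Im z * Im w" using z w by simp
  have a0: "0 \<le> a" "0 \<le> b" by (auto simp: a_def b_def)
  have "a < b"
  proof -
    have "a\<^sup>2 < b\<^sup>2" using ab yy by simp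
    then show ?thesis using a0 by (simp add: power2_less_imp_less)
  qed
  have *: "Re (Q z) + \<epsilon> \<le> (Re (Q w) + \<epsilon>) * b\<^sup>2 / (Im z * Im w)" if e: "0 < \<epsilon>" for \<epsilon>
  proof -
    define P where "P = (\<lambda>z. Q z + of_real \<epsilon>)"
    have "norm (P z - P w) * b \<le> norm (P z + cnj (P w)) * a" unfolding a_def b_def
    proof (rule Schwarz_Pick_half_plane[OF _ _ z w])
      show "P holomorphic_on {z. 0 < Im z}" unfolding P_def by (intro holomorphic_intros holQ)
      show "0 < Re (P z)" if "0 < Im z" for z using ReQ[OF that] e by (simp add: P_def)
    qed
    moreover define p q d where "p = Re (P z)" and "q = Re (P w)" and "d = Im (P z) - Im (P w)"
    ultimately have le: "norm (Complex (p - q) d) * b \<le> norm (Complex (p + q) d) * a"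
    proof -
      have "P z - P w = Complex (p - q) d" "P z + cnj (P w) = Complex (p + q) d"
        by (simp_all add: complex_eq_iff p_def q_def d_def)
      then show ?thesis using \<open>norm (P z - P w) * b \<le> norm (P z + cnj (P w)) * a\<close> by simp
    qed
    have le2: "((p - q)\<^sup>2 + d\<^sup>2) * b\<^sup>2 \<le> ((p + q)\<^sup>2 + d\<^sup>2) * a\<^sup>2"
      using power_mono[OF le, of 2] a0 by (simp add: power_mult_distrib cmod_power2)
    have le3: "d\<^sup>2 * a\<^sup>2 \<le> d\<^sup>2 * b\<^sup>2" using \<open>a < b\<close> a0 by (intro mult_left_mono power_mono) auto
    \<comment> \<open>Because a < b, the contribution of \<open>d\<close> is larger on the smaller
      side of \<open>le2\<close>, so it may be cancelled.\<close>
    have le4: "((p - q) * b)\<^sup>2 \<le> ((p + q) * a)\<^sup>2"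
      using le2[unfolded distrib_right] le3 unfolding power_mult_distrib by linarith
    have pq: "0 < p" "0 < q" using ReQ[OF z] ReQ[OF w] e by (auto simp: p_def q_def P_def)
    have "(p - q) * b \<le> (p + q) * a"
      using pq a0 by (intro power2_le_imp_le[OF le4]) auto
    then have "p * (b - a) \<le> q * (b + a)" by (simp add: algebra_simps)
    then have "p * (b - a) * (b + a) \<le> q * (b + a) * (b + a)" using a0 by (intro mult_right_mono) auto
    then have "p * (b\<^sup>2 - a\<^sup>2) \<le> q * (b + a)\<^sup>2" by (simp add: power2_eq_square algebra_simps)
    moreover have "(b + a)\<^sup>2 \<le> (2 * b)\<^sup>2" using \<open>a < b\<close> a0 by (intro power_mono) auto
    then have "q * (b + a)\<^sup>2 \<le> q * (4 * b\<^sup>2)" using pq by (intro mult_left_mono) (auto simp: power_mult_distrib)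
    ultimately have "p * (4 * Im z * Im w) \<le> q * (4 * b\<^sup>2)" unfolding ab by linarith
    then show ?thesis using yy by (simp add: p_def q_def P_def le_divide_eq algebra_simps)
  qed
  have lim: "((\<lambda>\<epsilon>. (Re (Q w) + \<epsilon>) * b\<^sup>2 / (Im z * Im w)) \<longlongrightarrow> (Re (Q w) + 0) * b\<^sup>2 / (Im z * Im w)) (at_right 0)"
    using z w by (intro tendsto_intros) auto
  have ev: "eventually (\<lambda>\<epsilon>. Re (Q z) \<le> (Re (Q w) + \<epsilon>) * b\<^sup>2 / (Im z * Im w)) (at_right 0)"
    using eventually_at_right_less[of "0::real"] by eventually_elim (use * in fastforce)
  have "Re (Q z) \<le> (Re (Q w) + 0) * b\<^sup>2 / (Im z * Im w)"
    by (rule tendsto_lowerbound[OF lim ev]) simp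
  then show ?thesis by (simp add: b_def)
qed

text \<open>The infinitesimal form of Schwarz--Pick: divide by z - w and let z tend to w, where the
  remaining quotient tends to Re (Q w) / Im w.\<close>

lemma deriv_le_Re_half_plane:
  fixes Q :: "complex \<Rightarrow> complex"
  assumes holQ: "Q holomorphic_on {z. 0 < Im z}" and ReQ: "\<And>z. 0 < Im z \<Longrightarrow> 0 \<le> Re (Q z)"
    and w: "0 < Im w"
  shows "norm (deriv Q w) \<le> Re (Q w) / Im w"
proof -
  have *: "norm (deriv Q w) \<le> (Re (Q w) + \<epsilon>) / Im w" if e: "0 < \<epsilon>" for \<epsilon>
  proof -
    define P where "P = (\<lambda>z. Q z + of_real \<epsilon>)"
    have holP: "P holomorphic_on {z. 0 < Im z}" unfolding P_def by (intro holomorphic_intros holQ)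
    have opn: "open {z. 0 < Im z}" by (rule open_halfspace_Im_gt)
    have dQ: "(Q has_field_derivative deriv Q w) (at w)"
      using holomorphic_derivI[OF holQ opn] w by auto
    have dP: "(P has_field_derivative deriv Q w) (at w)" unfolding P_def
      using DERIV_add[OF dQ DERIV_const[of "of_real \<epsilon>"]] by simp
    have l1: "((\<lambda>z. norm ((P z - P w) / (z - w))) \<longlongrightarrow> norm (deriv Q w)) (at w)"
      using dP by (intro tendsto_norm) (simp add: has_field_derivative_iff)
    have cP: "(P \<longlongrightarrow> P w) (at w)" using dP DERIV_isCont isContD by blast
    have l2: "((\<lambda>z. norm (P z + cnj (P w)) / norm (z - cnj w)) \<longlongrightarrow> norm (P w + cnj (P w)) / norm (w - cnj w)) (at w)"
      using w by (intro tendsto_intros cP) (auto simp: complex_eq_iff)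
    have "eventually (\<lambda>z. z \<in> {z. 0 < Im z}) (at w)"
      using opn w by (intro eventually_at_in_open') auto
    then have "eventually (\<lambda>z. norm ((P z - P w) / (z - w)) \<le> norm (P z + cnj (P w)) / norm (z - cnj w)) (at w)"
      using eventually_neq_at_within[of w]
    proof eventually_elim
      case (elim z)
      have "norm (P z - P w) * norm (z - cnj w) \<le> norm (P z + cnj (P w)) * norm (z - w)"
        by (rule Schwarz_Pick_half_plane[OF holP _ _ w]) (use ReQ e elim in \<open>auto simp: P_def add_nonneg_pos\<close>)
      moreover have "z - cnj w \<noteq> 0" using elim w by (auto simp: complex_eq_iff)
      ultimately show ?case using elim by (simp add: norm_divide divide_simps mult.commute split: if_splits)
    qed
    then have "norm (deriv Q w) \<le> norm (P w + cnj (P w)) / norm (w - cnj w)"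
      by (intro tendsto_le[OF _ l2 l1]) auto
    moreover have "P w + cnj (P w) = of_real (2 * (Re (Q w) + \<epsilon>))" "w - cnj w = of_real (2 * Im w) * \<i>"
      by (auto simp: P_def complex_eq_iff)
    moreover have "0 \<le> Re (Q w) + \<epsilon>" using ReQ[OF w] e by simp
    ultimately show ?thesis using w by (simp add: norm_mult field_simps del: of_real_mult of_real_add)
  qed
  have lim: "((\<lambda>\<epsilon>. (Re (Q w) + \<epsilon>) / Im w) \<longlongrightarrow> (Re (Q w) + 0) / Im w) (at_right 0)"
    using w by (intro tendsto_intros) auto
  have ev: "eventually (\<lambda>\<epsilon>. norm (deriv Q w) \<le> (Re (Q w) + \<epsilon>) / Im w) (at_right 0)"
    using eventually_at_right_less[of "0::real"] by eventually_elim (rule *)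
  have "norm (deriv Q w) \<le> (Re (Q w) + 0) / Im w"
    by (rule tendsto_lowerbound[OF lim ev]) simp
  then show ?thesis by simp
qed

subsection \<open>Zeros and cofactors\<close>

text \<open>Borel--Caratheodory for the logarithm l of g / g 0: an upper bound for Re l on the disc
  bounds |l| on half of it, Cauchy's inequality then bounds the second derivative on a quarter of
  it, and integrating once and twice from 0 gives the last two estimates.\<close>

lemma zero_free_log_bounds:
  fixes g :: "complex \<Rightarrow> complex"
  assumes holg: "g holomorphic_on UNIV" and N: "0 < N" and nz: "\<And>z. norm z < N \<Longrightarrow> g z \<noteq> 0"
    and bd: "\<And>z. norm z < N \<Longrightarrow> norm (g z) \<le> exp M * norm (g 0)" and M: "0 < M"
  obtains l where "l holomorphic_on ball 0 N"
    "\<And>z. norm z < N \<Longrightarrow> g z = g 0 * exp (l z)"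
    "\<And>z. norm z \<le> N / 4 \<Longrightarrow> norm (deriv l z - deriv l 0) \<le> 128 * M * norm z / N\<^sup>2"
    "\<And>z. norm z \<le> N / 4 \<Longrightarrow> norm (l z - deriv l 0 * z) \<le> 128 * M * (norm z)\<^sup>2 / N\<^sup>2"
proof -
  obtain l0 where holl0: "l0 holomorphic_on ball 0 N" and l0: "\<And>z. z \<in> ball 0 N \<Longrightarrow> g z = exp (l0 z)"
    by (rule contractible_imp_holomorphic_log[of g "ball 0 N"])
       (use nz holomorphic_on_subset[OF holg] convex_imp_contractible in auto)
  define l where "l = (\<lambda>z. l0 z - l0 0)"
  have holl: "l holomorphic_on ball 0 N" unfolding l_def by (intro holomorphic_intros holl0)
  have gl: "g z = g 0 * exp (l z)" if "norm z < N" for z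
    using l0[of z] l0[of 0] N that by (simp add: l_def exp_diff)
  have Re_l: "Re (l z) < 2 * M" if "norm z < N" for z
  proof -
    have "exp (Re (l z)) * norm (g 0) \<le> exp M * norm (g 0)"
      using bd[OF that] gl[OF that] by (simp add: norm_mult mult.commute)
    then have "Re (l z) \<le> M" using nz[of 0] N by simp
    then show ?thesis using M by simp
  qed
  have lbound: "norm (l z) \<le> 4 * M" if z: "norm z \<le> N / 2" for z
  proof -
    \<comment> \<open>The map u / (4 M - u) sends the half plane Re u < 2 M to the unit disc, as 4 M
      is the mirror image of 0 in its boundary line. Schwarz's lemma thus applies to
      \<open>q\<close>.\<close>
    define q where "q = (\<lambda>\<zeta>. l (of_real N * \<zeta>) / (of_real (4 * M) - l (of_real N * \<zeta>)))"
    have in_ball: "norm (of_real N * \<zeta>) < N" if "norm \<zeta> < 1" for \<zeta> :: complex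
      using that N by (simp add: norm_mult)
    have nz4: "of_real (4 * M) - l z \<noteq> 0" if "norm z < N" for z
      using Re_l[OF that] M by (auto simp: complex_eq_iff)
    have "(\<lambda>\<zeta>. l (of_real N * \<zeta>)) holomorphic_on ball 0 1"
    proof -
      have "(l \<circ> (*) (of_real N)) holomorphic_on ball 0 1"
        by (rule holomorphic_on_compose_gen[OF _ holl]) (use in_ball in \<open>auto intro!: holomorphic_intros\<close>)
      then show ?thesis by (simp add: o_def)
    qed
    then have holq: "q holomorphic_on ball 0 1" unfolding q_def
      by (intro holomorphic_intros) (use nz4 in_ball in auto)
    have "norm (z / of_real N) < 1" using z N by (simp add: norm_divide)
    have "norm (q (z / of_real N)) \<le> norm (z / of_real N)"
    proof (rule Schwarz_Lemma(1)[OF holq])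
      show "q 0 = 0" by (simp add: q_def l_def)
      show "norm (q \<zeta>) < 1" if "norm \<zeta> < 1" for \<zeta>
      proof -
        define u where "u = l (of_real N * \<zeta>)"
        have "Re u < 2 * M" unfolding u_def using Re_l in_ball[OF that] by blast
        then have "M * Re u < M * (2 * M)" using M by (intro mult_strict_left_mono) auto
        then have "(norm u)\<^sup>2 < (norm (of_real (4 * M) - u))\<^sup>2"
          unfolding cmod_power2 by (simp add: power2_eq_square algebra_simps)
        then have "norm u < norm (of_real (4 * M) - u)" by (rule power2_less_imp_less) simp
        moreover have "of_real (4 * M) - u \<noteq> 0" unfolding u_def using nz4 in_ball[OF that] by blast
        ultimately show ?thesis unfolding q_def u_def[symmetric] by (simp add: norm_divide divide_less_eq)
      qed
      show "norm (z / of_real N) < 1" by fact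
    qed
    moreover have "of_real N * (z / of_real N) = z" using N by simp
    ultimately have "norm (l z) / norm (of_real (4 * M) - l z) \<le> norm z / N"
      using N by (simp add: q_def norm_divide)
    also have "norm z / N \<le> 1 / 2" using z N by (simp add: divide_le_eq)
    finally have "2 * norm (l z) \<le> norm (of_real (4 * M) - l z)"
      using nz4[of z] z N by (simp add: divide_le_eq split: if_splits)
    also have "\<dots> \<le> 4 * M + norm (l z)"
      using norm_triangle_ineq4[of "of_real (4 * M)" "l z"] M by simp
    finally show ?thesis by simp
  qed
  \<comment> \<open>128 = 2! * 4 * 4^2: Cauchy's inequality for the second derivative, with |l| <= 4
    M on circles of radius N / 4.\<close>
  define K where "K = 128 * M / N\<^sup>2"
  have sub: "cball z (N/4) \<subseteq> ball 0 N" "cball z (N/4) \<subseteq> cball 0 (N/2)" if "norm z \<le> N/4" for z :: complex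
  proof -
    have "norm w \<le> N/2" if "dist z w \<le> N/4" for w
      using norm_triangle_ineq2[of w z] that \<open>norm z \<le> N/4\<close> by (simp add: dist_norm norm_minus_commute)
    then show "cball z (N/4) \<subseteq> cball 0 (N/2)" "cball z (N/4) \<subseteq> ball 0 N" using N by force+
  qed
  have d2: "norm (deriv (deriv l) z) \<le> K" if z: "norm z \<le> N/4" for z
  proof -
    have "norm ((deriv ^^ 2) l z) \<le> fact 2 * (4 * M) / (N/4)^2"
    proof (rule Cauchy_inequality)
      show "l holomorphic_on ball z (N/4)"
        using sub(1)[OF z] by (intro holomorphic_on_subset[OF holl]) auto
      show "continuous_on (cball z (N/4)) l"
        using sub(1)[OF z] by (intro holomorphic_on_imp_continuous_on holomorphic_on_subset[OF holl])
      show "norm (l w) \<le> 4 * M" if "norm (z - w) = N/4" for w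
        using sub(2)[OF z] that by (intro lbound) (auto simp: dist_norm subset_iff)
    qed (use N in auto)
    then show ?thesis using N by (simp add: K_def numeral_2_eq_2 power2_eq_square)
  qed
  have opb: "open (ball 0 N)" by simp
  have dl: "(l has_field_derivative deriv l z) (at z)" if "norm z < N" for z
    using holomorphic_derivI[OF holl opb] that by auto
  have ddl: "(deriv l has_field_derivative deriv (deriv l) z) (at z)" if "norm z < N" for z
    using holomorphic_derivI[OF holomorphic_deriv[OF holl opb] opb] that by auto
  have b1: "norm (deriv l z - deriv l 0) \<le> K * norm z" if z: "norm z \<le> N/4" for z
  proof -
    have "norm (deriv l z - deriv l 0) \<le> K * norm (z - 0)"
    proof (rule field_differentiable_bound[of "cball 0 (N/4)"])
      show "(deriv l has_field_derivative deriv (deriv l) w) (at w within cball 0 (N/4))"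
        if "w \<in> cball 0 (N/4)" for w
        by (rule has_field_derivative_at_within[OF ddl]) (use that N in auto)
    qed (use z N d2 in auto)
    then show ?thesis by simp
  qed
  have K0: "0 \<le> K" using M by (simp add: K_def)
  have b2: "norm (l z - deriv l 0 * z) \<le> K * (norm z)\<^sup>2" if z: "norm z \<le> N/4" for z
  proof -
    have "norm ((l z - deriv l 0 * z) - (l 0 - deriv l 0 * 0)) \<le> K * norm z * norm (z - 0)"
    proof (rule field_differentiable_bound[of "cball 0 (norm z)"])
      show "((\<lambda>w. l w - deriv l 0 * w) has_field_derivative deriv l w - deriv l 0) (at w within cball 0 (norm z))"
        if "w \<in> cball 0 (norm z)" for w
        by (rule has_field_derivative_at_within)
           (use dl[of w] that N z in \<open>auto intro!: derivative_eq_intros\<close>)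
      show "norm (deriv l w - deriv l 0) \<le> K * norm z" if "w \<in> cball 0 (norm z)" for w
      proof -
        have "norm (deriv l w - deriv l 0) \<le> K * norm w" using b1 that z by auto
        also have "\<dots> \<le> K * norm z" using that K0 by (intro mult_left_mono) auto
        finally show ?thesis .
      qed
    qed auto
    then show ?thesis by (simp add: l_def power2_eq_square mult.assoc)
  qed
  show thesis
    by (rule that[OF holl gl]) (use b1 b2 in \<open>auto simp: K_def\<close>)
qed

section \<open>Multiplicities, and division by finitely many zeros\<close>

lemma holomorphic_UNIV_tendsto:
  assumes "g holomorphic_on UNIV"
  shows "(g \<longlongrightarrow> g a) (at a)"
  using holomorphic_on_imp_continuous_on[OF assms] by (simp add: continuous_on_def)

text \<open>The order of vanishing in factored form, including order 0 at points where
  \<open>f\<close> does not vanish. This form passes through products and quotients directly;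
  \<open>has_mult_iff_deriv\<close> links it to the derivatives in
  \<open>is_zero_set\<close>.\<close>

definition has_mult :: "(complex \<Rightarrow> complex) \<Rightarrow> complex \<Rightarrow> nat \<Rightarrow> bool" where
  "has_mult f a k \<longleftrightarrow>
     (\<exists>g r. 0 < r \<and> g holomorphic_on ball a r \<and> (\<forall>z\<in>ball a r. f z = (z - a) ^ k * g z) \<and> g a \<noteq> 0)"

lemma has_mult_unique:
  assumes "has_mult f a j" "has_mult f a k"
  shows "j = k"
proof -
  have *: False if jk: "has_mult f a j" "has_mult f a k" "j < k" for j k
  proof -
    obtain g r where r: "0 < r" "g holomorphic_on ball a r" "\<And>z. z \<in> ball a r \<Longrightarrow> f z = (z - a) ^ j * g z" "g a \<noteq> 0"
      using jk(1) unfolding has_mult_def by blast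
    obtain h s where s: "0 < s" "h holomorphic_on ball a s" "\<And>z. z \<in> ball a s \<Longrightarrow> f z = (z - a) ^ k * h z"
      using jk(2) unfolding has_mult_def by blast
    have "isCont g a" using r(1,2) by (metis centre_in_ball continuous_on_interior holomorphic_on_imp_continuous_on interior_ball)
    then have l1: "(g \<longlongrightarrow> g a) (at a)" by (simp add: isCont_def)
    have "isCont h a" using s(1,2) by (metis centre_in_ball continuous_on_interior holomorphic_on_imp_continuous_on interior_ball)
    then have "(h \<longlongrightarrow> h a) (at a)" by (simp add: isCont_def)
    then have l2: "((\<lambda>z. (z - a) ^ (k - j) * h z) \<longlongrightarrow> (a - a) ^ (k - j) * h a) (at a)"
      by (intro tendsto_intros)
    have "eventually (\<lambda>z. z \<in> ball a (min r s)) (at a)"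
      using r(1) s(1) by (intro eventually_at_in_open') auto
    then have "eventually (\<lambda>z. g z = (z - a) ^ (k - j) * h z) (at a)"
      using eventually_neq_at_within[of a]
    proof eventually_elim
      case (elim z)
      then have "(z - a) ^ j * g z = (z - a) ^ k * h z" using r(3)[of z] s(3)[of z] by simp
      also have "(z - a) ^ k = (z - a) ^ j * (z - a) ^ (k - j)" using jk(3) by (simp flip: power_add)
      finally show ?case using elim by simp
    qed
    then have "((\<lambda>z. (z - a) ^ (k - j) * h z) \<longlongrightarrow> g a) (at a)" using l1 by (rule Lim_transform_eventually[rotated])
    then have "g a = (a - a) ^ (k - j) * h a" using l2 LIM_unique by blast
    then show False using r(4) jk(3) by simp
  qed
  show ?thesis using *[OF assms] *[OF assms(2,1)] by (meson linorder_neqE_nat)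
qed

lemma has_mult_iff_deriv:
  assumes holf: "f holomorphic_on UNIV"
  shows "has_mult f a k \<longleftrightarrow> (\<forall>j<k. (deriv ^^ j) f a = 0) \<and> (deriv ^^ k) f a \<noteq> 0"
proof -
  have *: "has_mult f a k" if d: "\<forall>j<k. (deriv ^^ j) f a = 0" "(deriv ^^ k) f a \<noteq> 0" for k
  proof (cases "k = 0")
    case True
    then show ?thesis using d(2) holomorphic_on_subset[OF holf, of "ball a 1"] unfolding has_mult_def
      by (intro exI[of _ f] exI[of _ "1::real"]) auto
  next
    case False
    then have "f a = 0" using d(1) by (metis funpow_0 gr0I)
    show ?thesis
    proof (rule holomorphic_factor_order_of_zero[OF holf open_UNIV UNIV_I _ d(2)])
      show "0 < k" using False by simp
      show "(deriv ^^ i) f a = 0" if "i < k" for i using d(1) that by blast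
      fix g r assume r: "0 < r" "g holomorphic_on ball a r"
        "\<And>w. w \<in> ball a r \<Longrightarrow> f w - f a = (w - a)^k * g w" "\<And>w. w \<in> ball a r \<Longrightarrow> g w \<noteq> 0"
      have "g a \<noteq> 0" using r(1,4) by simp
      then show "has_mult f a k" unfolding has_mult_def using r(1-3) \<open>f a = 0\<close>
        by (intro exI[of _ g] exI[of _ r]) auto
    qed
  qed
  show ?thesis
  proof
    assume hm: "has_mult f a k"
    have "\<exists>n. (deriv ^^ n) f a \<noteq> 0"
    proof (rule ccontr)
      assume "\<nexists>n. (deriv ^^ n) f a \<noteq> 0"
      then have f0: "f w = 0" for w
        using holomorphic_fun_eq_0_on_connected[OF holf open_UNIV connected_UNIV, of a w] by auto
      obtain g r where r: "0 < r" "g holomorphic_on ball a r" "\<And>z. z \<in> ball a r \<Longrightarrow> f z = (z - a) ^ k * g z" "g a \<noteq> 0"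
        using hm unfolding has_mult_def by blast
      have False
      proof -
        have "isCont g a" using r(1,2) by (metis centre_in_ball continuous_on_interior holomorphic_on_imp_continuous_on interior_ball)
        then have "(g \<longlongrightarrow> g a) (at a)" by (simp add: isCont_def)
        moreover have "eventually (\<lambda>z. z \<in> ball a r) (at a)" using r(1) by (intro eventually_at_in_open') auto
        then have "eventually (\<lambda>z. g z = 0) (at a)" using eventually_neq_at_within[of a]
          by eventually_elim (use r(3) f0 in auto)
        ultimately have "((\<lambda>_. 0) \<longlongrightarrow> g a) (at a)" by (rule Lim_transform_eventually)
        then have "g a = 0" by (simp add: tendsto_const_iff)
        then show ?thesis using r(4) by simp
      qed
      then show False .
    qed
    define n where "n = (LEAST n. (deriv ^^ n) f a \<noteq> 0)"
    have n: "(deriv ^^ n) f a \<noteq> 0" "\<forall>j<n. (deriv ^^ j) f a = 0"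
      using LeastI_ex[OF \<open>\<exists>n. (deriv ^^ n) f a \<noteq> 0\<close>] not_less_Least unfolding n_def by blast+
    have "n = k" by (rule has_mult_unique[OF *[OF n(2,1)] hm])
    then show "(\<forall>j<k. (deriv ^^ j) f a = 0) \<and> (deriv ^^ k) f a \<noteq> 0" using n by simp
  qed (use * in blast)
qed

lemma is_zero_set_iff:
  "f holomorphic_on UNIV \<Longrightarrow> is_zero_set f m \<longleftrightarrow> (\<forall>a. has_mult f a (m a))"
  unfolding is_zero_set_def by (simp add: has_mult_iff_deriv)

definition zprod :: "(complex \<Rightarrow> nat) \<Rightarrow> complex set \<Rightarrow> complex \<Rightarrow> complex" where
  "zprod m A z = (\<Prod>a\<in>A. (z - a) ^ m a)"

text \<open>Stated as a product and not as a quotient, so that the cofactor is entire and has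
  meaningful values at the zeros that were divided out.\<close>

definition cofactor :: "(complex \<Rightarrow> complex) \<Rightarrow> (complex \<Rightarrow> nat) \<Rightarrow> complex set \<Rightarrow> (complex \<Rightarrow> complex) \<Rightarrow> bool" where
  "cofactor f m A g \<longleftrightarrow> g holomorphic_on UNIV \<and> (\<forall>z. f z = zprod m A z * g z)"

lemma zprod_holomorphic [holomorphic_intros]: "zprod m A holomorphic_on S"
  unfolding zprod_def by (intro holomorphic_intros)

lemma zprod_nonzero: "finite A \<Longrightarrow> z \<notin> A \<Longrightarrow> zprod m A z \<noteq> 0"
  unfolding zprod_def by (auto simp: prod_zero_iff)

lemma zprod_Diff: "finite B \<Longrightarrow> A \<subseteq> B \<Longrightarrow> zprod m B z = zprod m A z * zprod m (B - A) z"
  unfolding zprod_def by (simp add: prod.subset_diff mult.commute)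

lemma cofactor_nonzero:
  assumes f: "\<And>a. has_mult f a (m a)" and g: "cofactor f m A g" and A: "finite A" and a: "a \<in> A \<or> m a = 0"
  shows "g a \<noteq> 0"
proof
  assume g0: "g a = 0"
  have hol: "g holomorphic_on UNIV" and eq: "\<And>z. f z = zprod m A z * g z"
    using g by (auto simp: cofactor_def)
  obtain h r where h: "0 < r" "h holomorphic_on ball a r" "\<And>z. z \<in> ball a r \<Longrightarrow> f z = (z - a) ^ m a * h z" "h a \<noteq> 0"
    using f[of a] unfolding has_mult_def by blast
  show False
  proof (cases "a \<in> A")
    case False
    then have "f a = h a" using a h(1) h(3)[of a] by simp
    then show False using eq[of a] g0 h(4) by simp
  next
    case True
    have eq2: "f z = (z - a) ^ m a * (zprod m (A - {a}) z * g z)" for z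
      using eq[of z] zprod_Diff[OF A, of "{a}" m z] True by (simp add: zprod_def)
    have "isCont h a" using h(1,2) by (metis centre_in_ball continuous_on_interior holomorphic_on_imp_continuous_on interior_ball)
    then have l1: "(h \<longlongrightarrow> h a) (at a)" by (simp add: isCont_def)
    have "(\<lambda>z. zprod m (A - {a}) z * g z) holomorphic_on UNIV" by (intro holomorphic_intros hol)
    then have l2: "((\<lambda>z. zprod m (A - {a}) z * g z) \<longlongrightarrow> zprod m (A - {a}) a * g a) (at a)"
      by (rule holomorphic_UNIV_tendsto)
    have "eventually (\<lambda>z. z \<in> ball a r) (at a)" using h(1) by (intro eventually_at_in_open') auto
    then have "eventually (\<lambda>z. h z = zprod m (A - {a}) z * g z) (at a)"
      using eventually_neq_at_within[of a]
    proof eventually_elim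
      case (elim z)
      have "(z - a) ^ m a * h z = (z - a) ^ m a * (zprod m (A - {a}) z * g z)"
        using h(3)[OF elim(1)] eq2[of z] by (rule trans[OF sym])
      moreover have "(z - a) ^ m a \<noteq> 0" using elim(2) by simp
      ultimately show ?case using mult_left_cancel by blast
    qed
    then have "((\<lambda>z. zprod m (A - {a}) z * g z) \<longlongrightarrow> h a) (at a)" using l1 by (rule Lim_transform_eventually[rotated])
    then have "h a = zprod m (A - {a}) a * g a" using l2 LIM_unique by blast
    then show False using g0 h(4) by simp
  qed
qed

lemma cofactor_zero_iff:
  assumes f: "\<And>a. has_mult f a (m a)" and g: "cofactor f m A g" and A: "finite A"
  shows "g a = 0 \<longleftrightarrow> 0 < m a \<and> a \<notin> A"
proof
  assume "g a = 0" then show "0 < m a \<and> a \<notin> A" using cofactor_nonzero[OF f g A] by blast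
next
  assume a: "0 < m a \<and> a \<notin> A"
  obtain h r where "0 < r" "\<And>z. z \<in> ball a r \<Longrightarrow> f z = (z - a) ^ m a * h z"
    using f[of a] unfolding has_mult_def by blast
  then have "f a = 0" using a by simp
  then show "g a = 0" using g zprod_nonzero[OF A, of a m] a by (simp add: cofactor_def)
qed

text \<open>One point is divided out at a time. Near the new point \<open>b\<close> the quotient
  comes from the local factor \<open>h\<close>, elsewhere from plain division, and the two agree on
  the overlap.\<close>

lemma cofactor_exists:
  assumes holf: "f holomorphic_on UNIV" and f: "\<And>a. has_mult f a (m a)" and A: "finite A"
  shows "\<exists>g. cofactor f m A g"
  using A
proof induction
  case empty
  then show ?case using holf by (auto simp: cofactor_def zprod_def)
next
  case (insert b A)
  then obtain g where hol: "g holomorphic_on UNIV" and eq: "\<And>z. f z = zprod m A z * g z"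
    by (auto simp: cofactor_def)
  obtain h r where h: "0 < r" "h holomorphic_on ball b r" "\<And>z. z \<in> ball b r \<Longrightarrow> f z = (z - b) ^ m b * h z" "h b \<noteq> 0"
    using f[of b] unfolding has_mult_def by blast
  \<comment> \<open>Removing \<open>A\<close> from the ball makes \<open>zprod m A\<close>
    invertible on \<open>U\<close>, and \<open>b\<close> stays inside because it is not in
    \<open>A\<close>.\<close>
  define U where "U = ball b r - A"
  have U: "open U" "b \<in> U" using insert.hyps h(1) by (auto simp: U_def finite_imp_closed open_Diff)
  define G where "G = (\<lambda>z. if z \<in> U then h z / zprod m A z else g z / (z - b) ^ m b)"
  have ag: "h z / zprod m A z = g z / (z - b) ^ m b" if "z \<in> U" "z \<noteq> b" for z
    using eq[of z] h(3)[of z] zprod_nonzero[OF insert.hyps(1), of z m] that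
    by (simp add: U_def field_simps)
  have "G holomorphic_on (U \<union> (UNIV - {b}))" unfolding G_def
  proof (intro holomorphic_on_If_Un)
    show "(\<lambda>z. h z / zprod m A z) holomorphic_on U"
      by (intro holomorphic_intros holomorphic_on_subset[OF h(2)])
         (use zprod_nonzero[OF insert.hyps(1)] in \<open>auto simp: U_def\<close>)
    show "(\<lambda>z. g z / (z - b) ^ m b) holomorphic_on UNIV - {b}"
      by (intro holomorphic_intros holomorphic_on_subset[OF hol]) auto
  qed (use U ag in \<open>auto simp: open_delete\<close>)
  moreover have "U \<union> (UNIV - {b}) = UNIV" using U by auto
  moreover have "f z = zprod m (insert b A) z * G z" for z
  proof (cases "z = b")
    case True
    have "f b = (b - b) ^ m b * h b" using h(1) h(3)[of b] by simp
    then show ?thesis using True U zprod_nonzero[OF insert.hyps, of m] insert.hyps by (simp add: G_def zprod_def)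
  next
    case False
    then have "G z = g z / (z - b) ^ m b" using ag[of z] by (simp add: G_def)
    then show ?thesis using False eq[of z] insert.hyps by (simp add: zprod_def)
  qed
  ultimately show ?case unfolding cofactor_def by metis
qed

lemma cofactor_subset:
  assumes A: "A \<subseteq> B" "finite B" and g: "cofactor f m A g" and h: "cofactor f m B h"
  shows "g z = zprod m (B - A) z * h z"
proof -
  have finA: "finite A" using A finite_subset by blast
  have "(\<lambda>z. g z - zprod m (B - A) z * h z) z = 0"
  proof (rule analytic_continuation[of "\<lambda>z. g z - zprod m (B - A) z * h z" UNIV "UNIV - A" z])
    show "(\<lambda>z. g z - zprod m (B - A) z * h z) holomorphic_on UNIV"
      using g h by (intro holomorphic_intros) (auto simp: cofactor_def)
    show "z islimpt UNIV - A" using finA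
      by (metis UNIV_I islimpt_UNIV islimpt_Un_finite Diff_partition sup_commute top_greatest Un_Diff_cancel)
    show "g w - zprod m (B - A) w * h w = 0" if "w \<in> UNIV - A" for w
    proof -
      have "zprod m A w * g w = zprod m A w * (zprod m (B - A) w * h w)"
        using g h zprod_Diff[OF A(2,1), of m w] by (auto simp: cofactor_def mult.assoc)
      then show ?thesis using zprod_nonzero[OF finA] that by simp
    qed
  qed auto
  then show ?thesis by simp
qed

subsection \<open>Jensen's formula\<close>

lemma maximum_modulus_cball:
  assumes hol: "h holomorphic_on S" "open S" "cball c r \<subseteq> S" and r: "0 < r"
    and M: "\<And>z. dist z c = r \<Longrightarrow> norm (h z) \<le> M" and z: "z \<in> cball c r"
  shows "norm (h z) \<le> M"
proof (rule maximum_modulus_frontier[of h "cball c r"])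
  show "h holomorphic_on interior (cball c r)"
    using hol by (intro holomorphic_on_subset[OF hol(1)]) auto
  show "continuous_on (closure (cball c r)) h"
    using hol by (simp add: holomorphic_on_imp_continuous_on holomorphic_on_subset)
qed (use r M z in \<open>auto simp: dist_commute\<close>)

text \<open>On the circle r^2 = (z - c) cnj (z - c). Hence a factor z - a may be exchanged for one
  whose zero is the mirror image of \<open>a\<close> in the circle, with the same modulus on the
  circle.\<close>

lemma norm_disc_reflection:
  fixes a c z :: complex
  assumes "dist z c = r" "0 < r"
  shows "norm ((of_real (r\<^sup>2) - cnj (a - c) * (z - c)) / of_real r) = norm (z - a)"
proof -
  have "of_real (r\<^sup>2) = (z - c) * cnj (z - c)"
    using assms complex_norm_square[of "z - c"] by (simp add: dist_norm)
  then have "of_real (r\<^sup>2) - cnj (a - c) * (z - c) = (z - c) * cnj (z - a)"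
    by (simp add: algebra_simps)
  then show ?thesis using assms by (simp add: norm_mult norm_divide dist_norm flip: complex_cnj_diff)
qed

text \<open>One half of Jensen's formula without integrals: the exchanged factors keep |f| on the
  circle and have modulus r at the centre, so the maximum principle applies to the product
  \<open>h\<close>.\<close>

lemma cofactor_centre_le:
  assumes g: "cofactor f m A g" and r: "0 < r" and M: "\<And>z. dist z c = r \<Longrightarrow> norm (f z) \<le> M"
  shows "norm (g c) * (\<Prod>a\<in>A. r ^ m a) \<le> M"
proof -
  define h where "h = (\<lambda>z. g z * (\<Prod>a\<in>A. ((of_real (r\<^sup>2) - cnj (a - c) * (z - c)) / of_real r) ^ m a))"
  have "norm (h c) \<le> M"
  proof (rule maximum_modulus_cball[of h UNIV c r])
    show "h holomorphic_on UNIV" unfolding h_def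
      using g r by (intro holomorphic_intros) (auto simp: cofactor_def)
    show "norm (h z) \<le> M" if z: "dist z c = r" for z
    proof -
      have "norm (h z) = norm (g z) * (\<Prod>a\<in>A. norm ((of_real (r\<^sup>2) - cnj (a - c) * (z - c)) / of_real r) ^ m a)"
        by (simp only: h_def norm_mult prod_norm[symmetric] norm_power)
      also have "\<dots> = norm (g z) * (\<Prod>a\<in>A. norm (z - a) ^ m a)"
        by (simp only: norm_disc_reflection[OF z r])
      also have "\<dots> = norm (f z)"
        using g by (simp add: cofactor_def zprod_def norm_mult prod_norm[symmetric] norm_power mult.commute)
      finally show ?thesis using M[OF z] by simp
    qed
  qed (use r in auto)
  moreover have "norm (h c) = norm (g c) * (\<Prod>a\<in>A. r ^ m a)"
    using r by (simp add: h_def norm_mult prod_norm[symmetric] norm_power power2_eq_square)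
  ultimately show ?thesis by simp
qed

text \<open>The other half of Jensen's formula. With \<open>A\<close> in the open disc the mirror
  images lie outside the closed disc, so \<open>h\<close> is zero free there and the maximum
  principle applies to 1 / h.\<close>

lemma cofactor_centre_ge:
  assumes g: "cofactor f m A g" and r: "0 < r" and A: "finite A" "A \<subseteq> ball c r"
    and nz: "\<And>z. z \<in> cball c r \<Longrightarrow> g z \<noteq> 0"
    and \<delta>: "0 < \<delta>" "\<And>z. dist z c = r \<Longrightarrow> \<delta> \<le> norm (f z)"
  shows "\<delta> \<le> norm (g c) * (\<Prod>a\<in>A. r ^ m a)"
proof -
  define h where "h = (\<lambda>z. g z * (\<Prod>a\<in>A. ((of_real (r\<^sup>2) - cnj (a - c) * (z - c)) / of_real r) ^ m a))"
  have holh: "h holomorphic_on UNIV" unfolding h_def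
    using g r by (intro holomorphic_intros) (auto simp: cofactor_def)
  have hnz: "h z \<noteq> 0" if z: "z \<in> cball c r" for z
  proof -
    have "of_real (r\<^sup>2) - cnj (a - c) * (z - c) \<noteq> 0" if "a \<in> A" for a
    proof
      assume "of_real (r\<^sup>2) - cnj (a - c) * (z - c) = 0"
      then have "norm (of_real (r\<^sup>2) :: complex) = norm (cnj (a - c) * (z - c))" by simp
      then have "r\<^sup>2 = dist c a * dist c z"
        by (simp only: norm_mult complex_mod_cnj dist_norm norm_of_real) (simp add: norm_minus_commute)
      also have "\<dots> \<le> dist c a * r" using z by (intro mult_left_mono) auto
      also have "\<dots> < r * r" using that A r by (intro mult_strict_right_mono) auto
      finally show False by (simp add: power2_eq_square)
    qed
    then show ?thesis using nz[OF z] r A by (simp add: h_def prod_zero_iff)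
  qed
  have op: "open {z. h z \<noteq> 0}"
  proof -
    have "continuous_on UNIV h" using holh holomorphic_on_imp_continuous_on by blast
    then show ?thesis by (intro open_Collect_neq) auto
  qed
  have "norm (inverse (h c)) \<le> inverse \<delta>"
  proof (rule maximum_modulus_cball[of "\<lambda>z. inverse (h z)" "{z. h z \<noteq> 0}" c r])
    show "(\<lambda>z. inverse (h z)) holomorphic_on {z. h z \<noteq> 0}"
      by (intro holomorphic_intros holomorphic_on_subset[OF holh]) auto
    show "norm (inverse (h z)) \<le> inverse \<delta>" if z: "dist z c = r" for z
    proof -
      have "norm (h z) = norm (g z) * (\<Prod>a\<in>A. norm ((of_real (r\<^sup>2) - cnj (a - c) * (z - c)) / of_real r) ^ m a)"
        by (simp only: h_def norm_mult prod_norm[symmetric] norm_power)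
      also have "\<dots> = norm (g z) * (\<Prod>a\<in>A. norm (z - a) ^ m a)"
        by (simp only: norm_disc_reflection[OF z r])
      also have "\<dots> = norm (f z)"
        using g by (simp add: cofactor_def zprod_def norm_mult prod_norm[symmetric] norm_power mult.commute)
      finally show ?thesis using \<delta>(1) \<delta>(2)[OF z] by (simp add: norm_inverse le_imp_inverse_le)
    qed
  qed (use op hnz r in auto)
  then have "\<delta> \<le> norm (h c)" using \<delta>(1) hnz[of c] r by (simp add: norm_inverse)
  moreover have "norm (h c) = norm (g c) * (\<Prod>a\<in>A. r ^ m a)"
    using r by (simp add: h_def norm_mult prod_norm[symmetric] norm_power power2_eq_square)
  ultimately show ?thesis by simp
qed

text \<open>\<open>ln (jensen f m x)\<close> is the mean of \<open>ln \<bar>f\<bar>\<close> over the unit circle about \<open>x\<close> (Jensen's formula).\<close>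

definition jensen :: "(complex \<Rightarrow> complex) \<Rightarrow> (complex \<Rightarrow> nat) \<Rightarrow> complex \<Rightarrow> real" where
  "jensen f m x = norm ((SOME g. cofactor f m {a. 0 < m a \<and> dist a x \<le> 1} g) x)"

definition disc_zeros :: "(complex \<Rightarrow> nat) \<Rightarrow> real \<Rightarrow> complex set" where
  "disc_zeros m R = {a. 0 < m a \<and> norm a < R}"

lemma finite_count_set:
  assumes "locally_finite_mult m"
  shows "finite {a. 0 < m a \<and> dist a c \<le> r}"
proof (rule finite_subset)
  show "finite {a. 0 < m a \<and> norm a \<le> r + norm c}"
    using assms by (auto simp: locally_finite_mult_def)
  show "{a. 0 < m a \<and> dist a c \<le> r} \<subseteq> {a. 0 < m a \<and> norm a \<le> r + norm c}"
  proof safe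
    fix a assume "dist a c \<le> r"
    then show "norm a \<le> r + norm c" using norm_triangle_ineq2[of a c] by (simp add: dist_norm)
  qed
qed

lemma finite_disc_zeros:
  assumes "locally_finite_mult m"
  shows "finite (disc_zeros m R)"
  by (rule finite_subset[OF _ finite_count_set[OF assms, of 0 R]]) (auto simp: disc_zeros_def)

lemma count_fn_mono:
  assumes "locally_finite_mult m" "s \<le> t"
  shows "count_fn m c s \<le> count_fn m c t"
  unfolding count_fn_def by (rule sum_mono2) (use assms in \<open>auto simp: finite_count_set\<close>)

locale entire_zeros =
  fixes f :: "complex \<Rightarrow> complex" and m :: "complex \<Rightarrow> nat"
  assumes hol: "f holomorphic_on UNIV" and mult: "\<And>a. has_mult f a (m a)"
    and lf: "locally_finite_mult m"
begin

lemma ex_cofactor: "finite A \<Longrightarrow> \<exists>g. cofactor f m A g"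
  by (rule cofactor_exists[OF hol mult])

lemma zero_iff: "f z = 0 \<longleftrightarrow> 0 < m z"
proof -
  have "cofactor f m {} f" using hol by (simp add: cofactor_def zprod_def)
  then show ?thesis using cofactor_zero_iff[OF mult, of "{}" f z] by simp
qed

text \<open>Zeros dividing out of the larger set contribute their distance from \<open>x\<close>,
  those in the closed unit disc contribute 1. The free choice of \<open>A\<close> lets a single
  cofactor serve the centres 0 and x simultaneously.\<close>

lemma jensen_eq:
  assumes A: "finite A" "{a. 0 < m a \<and> dist a x \<le> 1} \<subseteq> A" and h: "cofactor f m A h"
  shows "jensen f m x = norm (h x) * (\<Prod>a\<in>A. max 1 (dist a x) ^ m a)"
proof -
  define A1 where "A1 = {a. 0 < m a \<and> dist a x \<le> 1}"
  define g where "g = (SOME g. cofactor f m A1 g)"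
  have g: "cofactor f m A1 g" unfolding g_def
    by (rule someI_ex[OF ex_cofactor]) (simp add: A1_def finite_count_set[OF lf])
  have sub: "A1 \<subseteq> A" using A by (simp add: A1_def)
  have "norm (g x) = norm (zprod m (A - A1) x) * norm (h x)"
    using cofactor_subset[OF sub A(1) g h] by (simp add: norm_mult)
  also have "norm (zprod m (A - A1) x) = (\<Prod>a\<in>A - A1. max 1 (dist a x) ^ m a)"
    unfolding zprod_def prod_norm[symmetric] norm_power
  proof (rule prod.cong)
    show "norm (x - a) ^ m a = max 1 (dist a x) ^ m a" if "a \<in> A - A1" for a
      using that by (cases "m a = 0") (auto simp: A1_def dist_norm norm_minus_commute max_def)
  qed simp
  also have "\<dots> = (\<Prod>a\<in>A. max 1 (dist a x) ^ m a)"
    by (rule prod.mono_neutral_left) (use A in \<open>auto simp: A1_def\<close>)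
  finally show ?thesis by (simp add: jensen_def g_def A1_def mult.commute)
qed

lemma jensen_pos: "0 < jensen f m x"
proof -
  define A1 where "A1 = {a. 0 < m a \<and> dist a x \<le> 1}"
  have fin: "finite A1" unfolding A1_def by (rule finite_count_set[OF lf])
  obtain g where g: "cofactor f m A1 g" using ex_cofactor[OF fin] by blast
  have "g x \<noteq> 0" by (rule cofactor_nonzero[OF mult g fin]) (auto simp: A1_def)
  moreover have "0 < (\<Prod>a\<in>A1. max 1 (dist a x) ^ m a)" by (intro prod_pos) auto
  ultimately show ?thesis using jensen_eq[OF fin _ g] by (simp add: A1_def)
qed

lemma jensen_le:
  assumes "\<And>z. dist z x = 1 \<Longrightarrow> norm (f z) \<le> M"
  shows "jensen f m x \<le> M"
proof -
  define A1 where "A1 = {a. 0 < m a \<and> dist a x \<le> 1}"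
  have fin: "finite A1" unfolding A1_def by (rule finite_count_set[OF lf])
  obtain g where g: "cofactor f m A1 g" using ex_cofactor[OF fin] by blast
  have "jensen f m x = norm (g x) * (\<Prod>a\<in>A1. max 1 (dist a x) ^ m a)"
    by (rule jensen_eq[OF fin _ g]) (simp add: A1_def)
  also have "(\<Prod>a\<in>A1. max 1 (dist a x) ^ m a) = (\<Prod>a\<in>A1. 1 ^ m a)"
    by (rule prod.cong) (auto simp: A1_def max_def)
  also have "norm (g x) * \<dots> \<le> M" by (rule cofactor_centre_le[OF g _ assms]) auto
  finally show ?thesis .
qed

lemma norm_le_jensen: "norm (f x) \<le> jensen f m x"
proof -
  define A1 where "A1 = {a. 0 < m a \<and> dist a x \<le> 1}"
  have fin: "finite A1" unfolding A1_def by (rule finite_count_set[OF lf])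
  obtain g where g: "cofactor f m A1 g" using ex_cofactor[OF fin] by blast
  have "norm (f x) = norm (g x) * (\<Prod>a\<in>A1. norm (x - a) ^ m a)"
    using g by (simp add: cofactor_def zprod_def norm_mult prod_norm[symmetric] norm_power)
  also have "\<dots> \<le> norm (g x) * (\<Prod>a\<in>A1. max 1 (dist a x) ^ m a)"
    by (intro mult_left_mono prod_mono conjI power_mono) (auto simp: dist_norm norm_minus_commute)
  also have "\<dots> = jensen f m x"
    by (rule jensen_eq[symmetric, OF fin _ g]) (simp add: A1_def)
  finally show ?thesis .
qed

text \<open>Means of ln |f| over concentric circles increase with the radius, so a lower bound on a
  smaller circle is enough. The free radius matters because a limit of translates may have zeros on
  the unit circle itself.\<close>

lemma jensen_ge:
  assumes r: "0 < r" "r \<le> 1" and \<delta>: "0 < \<delta>" "\<And>z. dist z x = r \<Longrightarrow> \<delta> \<le> norm (f z)"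
  shows "\<delta> \<le> jensen f m x"
proof -
  define A1 where "A1 = {a. 0 < m a \<and> dist a x \<le> 1}"
  define A where "A = {a. 0 < m a \<and> dist a x < r}"
  have fin1: "finite A1" unfolding A1_def by (rule finite_count_set[OF lf])
  have sub: "A \<subseteq> A1" using r by (auto simp: A_def A1_def)
  then have fin: "finite A" using fin1 finite_subset by blast
  obtain g where g: "cofactor f m A g" using ex_cofactor[OF fin] by blast
  obtain g1 where g1: "cofactor f m A1 g1" using ex_cofactor[OF fin1] by blast
  have "\<delta> \<le> norm (g x) * (\<Prod>a\<in>A. r ^ m a)"
  proof (rule cofactor_centre_ge[OF g r(1) fin])
    show "A \<subseteq> ball x r" by (auto simp: A_def dist_commute)
    show "g z \<noteq> 0" if z: "z \<in> cball x r" for z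
    proof
      assume "g z = 0"
      then have "0 < m z" "z \<notin> A" using cofactor_zero_iff[OF mult g fin] by auto
      then have "dist z x = r" "f z = 0" using z zero_iff by (auto simp: A_def dist_commute)
      then show False using \<delta> by fastforce
    qed
  qed (use \<delta> in auto)
  also have "\<dots> \<le> norm (g x) * 1"
    using r by (intro mult_left_mono prod_le_1 conjI power_le_one) auto
  also have "norm (g x) * 1 = norm (g1 x) * (\<Prod>a\<in>A1 - A. norm (x - a) ^ m a)"
    using cofactor_subset[OF sub fin1 g g1] by (simp add: norm_mult zprod_def prod_norm[symmetric] norm_power)
  also have "\<dots> \<le> norm (g1 x) * (\<Prod>a\<in>A1 - A. max 1 (dist a x) ^ m a)"
    by (intro mult_left_mono prod_mono conjI power_mono) (auto simp: dist_norm norm_minus_commute)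
  also have "(\<Prod>a\<in>A1 - A. max 1 (dist a x) ^ m a) = (\<Prod>a\<in>A1. max 1 (dist a x) ^ m a)"
    by (rule prod.mono_neutral_left) (use r fin1 in \<open>auto simp: A1_def A_def max_def\<close>)
  also have "norm (g1 x) * \<dots> = jensen f m x"
    by (rule jensen_eq[symmetric, OF fin1 _ g1]) (simp add: A1_def)
  finally show ?thesis .
qed

text \<open>Jensen on the circle of radius 2 r: each zero within distance r of the centre wins a
  factor of at least 2.\<close>

lemma two_power_count_le:
  assumes r: "1 \<le> r" and M: "\<And>z. dist z x = 2 * r \<Longrightarrow> norm (f z) \<le> M"
  shows "jensen f m x * 2 ^ count_fn m x r \<le> M"
proof -
  define A where "A = {a. 0 < m a \<and> dist a x \<le> r}"
  have fin: "finite A" unfolding A_def by (rule finite_count_set[OF lf])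
  obtain g where g: "cofactor f m A g" using ex_cofactor[OF fin] by blast
  have "jensen f m x = norm (g x) * (\<Prod>a\<in>A. max 1 (dist a x) ^ m a)"
    by (rule jensen_eq[OF fin _ g]) (use r in \<open>auto simp: A_def\<close>)
  also have "\<dots> \<le> norm (g x) * (\<Prod>a\<in>A. r ^ m a)"
    using r by (intro mult_left_mono prod_mono conjI power_mono) (auto simp: A_def)
  finally have "jensen f m x * 2 ^ count_fn m x r \<le> norm (g x) * (\<Prod>a\<in>A. r ^ m a) * 2 ^ count_fn m x r"
    by (rule mult_right_mono) simp
  also have "(2::real) ^ count_fn m x r = (\<Prod>a\<in>A. 2 ^ m a)"
    by (simp add: count_fn_def A_def power_sum)
  also have "norm (g x) * (\<Prod>a\<in>A. r ^ m a) * (\<Prod>a\<in>A. 2 ^ m a) = norm (g x) * (\<Prod>a\<in>A. (2 * r) ^ m a)"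
    by (simp add: prod.distrib power_mult_distrib)
  also have "\<dots> \<le> M" by (rule cofactor_centre_le[OF g _ M]) (use r in auto)
  finally show ?thesis by (simp add: count_fn_def A_def power_sum)
qed

end

section \<open>The counting integral of condition (iv)\<close>

lemma count_fn_integral:
  assumes T: "1 \<le> T" and A: "finite A" "{a. 0 < m a \<and> dist a c \<le> T} \<subseteq> A"
  shows "((\<lambda>t. real (count_fn m c t) / t) has_integral
           (\<Sum>a\<in>A. real (m a) * max 0 (ln T - ln (max 1 (dist a c))))) {1..T}"
proof -
  \<comment> \<open>A single zero at distance d contributes the integral of k / t from max 1 d to T.
    For d > T the truncated logarithm gives 0, which is why any finite superset \<open>A\<close> is
    allowed.\<close>
  have one: "((\<lambda>t. (if d \<le> t then k else 0) / t) has_integral k * max 0 (ln T - ln (max 1 d))) {1..T}"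
    for d k :: real
  proof (cases "d \<le> T")
    case True
    have "((\<lambda>t. k / t) has_integral (k * ln T - k * ln (max 1 d))) {max 1 d..T}"
      by (rule fundamental_theorem_of_calculus)
         (use True T in \<open>auto intro!: derivative_eq_intros simp: has_real_derivative_iff_has_vector_derivative[symmetric] field_simps\<close>)
    then have "((\<lambda>t. if t \<in> {max 1 d..T} then k / t else 0) has_integral (k * ln T - k * ln (max 1 d))) {1..T}"
      by (subst has_integral_restrict) auto
    moreover have "k * ln T - k * ln (max 1 d) = k * max 0 (ln T - ln (max 1 d))"
      using True T by (simp add: max_def algebra_simps)
    ultimately have "((\<lambda>t. if t \<in> {max 1 d..T} then k / t else 0) has_integral k * max 0 (ln T - ln (max 1 d))) {1..T}"
      by simp
    then show ?thesis by (rule has_integral_eq[rotated]) auto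
  next
    case False
    then have "ln T \<le> ln (max 1 d)" using T by simp
    then have "k * max 0 (ln T - ln (max 1 d)) = 0" by (simp add: max_def)
    moreover have "((\<lambda>t. (if d \<le> t then k else 0) / t) has_integral 0) {1..T}"
      by (rule has_integral_is_0) (use False in auto)
    ultimately show ?thesis by (simp only:)
  qed
  have "((\<lambda>t. \<Sum>a\<in>A. (if dist a c \<le> t then real (m a) else 0) / t) has_integral
           (\<Sum>a\<in>A. real (m a) * max 0 (ln T - ln (max 1 (dist a c))))) {1..T}"
    by (intro has_integral_sum A one)
  moreover have "(\<Sum>a\<in>A. (if dist a c \<le> t then real (m a) else 0) / t) = real (count_fn m c t) / t"
    if "t \<in> {1..T}" for t
  proof -
    have "(\<Sum>a\<in>A. (if dist a c \<le> t then real (m a) else 0)) = (\<Sum>a\<in>{a. 0 < m a \<and> dist a c \<le> t}. real (m a))"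
      by (rule sum.mono_neutral_cong_right) (use A that in auto)
    then show ?thesis by (simp add: count_fn_def flip: sum_divide_distrib)
  qed
  ultimately show ?thesis by (rule has_integral_eq[rotated])
qed

lemma annulus_count_small:
  assumes lf: "locally_finite_mult m"
    and iii: "(\<lambda>t. real (count_fn m 0 (t + 1)) - real (count_fn m 0 t)) \<in> o[at_top](\<lambda>t. t)"
    and p: "0 < p"
  shows "((\<lambda>T. (real (count_fn m 0 (T + p)) - real (count_fn m 0 (T - p))) / T) \<longlongrightarrow> 0) at_top"
proof -
  define n where "n = (\<lambda>t. real (count_fn m 0 t))"
  define D where "D = (\<lambda>t. n (t + 1) - n t)"
  \<comment> \<open>An annulus of width 2 p is covered by this many annuli of width 1, each
    controlled by (iii).\<close>
  define k where "k = nat \<lceil>2 * p\<rceil>"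
  have mono: "n s \<le> n t" if "s \<le> t" for s t unfolding n_def using count_fn_mono[OF lf that] by simp
  have D: "((\<lambda>t. D t / t) \<longlongrightarrow> 0) at_top" using smalloD_tendsto[OF iii] by (simp add: D_def n_def)
  have Dq: "((\<lambda>T. D (T + q) / T) \<longlongrightarrow> 0) at_top" for q :: real
  proof -
    have sh: "filterlim (\<lambda>T::real. T + q) at_top at_top"
      by real_asymp
    have "((\<lambda>T. D (T + q) / (T + q)) \<longlongrightarrow> 0) at_top" using filterlim_compose[OF D sh] .
    moreover have "((\<lambda>T::real. (T + q) / T) \<longlongrightarrow> 1) at_top" by real_asymp
    ultimately have "((\<lambda>T. D (T + q) / (T + q) * ((T + q) / T)) \<longlongrightarrow> 0 * 1) at_top" by (rule tendsto_mult)
    moreover have "eventually (\<lambda>T. D (T + q) / (T + q) * ((T + q) / T) = D (T + q) / T) at_top"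
      using eventually_gt_at_top[of "max 0 (-q)"] by eventually_elim auto
    ultimately show ?thesis using Lim_transform_eventually by fastforce
  qed
  have "((\<lambda>T. \<Sum>j<k. D (T + (real j - p)) / T) \<longlongrightarrow> (\<Sum>j<k. 0)) at_top"
    by (intro tendsto_sum Dq)
  then have lim: "((\<lambda>T. \<Sum>j<k. D (T + (real j - p)) / T) \<longlongrightarrow> 0) at_top" by simp
    show ?thesis
    proof (rule tendsto_sandwich[OF _ _ tendsto_const lim])
      show "\<forall>\<^sub>F T in at_top. 0 \<le> (real (count_fn m 0 (T + p)) - real (count_fn m 0 (T - p))) / T"
        using eventually_gt_at_top[of 0]
        by eventually_elim (use mono p in \<open>simp add: n_def\<close>)
      show "\<forall>\<^sub>F T in at_top. (real (count_fn m 0 (T + p)) - real (count_fn m 0 (T - p))) / T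
              \<le> (\<Sum>j<k. D (T + (real j - p)) / T)"
        using eventually_gt_at_top[of 0]
      proof eventually_elim
        case (elim T)
        have "(\<Sum>j<k. D (T + (real j - p))) = (\<Sum>j<k. n (T - p + real (Suc j)) - n (T - p + real j))"
          by (rule sum.cong) (auto simp: D_def algebra_simps)
        also have "\<dots> = n (T - p + real k) - n (T - p)"
          using sum_lessThan_telescope[of "\<lambda>j. n (T - p + real j)" k] by simp
        finally have "(\<Sum>j<k. D (T + (real j - p))) = n (T - p + real k) - n (T - p)" .
        moreover have "T + p \<le> T - p + real k" unfolding k_def by linarith
        ultimately have "n (T + p) - n (T - p) \<le> (\<Sum>j<k. D (T + (real j - p)))" using mono by simp
        then show ?case using elim unfolding sum_divide_distrib[symmetric]
          by (intro divide_right_mono) (auto simp: n_def)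
      qed
    qed
qed

context entire_zeros
begin

text \<open>Both counting functions are summed over the same finite set \<open>A T\<close>, so the
  terms ln T cancel except at zeros near the circle of radius T, which (iii) makes negligible. What
  remains is the difference of the logarithms of two instances of \<open>jensen_eq\<close> for one
  cofactor.\<close>

lemma count_integral_tendsto:
  assumes iii: "(\<lambda>t. real (count_fn m 0 (t + 1)) - real (count_fn m 0 t)) \<in> o[at_top](\<lambda>t. t)"
    and G: "\<And>R. cofactor f m (disc_zeros m R) (G R)"
    and lim: "((\<lambda>R. norm (G R (of_real x)) / norm (G R 0)) \<longlongrightarrow> 1) at_top"
  shows "((\<lambda>T. integral {1..T} (\<lambda>t. (real (count_fn m 0 t) - real (count_fn m (of_real x) t)) / t))
           \<longlongrightarrow> ln (jensen f m (of_real x) / jensen f m 0)) at_top"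
proof -
  define X :: complex where "X = of_real x"
  \<comment> \<open>Moving the centre from 0 to x changes distances by at most |x|; the extra 2
    leaves room for strict inequalities.\<close>
  define p where "p = \<bar>x\<bar> + 2"
  define Mx where "Mx = (\<lambda>c a :: complex. max 1 (dist a c))"
  \<comment> \<open>Since max 0 (ln T - v) = (ln T - v) + max 0 (v - ln T), this is the correction
    owed by zeros farther than T.\<close>
  define \<rho> where "\<rho> = (\<lambda>T c a. max 0 (ln (Mx c a) - ln T))"
  define A where "A = (\<lambda>T. disc_zeros m (T + p))"
  define E where "E = (\<lambda>T. \<Sum>a\<in>A T. real (m a) * (\<rho> T 0 a - \<rho> T X a))"
  have fin: "finite (A T)" for T unfolding A_def by (rule finite_disc_zeros[OF lf])
  have Mx1: "1 \<le> Mx c a" for c a by (simp add: Mx_def)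
  have Mx0: "0 < Mx c a" "Mx c a \<noteq> 0" for c a using Mx1[of c a] by linarith+
  have dX: "\<bar>dist a X - norm a\<bar> \<le> \<bar>x\<bar>" for a
    using norm_triangle_ineq3[of "a - X" a] by (simp add: dist_norm X_def)
  have subX: "{a. 0 < m a \<and> dist a X \<le> T} \<subseteq> A T" "{a. 0 < m a \<and> dist a 0 \<le> T} \<subseteq> A T" for T
  proof -
    have "norm a < T + p" if "dist a X \<le> T" for a using dX[of a] that by (simp add: p_def)
    then show "{a. 0 < m a \<and> dist a X \<le> T} \<subseteq> A T" by (auto simp: A_def disc_zeros_def)
    show "{a. 0 < m a \<and> dist a 0 \<le> T} \<subseteq> A T" by (auto simp: A_def disc_zeros_def p_def)
  qed
  have lnj: "(\<Sum>a\<in>A T. real (m a) * ln (Mx c a)) = ln (jensen f m c) - ln (norm (G (T + p) c))"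
    and Gpos: "0 < norm (G (T + p) c)"
    if T: "1 \<le> T" and c: "c = X \<or> c = 0" for c T
  proof -
      have sub1: "{a. 0 < m a \<and> dist a c \<le> 1} \<subseteq> A T" using subX[of T] T c by fastforce
      have jq: "jensen f m c = norm (G (T + p) c) * (\<Prod>a\<in>A T. Mx c a ^ m a)"
        unfolding Mx_def by (rule jensen_eq[OF fin sub1]) (use G in \<open>simp add: A_def\<close>)
      have "0 < (\<Prod>a\<in>A T. Mx c a ^ m a)" using Mx0 by (intro prod_pos) auto
      moreover show "0 < norm (G (T + p) c)" using jq jensen_pos[of c] by (metis norm_eq_zero less_irrefl mult_eq_0_iff zero_less_norm_iff)
      ultimately have "ln (jensen f m c) = ln (norm (G (T + p) c)) + ln (\<Prod>a\<in>A T. Mx c a ^ m a)"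
        unfolding jq by (rule ln_mult_pos[rotated])
      also have "ln (\<Prod>a\<in>A T. Mx c a ^ m a) = (\<Sum>a\<in>A T. real (m a) * ln (Mx c a))"
        using Mx0 fin by (subst ln_prod) (auto simp: ln_realpow)
      finally show "(\<Sum>a\<in>A T. real (m a) * ln (Mx c a)) = ln (jensen f m c) - ln (norm (G (T + p) c))" by simp
  qed
  have int: "integral {1..T} (\<lambda>t. (real (count_fn m 0 t) - real (count_fn m X t)) / t)
      = ln (jensen f m X / jensen f m 0) - ln (norm (G (T + p) X) / norm (G (T + p) 0)) + E T"
    if T: "1 \<le> T" for T
  proof -
    have "((\<lambda>t. real (count_fn m 0 t) / t - real (count_fn m X t) / t) has_integral
      (\<Sum>a\<in>A T. real (m a) * max 0 (ln T - ln (max 1 (dist a 0))))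
      - (\<Sum>a\<in>A T. real (m a) * max 0 (ln T - ln (max 1 (dist a X))))) {1..T}"
      by (intro has_integral_diff count_fn_integral T fin subX)
    then have "integral {1..T} (\<lambda>t. (real (count_fn m 0 t) - real (count_fn m X t)) / t)
      = (\<Sum>a\<in>A T. real (m a) * max 0 (ln T - ln (Mx 0 a))) - (\<Sum>a\<in>A T. real (m a) * max 0 (ln T - ln (Mx X a)))"
      unfolding Mx_def diff_divide_distrib by (rule integral_unique)
    also have "\<dots> = (\<Sum>a\<in>A T. real (m a) * (ln (Mx X a) - ln (Mx 0 a)) + real (m a) * (\<rho> T 0 a - \<rho> T X a))"
      unfolding sum_subtractf[symmetric] by (rule sum.cong) (auto simp: \<rho>_def max_def algebra_simps)
    also have "\<dots> = (\<Sum>a\<in>A T. real (m a) * ln (Mx X a)) - (\<Sum>a\<in>A T. real (m a) * ln (Mx 0 a)) + E T"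
      by (simp add: sum.distrib E_def right_diff_distrib sum_subtractf)
    also have "\<dots> = (ln (jensen f m X) - ln (norm (G (T + p) X))) - (ln (jensen f m 0) - ln (norm (G (T + p) 0))) + E T"
      using lnj[OF T, of X] lnj[OF T, of 0] by simp
    also have "\<dots> = ln (jensen f m X / jensen f m 0) - ln (norm (G (T + p) X) / norm (G (T + p) 0)) + E T"
      using jensen_pos[of X] jensen_pos[of 0] Gpos[OF T, of X] Gpos[OF T, of 0] by (simp add: ln_div)
    finally show ?thesis .
  qed
  have Ebound: "\<bar>E T\<bar> \<le> 2 * p * ((real (count_fn m 0 (T + p)) - real (count_fn m 0 (T - p))) / T)"
    if T: "1 + p \<le> T" for T
  proof -
    define C where "C = {a. 0 < m a \<and> dist a 0 \<le> T + p} - {a. 0 < m a \<and> dist a 0 \<le> T - p}"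
    define q where "q = 2 * p / T"
    have p: "2 \<le> p" by (simp add: p_def)
    have q0: "0 \<le> q" using p T by (simp add: q_def)
    have r0: "0 \<le> \<rho> T c a" for c a by (simp add: \<rho>_def)
    have rb: "\<rho> T c a \<le> q" if "Mx c a \<le> T + 2 * p" for c a
    proof -
      have "ln (Mx c a) - ln T = ln (Mx c a / T)" using Mx1[of c a] T p by (simp add: ln_div)
      also have "\<dots> \<le> Mx c a / T - 1" using Mx1[of c a] T p by (intro ln_le_minus_one) (auto intro!: divide_pos_pos)
      also have "Mx c a / T \<le> (T + 2 * p) / T" using that T p by (intro divide_right_mono) auto
      also have "(T + 2 * p) / T - 1 = q" using T p by (simp add: q_def add_divide_distrib)
      finally show ?thesis using q0 by (simp add: \<rho>_def)
    qed
    have trm: "\<bar>real (m a) * (\<rho> T 0 a - \<rho> T X a)\<bar> \<le> (if a \<in> C then real (m a) * q else 0)"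
      if a: "a \<in> A T" for a
    proof (cases "norm a \<le> T - p")
      case True
      then have "Mx 0 a \<le> T" "Mx X a \<le> T" using dX[of a] T by (auto simp: Mx_def p_def)
      then have "\<rho> T 0 a = 0" "\<rho> T X a = 0" using Mx1[of 0 a] Mx1[of X a] T p
        by (auto simp: \<rho>_def max_def intro!: antisym)
      then show ?thesis using q0 by simp
    next
      case False
      then have aC: "a \<in> C" using a by (auto simp: C_def A_def disc_zeros_def)
      have "norm a \<le> T + p" using a by (auto simp: A_def disc_zeros_def)
      then have "Mx 0 a \<le> T + 2 * p" "Mx X a \<le> T + 2 * p" using dX[of a] T p by (auto simp: Mx_def p_def)
      then have "\<bar>\<rho> T 0 a - \<rho> T X a\<bar> \<le> q" using rb r0 by (smt (verit))
      then show ?thesis using aC by (simp add: abs_mult mult_left_mono)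
    qed
    have finC: "finite C" unfolding C_def using finite_count_set[OF lf] by blast
    have "\<bar>E T\<bar> \<le> (\<Sum>a\<in>A T. \<bar>real (m a) * (\<rho> T 0 a - \<rho> T X a)\<bar>)" unfolding E_def by (rule sum_abs)
    also have "\<dots> \<le> (\<Sum>a\<in>A T. if a \<in> C then real (m a) * q else 0)" by (intro sum_mono trm)
    also have "\<dots> = (\<Sum>a\<in>A T \<inter> C. real (m a) * q)" by (simp add: sum.inter_restrict[OF fin])
    also have "\<dots> \<le> (\<Sum>a\<in>C. real (m a) * q)" using finC q0 by (intro sum_mono2) auto
    also have "\<dots> = (\<Sum>a\<in>C. real (m a)) * q" by (simp add: sum_distrib_right)
    also have "(\<Sum>a\<in>C. real (m a)) = real (count_fn m 0 (T + p)) - real (count_fn m 0 (T - p))"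
      unfolding C_def count_fn_def of_nat_sum
      by (rule sum_diff[OF finite_count_set[OF lf]]) (use p in auto)
    finally show ?thesis by (simp add: q_def mult.commute)
  qed
  have "((\<lambda>T. 2 * p * ((real (count_fn m 0 (T + p)) - real (count_fn m 0 (T - p))) / T)) \<longlongrightarrow> 2 * p * 0) at_top"
    by (intro tendsto_mult tendsto_const annulus_count_small lf iii) (simp add: p_def)
  moreover have "eventually (\<lambda>T. norm (E T) \<le> 2 * p * ((real (count_fn m 0 (T + p)) - real (count_fn m 0 (T - p))) / T)) at_top"
    using eventually_ge_at_top[of "1 + p"] by eventually_elim (use Ebound in simp)
  ultimately have E0: "(E \<longlongrightarrow> 0) at_top" by (intro Lim_null_comparison[of E]) auto
  have "((\<lambda>T. norm (G (T + p) X) / norm (G (T + p) 0)) \<longlongrightarrow> 1) at_top"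
    by (rule filterlim_compose[OF lim[folded X_def], of "\<lambda>T. T + p"]) real_asymp
  then have L: "((\<lambda>T. ln (norm (G (T + p) X) / norm (G (T + p) 0))) \<longlongrightarrow> ln 1) at_top" by (rule tendsto_ln) simp
  have "((\<lambda>T. ln (jensen f m X / jensen f m 0) - ln (norm (G (T + p) X) / norm (G (T + p) 0)) + E T)
      \<longlongrightarrow> ln (jensen f m X / jensen f m 0) - ln 1 + 0) at_top"
    by (intro tendsto_add tendsto_diff tendsto_const L E0)
  moreover have "eventually (\<lambda>T. ln (jensen f m X / jensen f m 0) - ln (norm (G (T + p) X) / norm (G (T + p) 0)) + E T
      = integral {1..T} (\<lambda>t. (real (count_fn m 0 t) - real (count_fn m X t)) / t)) at_top"
    using eventually_ge_at_top[of 1] by eventually_elim (use int in simp)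
  ultimately show ?thesis using Lim_transform_eventually unfolding X_def by fastforce
qed

end

subsection \<open>Products over zeros of linear density\<close>

lemma sum_mult_le_count_fn:
  assumes lf: "locally_finite_mult m" and A: "A \<subseteq> cball c t"
  shows "(\<Sum>a\<in>A. real (m a)) \<le> real (count_fn m c t)"
proof (cases "finite A")
  case True
  have "(\<Sum>a\<in>A. real (m a)) = (\<Sum>a\<in>{a\<in>A. 0 < m a}. real (m a))"
    by (rule sum.mono_neutral_right) (use True in auto)
  also have "\<dots> \<le> (\<Sum>a\<in>{a. 0 < m a \<and> dist a c \<le> t}. real (m a))"
    by (rule sum_mono2[OF finite_count_set[OF lf]]) (use A in \<open>auto simp: dist_commute\<close>)
  finally show ?thesis by (simp add: count_fn_def)
qed simp

definition recip_sum :: "(complex \<Rightarrow> nat) \<Rightarrow> real \<Rightarrow> complex" where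
  "recip_sum m R = (\<Sum>a\<in>{a. 0 < m a \<and> 0 < norm a \<and> norm a < R}. of_nat (m a) / a)"

lemma recip_sum_diff:
  assumes lf: "locally_finite_mult m" and R: "0 < R" "R \<le> R'"
  shows "recip_sum m R' - recip_sum m R = (\<Sum>a\<in>disc_zeros m R' - disc_zeros m R. of_nat (m a) / a)"
proof -
  have fin: "finite {a. 0 < m a \<and> 0 < norm a \<and> norm a < R'}"
    by (rule finite_subset[OF _ finite_disc_zeros[OF lf, of R']]) (auto simp: disc_zeros_def)
  have "recip_sum m R' - recip_sum m R
      = (\<Sum>a\<in>{a. 0 < m a \<and> 0 < norm a \<and> norm a < R'} - {a. 0 < m a \<and> 0 < norm a \<and> norm a < R}. of_nat (m a) / a)"
    unfolding recip_sum_def by (rule sum_diff[symmetric, OF fin]) (use R in auto)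
  also have "{a. 0 < m a \<and> 0 < norm a \<and> norm a < R'} - {a. 0 < m a \<and> 0 < norm a \<and> norm a < R}
      = disc_zeros m R' - disc_zeros m R"
    using R by (auto simp: disc_zeros_def)
  finally show ?thesis .
qed

locale linear_count =
  fixes m :: "complex \<Rightarrow> nat" and C :: real
  assumes lf: "locally_finite_mult m" and count_le: "\<And>t. 1 \<le> t \<Longrightarrow> real (count_fn m 0 t) \<le> C * t"
begin

lemma C_nonneg: "0 \<le> C"
  using count_le[of 1] of_nat_0_le_iff[of "count_fn m 0 1"] by linarith

text \<open>Dyadic shells: the shell between t and 2 t carries total multiplicity at most 2 C t at
  weight at most 1 / t^2, and the resulting 2 C / t sum geometrically to 4 C / R.\<close>

lemma sum_inverse_square_le:
  assumes R: "1 \<le> R" and A: "finite A" "\<And>a. a \<in> A \<Longrightarrow> R \<le> norm a"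
  shows "(\<Sum>a\<in>A. real (m a) / (norm a)\<^sup>2) \<le> 4 * C / R"
proof -
  define w where "w = (\<lambda>a. real (m a) / (norm a)\<^sup>2)"
  define B where "B = (\<lambda>k. {a\<in>A. norm a < 2 ^ k * R})"
  have finB: "finite (B k)" for k using A by (simp add: B_def)
  have dy: "sum w (B k) \<le> 4 * C / R * (1 - 1 / 2 ^ k)" for k
  proof (induction k)
    case 0
    have "B 0 = {}" using A by (fastforce simp: B_def)
    then show ?case by simp
  next
    case (Suc k)
    define t where "t = 2 ^ k * R"
    have t: "1 \<le> t" unfolding t_def using R mult_mono[of 1 "2^k" 1 R] by simp
    have "sum w (B (Suc k)) = sum w (B k) + sum w (B (Suc k) - B k)"
    proof -
      have "B k \<subseteq> B (Suc k)" using R by (auto simp: B_def intro: less_le_trans)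
      from sum.subset_diff[OF this finB, of w] show ?thesis by simp
    qed
    also have "sum w (B (Suc k) - B k) \<le> (\<Sum>a\<in>B (Suc k) - B k. real (m a) / t\<^sup>2)"
    proof (rule sum_mono)
      fix a assume "a \<in> B (Suc k) - B k"
      then have "t \<le> norm a" by (auto simp: B_def t_def)
      then show "w a \<le> real (m a) / t\<^sup>2" unfolding w_def using t
        by (intro divide_left_mono power_mono) (auto simp: zero_less_mult_iff)
    qed
    also have "\<dots> = (\<Sum>a\<in>B (Suc k) - B k. real (m a)) / t\<^sup>2" by (simp add: sum_divide_distrib)
    also have "\<dots> \<le> C * (2 * t) / t\<^sup>2"
    proof (rule divide_right_mono)
      have "(\<Sum>a\<in>B (Suc k) - B k. real (m a)) \<le> real (count_fn m 0 (2 * t))"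
        by (rule sum_mult_le_count_fn[OF lf]) (auto simp: B_def t_def)
      also have "\<dots> \<le> C * (2 * t)" using t by (intro count_le) auto
      finally show "(\<Sum>a\<in>B (Suc k) - B k. real (m a)) \<le> C * (2 * t)" .
    qed simp
    also have "C * (2 * t) / t\<^sup>2 = 2 * C / t" using t by (simp add: power2_eq_square)
    also have "\<dots> = 4 * C / R * (1 / 2 ^ k - 1 / 2 ^ Suc k)" using R by (simp add: t_def field_simps)
    finally have "sum w (B (Suc k)) \<le> sum w (B k) + 4 * C / R * (1 / 2 ^ k - 1 / 2 ^ Suc k)" by simp
    also have "\<dots> \<le> 4 * C / R * (1 - 1 / 2 ^ k) + 4 * C / R * (1 / 2 ^ k - 1 / 2 ^ Suc k)"
      using Suc.IH by simp
    also have "\<dots> = 4 * C / R * (1 - 1 / 2 ^ Suc k)"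
      unfolding distrib_left[symmetric] by simp
    finally show ?case .
  qed
  obtain k where k: "(\<Sum>a\<in>A. norm a) / R < 2 ^ k" using real_arch_pow[of 2] by auto
  have "norm a < 2 ^ k * R" if "a \<in> A" for a
  proof -
    have "norm a \<le> (\<Sum>a\<in>A. norm a)" using A that by (intro member_le_sum) auto
    then show ?thesis using k R by (simp add: divide_less_eq)
  qed
  then have "B k = A" by (auto simp: B_def)
  then have "sum w A \<le> 4 * C / R * (1 - 1 / 2 ^ k)" using dy[of k] by simp
  also have "\<dots> \<le> 4 * C / R * 1" using C_nonneg R by (intro mult_left_mono) auto
  finally show ?thesis by (simp add: w_def)
qed

text \<open>From 2^k to 2^(k+1) every old logarithm grows by at most 1, because 2 <= e, and every
  new zero has logarithm at most 2. The increment is at most C 2^k + 4 C 2^k, hence the constant 5.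
  The bound gives exponential type for the product.\<close>

lemma sum_ln_dyadic_le:
  "(\<Sum>a\<in>{a. 0 < m a \<and> 1 \<le> norm a \<and> norm a < 2 ^ k}. real (m a) * ln (1 + 2 ^ k / norm a)) \<le> 5 * C * 2 ^ k"
proof -
  define B where "B = (\<lambda>k::nat. {a. 0 < m a \<and> 1 \<le> norm a \<and> norm a < 2 ^ k})"
  define v where "v = (\<lambda>k a. real (m a) * ln (1 + 2 ^ k / norm a))"
  have finB: "finite (B k)" for k
    by (rule finite_subset[OF _ finite_disc_zeros[OF lf, of "2^k"]]) (auto simp: B_def disc_zeros_def)
  have cB: "(\<Sum>a\<in>D. real (m a)) \<le> C * 2 ^ k" if "D \<subseteq> B k" for D k
  proof -
    have "(\<Sum>a\<in>D. real (m a)) \<le> real (count_fn m 0 (2 ^ k))"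
      by (rule sum_mult_le_count_fn[OF lf]) (use that in \<open>auto simp: B_def\<close>)
    also have "\<dots> \<le> C * 2 ^ k" by (intro count_le) simp
    finally show ?thesis .
  qed
  have "sum (v k) (B k) \<le> 5 * C * (2 ^ k - 1)"
  proof (induction k)
    case 0
    have "B 0 = {}" by (auto simp: B_def)
    then show ?case by simp
  next
    case (Suc k)
    have sub: "B k \<subseteq> B (Suc k)" by (auto simp: B_def intro: less_le_trans)
    have step: "v (Suc k) a \<le> v k a + real (m a)" if "a \<in> B k" for a
    proof -
      have a: "1 \<le> norm a" using that by (simp add: B_def)
      have "ln (1 + 2 ^ Suc k / norm a) \<le> ln (exp 1 * (1 + 2 ^ k / norm a))"
      proof (subst ln_le_cancel_iff)
        have "1 + 2 ^ Suc k / norm a \<le> 2 * (1 + 2 ^ k / norm a)" using a by simp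
        also have "\<dots> \<le> exp 1 * (1 + 2 ^ k / norm a)"
          using exp_ge_add_one_self[of 1] a by (intro mult_right_mono) auto
        finally show "1 + 2 ^ Suc k / norm a \<le> exp 1 * (1 + 2 ^ k / norm a)" .
      qed (use a in \<open>auto intro!: add_pos_nonneg mult_pos_pos\<close>)
      also have "\<dots> = 1 + ln (1 + 2 ^ k / norm a)" by (subst ln_mult_pos) (auto intro!: add_pos_nonneg)
      finally have "real (m a) * ln (1 + 2 ^ Suc k / norm a) \<le> real (m a) * (1 + ln (1 + 2 ^ k / norm a))"
        by (rule mult_left_mono) simp
      then show ?thesis by (simp add: v_def algebra_simps)
    qed
    have new: "v (Suc k) a \<le> 2 * real (m a)" if "a \<in> B (Suc k) - B k" for a
    proof -
      have a: "2 ^ k \<le> norm a" using that by (auto simp: B_def)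
      then have "0 < norm a" by (smt (verit) zero_less_power)
      then have "2 ^ Suc k / norm a \<le> 2" using a by (simp add: divide_le_eq)
      moreover have "ln (1 + 2 ^ Suc k / norm a) \<le> 2 ^ Suc k / norm a" by (rule ln_add_one_self_le_self) simp
      ultimately have "ln (1 + 2 ^ Suc k / norm a) \<le> 2" by linarith
      then have "real (m a) * ln (1 + 2 ^ Suc k / norm a) \<le> real (m a) * 2" by (rule mult_left_mono) simp
      then show ?thesis by (simp add: v_def mult.commute)
    qed
    have "sum (v (Suc k)) (B (Suc k)) = sum (v (Suc k)) (B (Suc k) - B k) + sum (v (Suc k)) (B k)"
      by (rule sum.subset_diff[OF sub finB])
    also have "\<dots> \<le> (\<Sum>a\<in>B (Suc k) - B k. 2 * real (m a)) + (\<Sum>a\<in>B k. v k a + real (m a))"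
      by (intro add_mono sum_mono step new)
    also have "\<dots> = 2 * (\<Sum>a\<in>B (Suc k) - B k. real (m a)) + (sum (v k) (B k) + (\<Sum>a\<in>B k. real (m a)))"
      by (simp add: sum.distrib sum_distrib_left)
    also have "\<dots> \<le> 2 * (C * 2 ^ Suc k) + (5 * C * (2 ^ k - 1) + C * 2 ^ k)"
      by (intro add_mono mult_left_mono cB Suc.IH) auto
    finally show ?case by (simp add: algebra_simps)
  qed
  then show ?thesis using C_nonneg by (simp add: B_def v_def algebra_simps)
qed

text \<open>Plain factors without the exponentials of the Weierstrass product: with linear density,
  convergence over growing discs rests on condition (i).\<close>

definition partial_prod :: "real \<Rightarrow> complex \<Rightarrow> complex" where
  "partial_prod R z = z ^ m 0 * (\<Prod>a\<in>disc_zeros m R - {0}. (1 - z / a) ^ m a)"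

text \<open>A logarithm of the quotient of two partial products. For |z| <= R / 2 each ratio z / a
  has modulus at most 1 / 2, so the principal branch is holomorphic there.\<close>

definition logtail :: "real \<Rightarrow> real \<Rightarrow> complex \<Rightarrow> complex" where
  "logtail R N z = (\<Sum>a\<in>disc_zeros m N - disc_zeros m R. of_nat (m a) * Ln (1 - z / a))"

lemma finite_dz: "finite (disc_zeros m R)"
  by (rule finite_disc_zeros[OF lf])

lemma partial_prod_eq:
  assumes R: "0 < R"
  shows "partial_prod R z = (\<Prod>a\<in>disc_zeros m R - {0}. (- 1 / a) ^ m a) * zprod m (disc_zeros m R) z"
proof -
  have "zprod m (disc_zeros m R) z = z ^ m 0 * (\<Prod>a\<in>disc_zeros m R - {0}. (z - a) ^ m a)"
  proof (cases "0 \<in> disc_zeros m R")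
    case True
    then show ?thesis unfolding zprod_def by (subst prod.remove[OF finite_dz True]) simp
  next
    case False
    then have "m 0 = 0" using R by (simp add: disc_zeros_def)
    then show ?thesis using False by (simp add: zprod_def)
  qed
  moreover have "(\<Prod>a\<in>disc_zeros m R - {0}. (1 - z / a) ^ m a)
    = (\<Prod>a\<in>disc_zeros m R - {0}. (- 1 / a) ^ m a) * (\<Prod>a\<in>disc_zeros m R - {0}. (z - a) ^ m a)"
    unfolding prod.distrib[symmetric] power_mult_distrib[symmetric]
  proof (rule prod.cong)
    fix a assume "a \<in> disc_zeros m R - {0}"
    then have "1 - z / a = - 1 / a * (z - a)" by (simp add: field_simps)
    then show "(1 - z / a) ^ m a = (- 1 / a * (z - a)) ^ m a" by (simp only:)
  qed simp
  ultimately show ?thesis by (simp add: partial_prod_def)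
qed

lemma half_ratio:
  fixes z a :: complex
  assumes "norm z \<le> R / 2" "R \<le> norm a" "0 < R"
  shows "norm (z / a) \<le> 1 / 2" "1 - z / a \<notin> \<real>\<^sub>\<le>\<^sub>0" "1 - z / a \<noteq> 0"
proof -
  show 1: "norm (z / a) \<le> 1 / 2" using assms by (simp add: norm_divide divide_le_eq)
  have "Re (z / a) \<le> 1 / 2" using 1 complex_Re_le_cmod[of "z / a"] by linarith
  then have "0 < Re (1 - z / a)" by simp
  then show "1 - z / a \<notin> \<real>\<^sub>\<le>\<^sub>0" "1 - z / a \<noteq> 0" by (auto simp: complex_nonpos_Reals_iff)
qed

lemma partial_prod_split:
  assumes R: "0 < R" "R \<le> N" and z: "norm z \<le> R / 2"
  shows "partial_prod N z = partial_prod R z * exp (logtail R N z)"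
proof -
  have "exp (logtail R N z) = (\<Prod>a\<in>disc_zeros m N - disc_zeros m R. (1 - z / a) ^ m a)"
    unfolding logtail_def exp_sum[OF finite_Diff[OF finite_dz]]
  proof (rule prod.cong)
    fix a assume "a \<in> disc_zeros m N - disc_zeros m R"
    then have "R \<le> norm a" by (auto simp: disc_zeros_def)
    then show "exp (of_nat (m a) * Ln (1 - z / a)) = (1 - z / a) ^ m a"
      using half_ratio(3)[OF z _ R(1)] by (simp add: exp_of_nat_mult)
  qed simp
  moreover have "(\<Prod>a\<in>disc_zeros m N - {0}. (1 - z / a) ^ m a)
    = (\<Prod>a\<in>(disc_zeros m N - {0}) - (disc_zeros m R - {0}). (1 - z / a) ^ m a) * (\<Prod>a\<in>disc_zeros m R - {0}. (1 - z / a) ^ m a)"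
    by (rule prod.subset_diff) (use R finite_dz in \<open>auto simp: disc_zeros_def\<close>)
  moreover have "(disc_zeros m N - {0}) - (disc_zeros m R - {0}) = disc_zeros m N - disc_zeros m R"
    using R by (auto simp: disc_zeros_def)
  ultimately show ?thesis by (simp add: partial_prod_def)
qed

text \<open>Ln (1 - u) = - u + O(u^2): the linear parts add up to a difference of
  \<open>recip_sum\<close>, while the squares are covered by \<open>sum_inverse_square_le\<close>; 8
  = 2 * 4.\<close>

lemma logtail_diff:
  assumes R: "0 < R" "R \<le> M" "1 \<le> M" "M \<le> N" and z: "norm z \<le> R / 2"
  shows "norm (logtail R N z - logtail R M z) \<le> norm z * norm (recip_sum m N - recip_sum m M) + 8 * C * (norm z)\<^sup>2 / M"
proof -
  define D where "D = disc_zeros m N - disc_zeros m M"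
  have finD: "finite D" unfolding D_def using finite_dz by auto
  have DM: "M \<le> norm a" if "a \<in> D" for a using that by (auto simp: D_def disc_zeros_def)
  have eqD: "disc_zeros m N - disc_zeros m R - (disc_zeros m M - disc_zeros m R) = D"
    using R by (auto simp: D_def disc_zeros_def)
  have "logtail R N z - logtail R M z = (\<Sum>a\<in>D. of_nat (m a) * Ln (1 - z / a))"
    unfolding logtail_def eqD[symmetric] by (rule sum_diff[symmetric]) (use R finite_dz in \<open>auto simp: disc_zeros_def\<close>)
  also have "\<dots> = (\<Sum>a\<in>D. of_nat (m a) * (Ln (1 - z / a) + z / a)) - z * (\<Sum>a\<in>D. of_nat (m a) / a)"
    unfolding sum_distrib_left sum_subtractf[symmetric] by (rule sum.cong) (auto simp: algebra_simps)
  also have "(\<Sum>a\<in>D. of_nat (m a) / a) = recip_sum m N - recip_sum m M"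
    unfolding D_def by (rule recip_sum_diff[symmetric, OF lf]) (use R in auto)
  finally have eq: "logtail R N z - logtail R M z
    = (\<Sum>a\<in>D. of_nat (m a) * (Ln (1 - z / a) + z / a)) - z * (recip_sum m N - recip_sum m M)" .
  have "norm (\<Sum>a\<in>D. of_nat (m a) * (Ln (1 - z / a) + z / a)) \<le> (\<Sum>a\<in>D. (2 * (norm z)\<^sup>2) * (real (m a) / (norm a)\<^sup>2))"
  proof (rule sum_norm_le)
    fix a assume a: "a \<in> D"
    have h: "norm (z / a) \<le> 1 / 2" using half_ratio(1)[OF z _ R(1)] DM[OF a] R by simp
    have "norm (Ln (1 + - (z / a)) - - (z / a)) \<le> (norm (- (z / a)))\<^sup>2 / (1 - norm (- (z / a)))"
      by (rule Ln_approx_linear) (use h in simp)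
    also have "\<dots> \<le> (norm (z / a))\<^sup>2 / (1 / 2)" using h by (intro frac_le) auto
    finally have "norm (Ln (1 - z / a) + z / a) \<le> 2 * (norm z)\<^sup>2 / (norm a)\<^sup>2"
      by (simp add: norm_divide power_divide mult.commute)
    then have "real (m a) * norm (Ln (1 - z / a) + z / a) \<le> real (m a) * (2 * (norm z)\<^sup>2 / (norm a)\<^sup>2)"
      by (rule mult_left_mono) simp
    then show "norm (of_nat (m a) * (Ln (1 - z / a) + z / a)) \<le> 2 * (norm z)\<^sup>2 * (real (m a) / (norm a)\<^sup>2)"
      by (simp add: norm_mult mult_ac)
  qed
  also have "\<dots> = 2 * (norm z)\<^sup>2 * (\<Sum>a\<in>D. real (m a) / (norm a)\<^sup>2)" by (simp add: sum_distrib_left)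
  also have "\<dots> \<le> 2 * (norm z)\<^sup>2 * (4 * C / M)"
    by (intro mult_left_mono sum_inverse_square_le finD DM) (use R in auto)
  finally have "norm (\<Sum>a\<in>D. of_nat (m a) * (Ln (1 - z / a) + z / a)) \<le> 8 * C * (norm z)\<^sup>2 / M"
    by (simp add: mult_ac)
  then show ?thesis unfolding eq
    by (intro order_trans[OF norm_triangle_ineq4]) (simp add: norm_mult)
qed

lemma logtail_le:
  assumes R: "1 \<le> R" "R \<le> N" and z: "norm z \<le> R / 2"
  shows "norm (logtail R N z) \<le> norm z * norm (recip_sum m N - recip_sum m R) + 8 * C * (norm z)\<^sup>2 / R"
proof -
  have "logtail R R z = 0" by (simp add: logtail_def)
  then show ?thesis using logtail_diff[of R R N z] R z by simp
qed

lemma logtail_holomorphic: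
  assumes R: "0 < R"
  shows "logtail R N holomorphic_on cball 0 (R / 2)"
  unfolding logtail_def
proof (intro holomorphic_intros)
  fix a z :: complex assume a: "a \<in> disc_zeros m N - disc_zeros m R" and z: "z \<in> cball 0 (R / 2)"
  then have "R \<le> norm a" "norm z \<le> R / 2" by (auto simp: disc_zeros_def)
  then show "1 - z / a \<notin> \<real>\<^sub>\<le>\<^sub>0" using half_ratio(2) R by blast
qed (use R in \<open>auto simp: disc_zeros_def\<close>)

text \<open>The logarithms of the tails are uniformly Cauchy on the disc of radius R / 2. Their
  limit l is returned with an explicit bound, since both the growth of the product and its
  comparison with the cofactors depend on that bound.\<close>

lemma ex_product:
  assumes L: "(recip_sum m \<longlongrightarrow> L) at_top"
  obtains f where "f holomorphic_on UNIV" "\<And>a. has_mult f a (m a)"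
    "\<And>R. 1 \<le> R \<Longrightarrow> \<exists>l. l holomorphic_on ball 0 (R / 2) \<and>
      (\<forall>z. norm z < R / 2 \<longrightarrow> f z = partial_prod R z * exp (l z) \<and>
        norm (l z) \<le> norm z * norm (L - recip_sum m R) + 8 * C * (norm z)\<^sup>2 / R)"
proof -
  define f where "f = (\<lambda>z. lim (\<lambda>n::nat. partial_prod (real n) z))"
  have Ln: "(\<lambda>n. recip_sum m (real n)) \<longlonglongrightarrow> L"
    by (rule filterlim_compose[OF L filterlim_real_sequentially])
  have main: "\<exists>l. l holomorphic_on ball 0 (R / 2) \<and>
      (\<forall>z. norm z < R / 2 \<longrightarrow> f z = partial_prod R z * exp (l z) \<and>
        norm (l z) \<le> norm z * norm (L - recip_sum m R) + 8 * C * (norm z)\<^sup>2 / R)" if R: "1 \<le> R" for R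
  proof -
    have "uniformly_Cauchy_on (cball 0 (R / 2)) (\<lambda>n. logtail R (real n))"
    proof (rule uniformly_Cauchy_onI')
      fix e :: real assume e: "0 < e"
      define e' where "e' = e / (2 * R)"
      have e': "0 < e'" using e R by (simp add: e'_def)
      obtain M0 where M0: "\<And>i j. M0 \<le> i \<Longrightarrow> M0 \<le> j \<Longrightarrow> norm (recip_sum m (real i) - recip_sum m (real j)) < e'"
        using LIMSEQ_imp_Cauchy[OF Ln] e' unfolding Cauchy_iff by blast
      \<comment> \<open>From here on the quadratic part is at most e / 4, and the linear part is at
        most R / 2 times e', that is e / 4.\<close>
      define M where "M = max M0 (nat \<lceil>R + 8 * C * R\<^sup>2 / e\<rceil> + 1)"
      have MR: "R + 8 * C * R\<^sup>2 / e \<le> real M" unfolding M_def by linarith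
      have "dist (logtail R (real i) z) (logtail R (real j) z) < e" if "z \<in> cball 0 (R / 2)" "M \<le> i" "i < j" for i j and z :: complex
      proof -
        have z: "norm z \<le> R / 2" using that by simp
        have iM: "R + 8 * C * R\<^sup>2 / e \<le> real i" using MR that by linarith
        have q0: "0 \<le> 8 * C * R\<^sup>2 / e" using C_nonneg e by simp
        have "norm (logtail R (real j) z - logtail R (real i) z)
          \<le> norm z * norm (recip_sum m (real j) - recip_sum m (real i)) + 8 * C * (norm z)\<^sup>2 / real i"
          by (rule logtail_diff) (use R iM q0 that z in auto)
        also have "norm z * norm (recip_sum m (real j) - recip_sum m (real i)) \<le> R / 2 * e'"
          using z M0[of j i] that R by (intro mult_mono) (auto simp: M_def)
        also have "R / 2 * e' = e / 4" using R by (simp add: e'_def)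
        also have "8 * C * (norm z)\<^sup>2 / real i \<le> e / 4"
        proof -
          have "8 * C * R\<^sup>2 / e \<le> real i" using iM R by linarith
          then have "8 * C * R\<^sup>2 \<le> e * real i" using e by (simp add: pos_divide_le_eq mult.commute)
          moreover have "(norm z)\<^sup>2 \<le> (R / 2)\<^sup>2" using z by (intro power_mono) auto
          then have "8 * C * (norm z)\<^sup>2 \<le> 8 * C * (R / 2)\<^sup>2" using C_nonneg by (intro mult_left_mono) auto
          ultimately have "8 * C * (norm z)\<^sup>2 \<le> e / 4 * real i" by (simp add: power_divide)
          moreover have "0 < real i" using iM R q0 by linarith
          ultimately show ?thesis by (simp add: divide_le_eq)
        qed
        finally show ?thesis using e by (simp add: dist_norm norm_minus_commute)
      qed
      then show "\<exists>M. \<forall>x\<in>cball 0 (R / 2). \<forall>i\<ge>M. \<forall>j>i. dist (logtail R (real i) x) (logtail R (real j) x) < e"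
        by blast
    qed
    then have "uniformly_convergent_on (cball 0 (R / 2)) (\<lambda>n. logtail R (real n))"
      by (rule Cauchy_uniformly_convergent)
    then obtain l where l: "uniform_limit (cball 0 (R / 2)) (\<lambda>n. logtail R (real n)) l sequentially"
      unfolding uniformly_convergent_on_def by blast
    have lp: "(\<lambda>n. logtail R (real n) z) \<longlonglongrightarrow> l z" if "norm z < R / 2" for z
      by (rule tendsto_uniform_limitI[OF l]) (use that in auto)
    have "l holomorphic_on ball 0 (R / 2)"
    proof (rule holomorphic_uniform_sequence[of _ "\<lambda>n. logtail R (real n)"])
      show "logtail R (real n) holomorphic_on ball 0 (R / 2)" for n
        by (rule holomorphic_on_subset[OF logtail_holomorphic]) (use R in auto)
      fix x :: complex assume "x \<in> ball 0 (R / 2)"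
      then obtain d where "0 < d" "cball x d \<subseteq> ball 0 (R / 2)" using iffD1[OF open_contains_cball open_ball] by blast
      moreover from this have "uniform_limit (cball x d) (\<lambda>n. logtail R (real n)) l sequentially"
        by (intro uniform_limit_on_subset[OF l]) (auto simp: subset_iff)
      ultimately show "\<exists>d>0. cball x d \<subseteq> ball 0 (R / 2) \<and> uniform_limit (cball x d) (\<lambda>n. logtail R (real n)) l sequentially"
        by (intro exI[of _ d] conjI)
    qed auto
    moreover have "f z = partial_prod R z * exp (l z)" if z: "norm z < R / 2" for z
    proof -
      have "(\<lambda>n. partial_prod R z * exp (logtail R (real n) z)) \<longlonglongrightarrow> partial_prod R z * exp (l z)"
        by (intro tendsto_intros lp z)
      moreover have "eventually (\<lambda>n. partial_prod R z * exp (logtail R (real n) z) = partial_prod (real n) z) sequentially"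
        using eventually_ge_at_top[of "nat \<lceil>R\<rceil>"]
      proof eventually_elim
        case (elim n)
        then have "R \<le> real n" by linarith
        then show ?case using partial_prod_split[of R "real n" z] R z by simp
      qed
      ultimately have "(\<lambda>n. partial_prod (real n) z) \<longlonglongrightarrow> partial_prod R z * exp (l z)" by (rule Lim_transform_eventually)
      then show ?thesis unfolding f_def by (rule limI)
    qed
    moreover have "norm (l z) \<le> norm z * norm (L - recip_sum m R) + 8 * C * (norm z)\<^sup>2 / R" if z: "norm z < R / 2" for z
    proof (rule tendsto_le[OF sequentially_bot])
      show "(\<lambda>n. norm (logtail R (real n) z)) \<longlonglongrightarrow> norm (l z)" by (intro tendsto_intros lp z)
      show "(\<lambda>n. norm z * norm (recip_sum m (real n) - recip_sum m R) + 8 * C * (norm z)\<^sup>2 / R)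
        \<longlonglongrightarrow> norm z * norm (L - recip_sum m R) + 8 * C * (norm z)\<^sup>2 / R"
        by (intro tendsto_add tendsto_mult tendsto_norm tendsto_diff tendsto_const Ln)
      show "\<forall>\<^sub>F n in sequentially. norm (logtail R (real n) z)
        \<le> norm z * norm (recip_sum m (real n) - recip_sum m R) + 8 * C * (norm z)\<^sup>2 / R"
        using eventually_ge_at_top[of "nat \<lceil>R\<rceil>"]
      proof eventually_elim
        case (elim n)
        then have "R \<le> real n" by linarith
        then show ?case using logtail_le[of R "real n" z] R z by simp
      qed
    qed
    ultimately show ?thesis by blast
  qed
  have holp: "partial_prod R holomorphic_on S" for R S unfolding partial_prod_def by (intro holomorphic_intros) auto
  have "f holomorphic_on UNIV"
  proof -
    have "f holomorphic_on ball 0 (real n + 1)" for n :: nat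
    proof -
      define R where "R = 2 * (real n + 1)"
      have R: "1 \<le> R" "R / 2 = real n + 1" by (simp_all add: R_def)
      obtain l where l: "l holomorphic_on ball 0 (real n + 1)"
        "\<And>z. norm z < real n + 1 \<Longrightarrow> f z = partial_prod R z * exp (l z)"
        using main[OF R(1)] unfolding R(2) by blast
      have "(\<lambda>z. partial_prod R z * exp (l z)) holomorphic_on ball 0 (real n + 1)"
        by (intro holomorphic_intros holp l)
      then show ?thesis by (rule holomorphic_transform) (simp add: l(2))
    qed
    then have "f holomorphic_on (\<Union>n. ball 0 (real n + 1))" by (intro holomorphic_on_UN_open) auto
    moreover have "(\<Union>n. ball 0 (real n + 1)) = (UNIV :: complex set)"
    proof -
      have "\<exists>n::nat. norm x < real n + 1" for x :: complex
        using reals_Archimedean2[of "norm x"] by (meson less_add_one less_trans)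
      then show ?thesis by auto
    qed
    ultimately show ?thesis by simp
  qed
  moreover have "has_mult f a (m a)" for a
  proof -
    define R where "R = 2 * norm a + 4"
    have R: "1 \<le> R" "0 < R" using norm_ge_zero[of a] unfolding R_def by linarith+
    obtain l where l: "l holomorphic_on ball 0 (R / 2)" "\<And>z. norm z < R / 2 \<Longrightarrow> f z = partial_prod R z * exp (l z)"
      using main[OF R(1)] by blast
    define \<kappa> where "\<kappa> = (\<Prod>a\<in>disc_zeros m R - {0}. (- 1 / a) ^ m a)"
    have sub: "ball a 1 \<subseteq> ball 0 (R / 2)"
    proof
      fix z assume "z \<in> ball a 1"
      then show "z \<in> ball 0 (R / 2)" using norm_triangle_ineq2[of z a] by (simp add: R_def dist_norm norm_minus_commute)
    qed
    have zp: "zprod m (disc_zeros m R) z = (z - a) ^ m a * zprod m (disc_zeros m R - {a}) z" for z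
    proof (cases "a \<in> disc_zeros m R")
      case True
      then show ?thesis by (simp add: zprod_def prod.remove[OF finite_dz])
    next
      case False
      moreover have "norm a < R" unfolding R_def by (smt (verit) norm_ge_zero)
      ultimately have "m a = 0" by (simp add: disc_zeros_def)
      then show ?thesis using False by simp
    qed
    show ?thesis unfolding has_mult_def
    proof (intro exI[of _ "\<lambda>z. \<kappa> * zprod m (disc_zeros m R - {a}) z * exp (l z)"] exI[of _ "1::real"] conjI ballI)
      show "(\<lambda>z. \<kappa> * zprod m (disc_zeros m R - {a}) z * exp (l z)) holomorphic_on ball a 1"
        by (intro holomorphic_intros holomorphic_on_subset[OF l(1) sub])
      show "f z = (z - a) ^ m a * (\<kappa> * zprod m (disc_zeros m R - {a}) z * exp (l z))" if "z \<in> ball a 1" for z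
      proof -
        have "f z = partial_prod R z * exp (l z)" using l(2)[of z] sub that by auto
        then show ?thesis unfolding partial_prod_eq[OF R(2)] zp \<kappa>_def by simp
      qed
      have "\<kappa> \<noteq> 0" unfolding \<kappa>_def using finite_dz by (simp add: prod_zero_iff)
      moreover have "zprod m (disc_zeros m R - {a}) a \<noteq> 0" using finite_dz by (intro zprod_nonzero) auto
      ultimately show "\<kappa> * zprod m (disc_zeros m R - {a}) a * exp (l a) \<noteq> 0" by simp
    qed simp
  qed
  ultimately show thesis using main by (rule that)
qed

end

subsection \<open>Sufficiency\<close>

lemma Phragmen_Lindelof_plane:
  fixes f :: "complex \<Rightarrow> complex"
  assumes holf: "f holomorphic_on UNIV" and f: "\<And>z. norm (f z) \<le> A * exp (B * norm z)"
    and M: "0 < M" and re: "\<And>x. norm (f (of_real x)) \<le> M" and B: "0 \<le> B"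
  shows "norm (f z) \<le> M * exp (B * \<bar>Im z\<bar>)"
proof (cases "0 \<le> Im z")
  case True
  then show ?thesis using Phragmen_Lindelof_half_plane[OF holf f M re B True] by simp
next
  case False
  have "norm ((\<lambda>z. f (- z)) (- z)) \<le> M * exp (B * Im (- z))"
  proof (rule Phragmen_Lindelof_half_plane[of "\<lambda>z. f (- z)", OF _ _ M _ B])
    show "(\<lambda>z. f (- z)) holomorphic_on UNIV"
      using holomorphic_on_compose_gen[OF holomorphic_on_minus[OF holomorphic_on_id] holf] by (simp add: o_def id_def)
    show "norm (f (- z)) \<le> A * exp (B * norm z)" for z using f[of "- z"] by simp
    show "norm (f (- of_real x)) \<le> M" for x using re[of "- x"] by simp
  qed (use False in auto)
  then show ?thesis using False by simp
qed

context linear_count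
begin

text \<open>For large z a dyadic radius R comparable with |z| is used: the partial product is then
  estimated by \<open>sum_ln_dyadic_le\<close> and the remaining factor by the bound for l. Small z
  are handled by compactness.\<close>

lemma product_exp_type:
  assumes hol: "f holomorphic_on UNIV" and L: "(recip_sum m \<longlongrightarrow> L) at_top"
    and l: "\<And>R. 1 \<le> R \<Longrightarrow> \<exists>l. l holomorphic_on ball 0 (R / 2) \<and>
      (\<forall>z. norm z < R / 2 \<longrightarrow> f z = partial_prod R z * exp (l z) \<and>
        norm (l z) \<le> norm z * norm (L - recip_sum m R) + 8 * C * (norm z)\<^sup>2 / R)"
  obtains A B where "0 \<le> B" "\<And>z. norm (f z) \<le> A * exp (B * norm z)"
proof -
  obtain R0 where R0: "\<And>R. R0 \<le> R \<Longrightarrow> norm (L - recip_sum m R) < 1"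
    using tendstoD[OF L, of 1] by (auto simp: eventually_at_top_linorder dist_norm norm_minus_commute)
  define r0 where "r0 = max 1 R0"
  define S0 where "S0 = {a. 0 < m a \<and> 0 < norm a \<and> norm a < 1}"
  \<comment> \<open>The three terms come from a zero at 0, from the other zeros in the unit disc,
    and from the dyadic sum with 2^k <= 8 |z|, which turns 5 C into 40 C.\<close>
  define B1 where "B1 = real (m 0) + (\<Sum>a\<in>S0. real (m a) / norm a) + 40 * C"
  define B where "B = B1 + 1 + 4 * C"
  have B0: "0 \<le> B1" "0 \<le> B" unfolding B_def B1_def using C_nonneg by (auto intro!: sum_nonneg add_nonneg_nonneg)
  have finS: "finite S0" by (rule finite_subset[OF _ finite_dz[of 1]]) (auto simp: S0_def disc_zeros_def)
  have big: "norm (f z) \<le> exp (B * norm z)" if z: "r0 \<le> norm z" for z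
  proof -
    define r where "r = norm z"
    have r: "1 \<le> r" "R0 \<le> r" using z by (auto simp: r_def r0_def)
    \<comment> \<open>This yields 2 r < 2^k <= 8 r.\<close>
    define k where "k = nat \<lceil>log 2 (2 * r)\<rceil> + 1"
    have "0 \<le> log 2 (2 * r)" using r by simp
    have "log 2 (2 * r) < real k" "real k \<le> log 2 (2 * r) + 2" using \<open>0 \<le> log 2 (2 * r)\<close> unfolding k_def by linarith+
    have k1: "2 * r < 2 ^ k"
    proof -
      have "2 * r = 2 powr (log 2 (2 * r))" using r by simp
      also have "\<dots> < 2 powr (real k)" using \<open>log 2 (2 * r) < real k\<close> by simp
      finally show ?thesis by (simp add: powr_realpow)
    qed
    have k2: "2 ^ k \<le> 8 * r"
    proof -
      have "2 powr (real k) \<le> 2 powr (log 2 (2 * r) + 2)" using \<open>real k \<le> log 2 (2 * r) + 2\<close> by simp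
      also have "\<dots> = 8 * r" using r by (simp add: powr_add)
      finally show ?thesis by (simp add: powr_realpow)
    qed
    define R :: real where "R = 2 ^ k"
    have R: "1 \<le> R" "2 * r < R" "R \<le> 8 * r" "R0 \<le> R" using k1 k2 r by (auto simp: R_def)
    obtain l where lz: "f z = partial_prod R z * exp (l z)"
      "norm (l z) \<le> norm z * norm (L - recip_sum m R) + 8 * C * (norm z)\<^sup>2 / R"
      proof -
      have "norm z < R / 2" using R(2) by (simp add: r_def)
      then show ?thesis using l[OF R(1)] that by blast
    qed
    have "norm (l z) \<le> r * 1 + 8 * C * r\<^sup>2 / R"
    proof -
      have "norm z * norm (L - recip_sum m R) \<le> r * 1"
        using R0[OF R(4)] by (intro mult_mono) (auto simp: r_def)
      then show ?thesis using lz(2) by (simp add: r_def)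
    qed
    also have "8 * C * r\<^sup>2 / R \<le> 8 * C * r\<^sup>2 / (2 * r)"
      using R r C_nonneg by (intro divide_left_mono) auto
    also have "\<dots> = 4 * C * r" using r by (simp add: power2_eq_square)
    finally have nl: "norm (l z) \<le> r + 4 * C * r" by simp
    define S1 where "S1 = {a. 0 < m a \<and> 1 \<le> norm a \<and> norm a < R}"
    have finS1: "finite S1" by (rule finite_subset[OF _ finite_dz[of R]]) (auto simp: S1_def disc_zeros_def)
    have dz: "disc_zeros m R - {0} = S0 \<union> S1" using R by (auto simp: S0_def S1_def disc_zeros_def)
    have fac: "norm (1 - z / a) ^ m a \<le> exp (real (m a) * ln (1 + r / norm a))" if "a \<noteq> 0" for a
    proof -
      have "norm (1 - z / a) \<le> 1 + r / norm a" using norm_triangle_ineq4[of 1 "z / a"] by (simp add: norm_divide r_def)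
      then have "norm (1 - z / a) ^ m a \<le> (1 + r / norm a) ^ m a" by (intro power_mono) auto
      also have "0 < 1 + r / norm a" using r by (intro add_pos_nonneg) auto
      then have "(1 + r / norm a) ^ m a = exp (real (m a) * ln (1 + r / norm a))"
        by (simp add: exp_of_nat_mult)
      finally show ?thesis .
    qed
    have "norm (partial_prod R z) = r ^ m 0 * (\<Prod>a\<in>S0 \<union> S1. norm (1 - z / a) ^ m a)"
      unfolding partial_prod_def dz by (simp add: norm_mult norm_power prod_norm[symmetric] r_def)
    also have "\<dots> \<le> exp (real (m 0) * r) * (\<Prod>a\<in>S0 \<union> S1. exp (real (m a) * ln (1 + r / norm a)))"
    proof (intro mult_mono prod_mono conjI fac prod_nonneg)
      have "r \<le> exp r" using exp_ge_add_one_self[of r] by linarith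
      then have "r ^ m 0 \<le> exp r ^ m 0" using r by (intro power_mono) auto
      then show "r ^ m 0 \<le> exp (real (m 0) * r)" by (simp add: exp_of_nat_mult)
    qed (auto simp: S0_def S1_def)
    also have "(\<Prod>a\<in>S0 \<union> S1. exp (real (m a) * ln (1 + r / norm a)))
      = exp (\<Sum>a\<in>S0 \<union> S1. real (m a) * ln (1 + r / norm a))" using finS finS1 by (simp add: exp_sum)
    also have "(\<Sum>a\<in>S0 \<union> S1. real (m a) * ln (1 + r / norm a))
      = (\<Sum>a\<in>S0. real (m a) * ln (1 + r / norm a)) + (\<Sum>a\<in>S1. real (m a) * ln (1 + r / norm a))"
      by (rule sum.union_disjoint) (use finS finS1 in \<open>auto simp: S0_def S1_def\<close>)
    also have "(\<Sum>a\<in>S0. real (m a) * ln (1 + r / norm a)) \<le> (\<Sum>a\<in>S0. real (m a) / norm a) * r"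
      unfolding sum_distrib_right
    proof (rule sum_mono)
      fix a :: complex
      have "ln (1 + r / norm a) \<le> r / norm a" using r by (intro ln_add_one_self_le_self) auto
      then have "real (m a) * ln (1 + r / norm a) \<le> real (m a) * (r / norm a)" by (rule mult_left_mono) simp
      then show "real (m a) * ln (1 + r / norm a) \<le> real (m a) / norm a * r" by simp
    qed
    also have "(\<Sum>a\<in>S1. real (m a) * ln (1 + r / norm a)) \<le> (\<Sum>a\<in>S1. real (m a) * ln (1 + 2 ^ k / norm a))"
    proof (intro sum_mono mult_left_mono)
      fix a assume "a \<in> S1"
      then have "0 < norm a" unfolding S1_def by (smt (verit) mem_Collect_eq)
      have "r / norm a \<le> 2 ^ k / norm a" using R r unfolding R_def by (intro divide_right_mono) auto
      moreover have "0 \<le> r / norm a" using r by simp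
      ultimately show "ln (1 + r / norm a) \<le> ln (1 + 2 ^ k / norm a)" by (subst ln_le_cancel_iff) auto
    qed auto
    also have "\<dots> \<le> 5 * C * 2 ^ k" using sum_ln_dyadic_le[of k] by (simp add: S1_def R_def)
    also have "\<dots> \<le> 5 * C * (8 * r)" using k2 C_nonneg by (intro mult_left_mono) auto
    finally have "norm (partial_prod R z) \<le> exp (real (m 0) * r) * exp ((\<Sum>a\<in>S0. real (m a) / norm a) * r + 40 * C * r)"
      by (simp add: mult.assoc)
    then have np: "norm (partial_prod R z) \<le> exp (B1 * r)" by (simp add: B1_def algebra_simps flip: exp_add)
    have "norm (f z) = norm (partial_prod R z) * exp (Re (l z))" by (simp add: lz(1) norm_mult)
    also have "\<dots> \<le> exp (B1 * r) * exp (r + 4 * C * r)"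
      using nl complex_Re_le_cmod[of "l z"] by (intro mult_mono np) auto
    also have "\<dots> = exp (B * r)" by (simp add: B_def algebra_simps flip: exp_add)
    finally show ?thesis by (simp add: r_def)
  qed
  have "compact (f ` cball 0 r0)"
    by (intro compact_continuous_image holomorphic_on_imp_continuous_on holomorphic_on_subset[OF hol]) auto
  then obtain K where K: "\<And>z. norm z \<le> r0 \<Longrightarrow> norm (f z) \<le> K"
    using compact_imp_bounded bounded_iff by (metis (no_types, lifting) image_eqI mem_cball_0)
  have K0: "0 \<le> K" using order_trans[OF norm_ge_zero K[of 0]] by (simp add: r0_def)
  show thesis
  proof (rule that[OF B0(2)])
    fix z
    show "norm (f z) \<le> (K + 1) * exp (B * norm z)"
    proof (cases "r0 \<le> norm z")
      case True
      have "1 * exp (B * norm z) \<le> (K + 1) * exp (B * norm z)" using K0 by (intro mult_right_mono) auto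
      then show ?thesis using big[OF True] by linarith
    next
      case False
      have "(K + 1) * 1 \<le> (K + 1) * exp (B * norm z)" using K0 B0 by (intro mult_left_mono) auto
      then show ?thesis using K[of z] False by simp
    qed
  qed
qed

text \<open>By the identity theorem the cofactor is a constant times exp l on the disc of radius R /
  2. Its normalised modulus at x is therefore exp (Re (l x)), and the bound for l x tends to
  0.\<close>

lemma product_cofactor_ratio:
  assumes L: "(recip_sum m \<longlongrightarrow> L) at_top"
    and l: "\<And>R. 1 \<le> R \<Longrightarrow> \<exists>l. l holomorphic_on ball 0 (R / 2) \<and>
      (\<forall>z. norm z < R / 2 \<longrightarrow> f z = partial_prod R z * exp (l z) \<and>
        norm (l z) \<le> norm z * norm (L - recip_sum m R) + 8 * C * (norm z)\<^sup>2 / R)"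
    and G: "\<And>R. cofactor f m (disc_zeros m R) (G R)"
  shows "((\<lambda>R. norm (G R x) / norm (G R 0)) \<longlongrightarrow> 1) at_top"
proof -
  define u where "u = (\<lambda>R. ln (norm (G R x) / norm (G R 0)))"
  define b where "b = (\<lambda>R. norm x * norm (L - recip_sum m R) + 8 * C * (norm x)\<^sup>2 / R)"
  have key: "\<bar>u R\<bar> \<le> b R \<and> exp (u R) = norm (G R x) / norm (G R 0)" if R: "2 * norm x + 1 \<le> R" for R
  proof -
    have R1: "1 \<le> R" "0 < R" "norm x < R / 2" using R norm_ge_zero[of x] by linarith+
    obtain l where l: "l holomorphic_on ball 0 (R / 2)"
      "\<And>z. norm z < R / 2 \<Longrightarrow> f z = partial_prod R z * exp (l z)"
      "\<And>z. norm z < R / 2 \<Longrightarrow> norm (l z) \<le> norm z * norm (L - recip_sum m R) + 8 * C * (norm z)\<^sup>2 / R"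
      using l[OF R1(1)] by blast
    define \<kappa> where "\<kappa> = (\<Prod>a\<in>disc_zeros m R - {0}. (- 1 / a) ^ m a)"
    have \<kappa>0: "\<kappa> \<noteq> 0" unfolding \<kappa>_def using finite_dz by (simp add: prod_zero_iff)
    have eqG: "G R z = \<kappa> * exp (l z)" if z: "norm z < R / 2" for z
    proof -
      have "(\<lambda>z. G R z - \<kappa> * exp (l z)) z = 0"
      proof (rule analytic_continuation[of "\<lambda>z. G R z - \<kappa> * exp (l z)" "ball 0 (R/2)" "ball 0 (R/2) - disc_zeros m R" z])
        show "(\<lambda>z. G R z - \<kappa> * exp (l z)) holomorphic_on ball 0 (R / 2)"
          using G[of R] l(1) by (intro holomorphic_intros) (auto simp: cofactor_def intro: holomorphic_on_subset)
        have "z islimpt ball 0 (R / 2)" using z by (intro interior_limit_point) auto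
        then show "z islimpt ball 0 (R / 2) - disc_zeros m R"
          using islimpt_Un_finite[of "ball 0 (R/2) \<inter> disc_zeros m R" z "ball 0 (R/2) - disc_zeros m R"] finite_dz
          by (simp add: Int_Diff_Un)
        fix w assume w: "w \<in> ball 0 (R / 2) - disc_zeros m R"
        have "zprod m (disc_zeros m R) w * G R w = zprod m (disc_zeros m R) w * (\<kappa> * exp (l w))"
          using G[of R] l(2)[of w] w unfolding cofactor_def partial_prod_eq[OF R1(2)] \<kappa>_def by auto
        then show "G R w - \<kappa> * exp (l w) = 0" using zprod_nonzero[OF finite_dz, of w R m] w by simp
      qed (use z in auto)
      then show ?thesis by simp
    qed
    have l0: "l 0 = 0" using l(3)[of 0] R1 by simp
    have ratio: "norm (G R x) / norm (G R 0) = exp (Re (l x))"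
      using eqG[of x] eqG[of 0] R1 \<kappa>0 by (simp add: l0 norm_mult)
    have "\<bar>Re (l x)\<bar> \<le> b R" using abs_Re_le_cmod[of "l x"] l(3)[OF R1(3)] by (simp add: b_def)
    then show ?thesis by (simp add: u_def ratio)
  qed
  have "((\<lambda>R. norm x * norm (L - recip_sum m R) + 8 * C * (norm x)\<^sup>2 * inverse R) \<longlongrightarrow> norm x * norm (L - L) + 8 * C * (norm x)\<^sup>2 * 0) at_top"
    by (intro tendsto_intros L tendsto_inverse_0_at_top filterlim_ident)
  then have "(b \<longlongrightarrow> 0) at_top" by (simp add: b_def divide_inverse)
  moreover have ev: "eventually (\<lambda>R. 2 * norm x + 1 \<le> R) at_top" by (rule eventually_ge_at_top)
  have "eventually (\<lambda>R. norm (u R) \<le> b R) at_top" using ev by eventually_elim (use key in auto)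
  ultimately have "(u \<longlongrightarrow> 0) at_top" by (intro Lim_null_comparison[of u b]) auto
  then have "((\<lambda>R. exp (u R)) \<longlongrightarrow> exp 0) at_top" by (rule tendsto_exp)
  moreover have "eventually (\<lambda>R. exp (u R) = norm (G R x) / norm (G R 0)) at_top"
    using ev by eventually_elim (use key in auto)
  ultimately show ?thesis using Lim_transform_eventually by fastforce
qed

end

lemma bigo_imp_linear_count:
  assumes lf: "locally_finite_mult m"
    and O: "(\<lambda>t. real (count_fn m 0 t)) \<in> O[at_top](\<lambda>t. t)"
  obtains C where "linear_count m C"
proof -
  obtain c where c: "0 < c" "eventually (\<lambda>t. norm (real (count_fn m 0 t)) \<le> c * norm t) at_top"
    using landau_o.bigE[OF O] by blast
  then obtain T where T: "\<And>t. T \<le> t \<Longrightarrow> real (count_fn m 0 t) \<le> c * \<bar>t\<bar>"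
    by (auto simp: eventually_at_top_linorder)
  define C where "C = max c (real (count_fn m 0 T))"
  have "real (count_fn m 0 t) \<le> C * t" if t: "1 \<le> t" for t
  proof (cases "T \<le> t")
    case True
    then have "real (count_fn m 0 t) \<le> c * t" using T t by fastforce
    also have "\<dots> \<le> C * t" using t by (intro mult_right_mono) (auto simp: C_def)
    finally show ?thesis .
  next
    case False
    then have "real (count_fn m 0 t) \<le> real (count_fn m 0 T)" using count_fn_mono[OF lf, of t T 0] by simp
    also have "\<dots> \<le> C * 1" by (simp add: C_def)
    also have "\<dots> \<le> C * t" using t c by (intro mult_left_mono) (auto simp: C_def)
    finally show ?thesis .
  qed
  then show thesis by (intro that[of C]) (use lf in \<open>unfold_locales, auto\<close>)
qed

lemma entire_zeros_in_class_D:
  assumes ez: "entire_zeros f m" and et: "\<And>z. norm (f z) \<le> A * exp (B * norm z)" "0 \<le> B"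
    and jl: "0 < c" "\<And>x. c \<le> jensen f m (of_real x)" and ju: "\<And>x. jensen f m (of_real x) \<le> M"
  shows "f \<in> class_D"
proof -
  interpret entire_zeros f m by fact
  have M: "0 < M" using jl(1) jl(2)[of 0] ju[of 0] by linarith
  have bd: "norm (f z) \<le> M * exp (B * \<bar>Im z\<bar>)" for z
    by (rule Phragmen_Lindelof_plane[OF hol et(1) M _ et(2)]) (rule order_trans[OF norm_le_jensen ju])
  have "\<exists>r g. strict_mono r \<and> g holomorphic_on UNIV \<and> (\<exists>z. g z \<noteq> 0) \<and>
        (\<forall>K. compact K \<longrightarrow> uniform_limit K (\<lambda>k z. f (z + complex_of_real (h (r k)))) g sequentially)"
    for h :: "nat \<Rightarrow> real"
  proof -
    define F where "F = (\<lambda>n z. f (z + complex_of_real (h n)))"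
    have holF: "F n holomorphic_on UNIV" for n
      using holomorphic_on_compose_gen[of "\<lambda>z. z + complex_of_real (h n)" UNIV f UNIV] hol
      by (simp add: F_def o_def holomorphic_intros)
    obtain g r where g: "g holomorphic_on UNIV" "strict_mono (r :: nat \<Rightarrow> nat)"
      "\<And>K. compact K \<Longrightarrow> K \<subseteq> UNIV \<Longrightarrow> uniform_limit K (F \<circ> r) g sequentially"
    proof (rule Montel[of UNIV "range F" F])
      fix K :: "complex set" assume "compact K"
      then obtain b where b: "\<And>z. z \<in> K \<Longrightarrow> norm z \<le> b" using compact_imp_bounded bounded_iff by metis
      have "norm (F n z) \<le> M * exp (B * b)" if "z \<in> K" for n z
      proof -
        have "norm (F n z) \<le> M * exp (B * \<bar>Im z\<bar>)" using bd[of "z + complex_of_real (h n)"] by (simp add: F_def)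
        also have "\<dots> \<le> M * exp (B * b)"
          using M et(2) b[OF that] abs_Im_le_cmod[of z] by (intro mult_left_mono) (auto intro!: mult_left_mono)
        finally show ?thesis .
      qed
      then show "\<exists>B. \<forall>h\<in>range F. \<forall>z\<in>K. norm (h z) \<le> B" by blast
    qed (use holF in auto)
    have "\<exists>z. g z \<noteq> 0"
    proof (rule ccontr)
      assume "\<nexists>z. g z \<noteq> 0"
      then have g0: "g z = 0" for z by blast
      have "uniform_limit (cball 0 1) (F \<circ> r) g sequentially" by (rule g(3)) auto
      then have "eventually (\<lambda>n. \<forall>z\<in>cball 0 1. dist ((F \<circ> r) n z) (g z) < c / 2) sequentially"
        by (rule uniform_limitD) (use jl(1) in simp)
      then obtain n where "\<forall>z\<in>cball 0 1. dist ((F \<circ> r) n z) (g z) < c / 2"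
        using eventually_happens' sequentially_bot by blast
      then have n: "\<And>z. norm z \<le> 1 \<Longrightarrow> norm (F (r n) z) < c / 2" by (simp add: g0)
      have "jensen f m (of_real (h (r n))) \<le> c / 2"
      proof (rule jensen_le)
        fix z assume "dist z (complex_of_real (h (r n))) = 1"
        then show "norm (f z) \<le> c / 2" using n[of "z - of_real (h (r n))"] by (simp add: F_def dist_norm)
      qed
      then show False using jl(1) jl(2)[of "h (r n)"] by linarith
    qed
    moreover have "\<forall>K. compact K \<longrightarrow> uniform_limit K (\<lambda>k z. f (z + complex_of_real (h (r k)))) g sequentially"
      using g(3) by (simp add: F_def o_def)
    ultimately show ?thesis using g by blast
  qed
  moreover have "exp_type f" using et(1) unfolding exp_type_def by blast
  ultimately show ?thesis using hol by (simp add: class_D_def)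
qed

lemma zero_set_sufficient:
  assumes lf: "locally_finite_mult m" and L: "(recip_sum m \<longlongrightarrow> L) at_top"
    and O: "(\<lambda>t. real (count_fn m 0 t)) \<in> O[at_top](\<lambda>t. t)"
    and iii: "(\<lambda>t. real (count_fn m 0 (t + 1)) - real (count_fn m 0 t)) \<in> o[at_top](\<lambda>t. t)"
    and iv: "\<And>x::real. \<exists>I::real.
          ((\<lambda>T. integral {1..T} (\<lambda>t. (real (count_fn m 0 t) - real (count_fn m (of_real x) t)) / t))
             \<longlongrightarrow> I) at_top \<and> \<bar>I\<bar> \<le> K"
  shows "\<exists>f. f \<in> class_D \<and> is_zero_set f m"
proof -
  obtain C where "linear_count m C" using bigo_imp_linear_count[OF lf O] .
  then interpret linear_count m C .
  obtain f where f: "f holomorphic_on UNIV" "\<And>a. has_mult f a (m a)"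
    and l: "\<And>R. 1 \<le> R \<Longrightarrow> \<exists>l. l holomorphic_on ball 0 (R / 2) \<and>
      (\<forall>z. norm z < R / 2 \<longrightarrow> f z = partial_prod R z * exp (l z) \<and>
        norm (l z) \<le> norm z * norm (L - recip_sum m R) + 8 * C * (norm z)\<^sup>2 / R)"
    by (rule ex_product[OF L]) blast
  interpret entire_zeros f m by unfold_locales (use f lf in auto)
  obtain A B where AB: "0 \<le> B" "\<And>z. norm (f z) \<le> A * exp (B * norm z)"
    using product_exp_type[OF f(1) L l] by metis
  obtain G where G: "\<And>R. cofactor f m (disc_zeros m R) (G R)"
    using ex_cofactor[OF finite_dz] by metis
  have ratio: "((\<lambda>R. norm (G R x) / norm (G R 0)) \<longlongrightarrow> 1) at_top" for x
    by (rule product_cofactor_ratio[OF L l G])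
  define j where "j = (\<lambda>x::real. jensen f m (of_real x))"
  have j: "\<bar>ln (j x / j 0)\<bar> \<le> K" for x
  proof -
    obtain I where I: "((\<lambda>T. integral {1..T} (\<lambda>t. (real (count_fn m 0 t) - real (count_fn m (of_real x) t)) / t))
             \<longlongrightarrow> I) at_top" "\<bar>I\<bar> \<le> K" using iv[of x] by blast
    have "I = ln (jensen f m (of_real x) / jensen f m 0)"
      by (rule tendsto_unique[OF _ I(1) count_integral_tendsto[OF iii G ratio]]) simp
    then show ?thesis using I(2) by (simp add: j_def)
  qed
  have j0: "0 < j x" for x by (simp add: j_def jensen_pos)
  have "f \<in> class_D"
  proof (rule entire_zeros_in_class_D[OF _ AB(2,1)])
    show "entire_zeros f m" ..
    show "0 < j 0 * exp (- K)" using j0 by simp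
    have le: "exp (- K) \<le> j x / j 0" "j x / j 0 \<le> exp K" for x
    proof -
      have "0 < j x / j 0" using j0 by simp
      then have "j x / j 0 = exp (ln (j x / j 0))" by simp
      moreover have "exp (- K) \<le> exp (ln (j x / j 0))" "exp (ln (j x / j 0)) \<le> exp K"
        using j[of x] by (simp_all add: abs_le_iff del: exp_ln_iff)
      ultimately show "exp (- K) \<le> j x / j 0" "j x / j 0 \<le> exp K" by simp_all
    qed
    show "j 0 * exp (- K) \<le> jensen f m (of_real x)" for x
      using le(1)[of x] j0[of 0] by (simp add: le_divide_eq mult.commute j_def)
    show "jensen f m (of_real x) \<le> j 0 * exp K" for x
      using le(2)[of x] j0[of 0] by (simp add: divide_le_eq mult.commute j_def)
  qed
  then show ?thesis using f is_zero_set_iff[OF f(1)] by blast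
qed

subsection \<open>Reflected zeros and the Blaschke condition\<close>

text \<open>Were |f (h n)| > n for real h n, no subsequence of the translates by h could converge at
  0.\<close>

lemma class_D_bounded_on_reals:
  assumes "f \<in> class_D"
  obtains M where "0 < M" "\<And>x::real. norm (f (of_real x)) \<le> M"
proof -
  have "\<exists>M. \<forall>x::real. norm (f (of_real x)) \<le> M"
  proof (rule ccontr)
    assume "\<not> ?thesis"
    then have "\<forall>n::nat. \<exists>x::real. real n < norm (f (of_real x))" by (meson not_le)
    then obtain h where h: "\<And>n::nat. real n < norm (f (of_real (h n)))" by metis
    obtain r g where r: "strict_mono (r :: nat \<Rightarrow> nat)"
      "\<And>K. compact K \<Longrightarrow> uniform_limit K (\<lambda>k z. f (z + complex_of_real (h (r k)))) g sequentially"
      using assms unfolding class_D_def by blast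
    have "(\<lambda>k. f (0 + complex_of_real (h (r k)))) \<longlonglongrightarrow> g 0"
      by (rule tendsto_uniform_limitI[OF r(2)[of "{0}"]]) auto
    then have "Bseq (\<lambda>k. f (complex_of_real (h (r k))))" by (simp add: convergentI convergent_imp_Bseq)
    then obtain K where K: "\<And>k. norm (f (complex_of_real (h (r k)))) \<le> K" by (auto simp: Bseq_def)
    obtain n where "K < real n" using reals_Archimedean2 by blast
    also have "real n \<le> real (r n)" using seq_suble[OF r(1)] by simp
    finally show False using h[of "r n"] K[of n] by linarith
  qed
  then obtain M where "\<forall>x::real. norm (f (of_real x)) \<le> M" by blast
  then show thesis by (intro that[of "max 1 M"]) (auto simp: le_max_iff_disj)
qed

text \<open>If this failed, some limit of translates would vanish on a disc and hence identically.
  The discs stay at height at least 1, so the points found can serve as base points for Harnack's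
  inequality in the upper half plane.\<close>

lemma class_D_lower_bound:
  assumes "f \<in> class_D"
  obtains \<delta> where "0 < \<delta>" "\<And>x::real. \<exists>z. dist z (Complex x 2) \<le> 1 \<and> \<delta> \<le> norm (f z)"
proof -
  have "\<exists>\<delta>>0. \<forall>x::real. \<exists>z. dist z (Complex x 2) \<le> 1 \<and> \<delta> \<le> norm (f z)"
  proof (rule ccontr)
    assume neg: "\<not> ?thesis"
    have "\<exists>x::real. \<forall>z. dist z (Complex x 2) \<le> 1 \<longrightarrow> norm (f z) < inverse (real (Suc n))" for n
    proof -
      have "0 < inverse (real (Suc n))" by simp
      then show ?thesis using neg by (metis not_le)
    qed
    then obtain h where h: "\<And>n z. dist z (Complex (h n) 2) \<le> 1 \<Longrightarrow> norm (f z) < inverse (real (Suc n))" by metis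
    obtain r g where r: "strict_mono (r :: nat \<Rightarrow> nat)" "g holomorphic_on UNIV" "\<exists>z. g z \<noteq> 0"
      "\<And>K. compact K \<Longrightarrow> uniform_limit K (\<lambda>k z. f (z + complex_of_real (h (r k)))) g sequentially"
      using assms unfolding class_D_def by blast
    have g0: "g z = 0" if z: "z \<in> ball (Complex 0 2) 1" for z
    proof -
      have l1: "(\<lambda>k. f (z + complex_of_real (h (r k)))) \<longlonglongrightarrow> g z"
        by (rule tendsto_uniform_limitI[OF r(4)[of "{z}"]]) auto
      have le: "norm (f (z + complex_of_real (h (r k)))) \<le> inverse (real (Suc k))" for k
      proof -
        have "norm (z + complex_of_real (h (r k)) - Complex (h (r k)) 2) = norm (z - Complex 0 2)"
          by (rule arg_cong[of _ _ norm]) (simp add: complex_eq_iff)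
        then have "dist (z + complex_of_real (h (r k))) (Complex (h (r k)) 2) \<le> 1"
          using z by (simp only: dist_norm mem_ball) (simp add: norm_minus_commute)
        then have "norm (f (z + complex_of_real (h (r k)))) < inverse (real (Suc (r k)))"
          by (rule h)
        also have "\<dots> \<le> inverse (real (Suc k))" using seq_suble[OF r(1), of k] by (intro le_imp_inverse_le) auto
        finally show ?thesis by simp
      qed
      have "(\<lambda>k. f (z + complex_of_real (h (r k)))) \<longlonglongrightarrow> 0"
        by (rule Lim_null_comparison[OF _ LIMSEQ_inverse_real_of_nat]) (use le in auto)
      then show ?thesis using l1 LIMSEQ_unique by blast
    qed
    have "g w = 0" for w
      by (rule analytic_continuation_open[of "ball (Complex 0 2) 1" UNIV g "\<lambda>_. 0"])
         (use r(2) g0 in \<open>auto simp del: mem_ball\<close>)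
    then show False using r(3) by blast
  qed
  then show thesis using that by blast
qed

text \<open>If the infimum were 0, translates would converge to some nonzero g. As g has finitely
  many zeros in the closed unit disc, some circle of radius less than 1 avoids them; there the
  translates are eventually bounded below, contradicting \<open>jensen_ge\<close>.\<close>

lemma class_D_jensen_lower_bound:
  assumes D: "f \<in> class_D" and "entire_zeros f m"
  obtains c where "0 < c" "\<And>x::real. c \<le> jensen f m (of_real x)"
proof -
  interpret entire_zeros f m by fact
  have "\<exists>c>0. \<forall>x::real. c \<le> jensen f m (of_real x)"
  proof (rule ccontr)
    assume neg: "\<not> ?thesis"
    have "\<exists>x::real. jensen f m (of_real x) < inverse (real (Suc n))" for n
    proof -
      have "0 < inverse (real (Suc n))" by simp
      then show ?thesis using neg by (metis not_le)
    qed
    then obtain h where h: "\<And>n. jensen f m (of_real (h n)) < inverse (real (Suc n))" by metis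
    obtain r g where r: "strict_mono (r :: nat \<Rightarrow> nat)" "g holomorphic_on UNIV" "\<exists>z. g z \<noteq> 0"
      "\<And>K. compact K \<Longrightarrow> uniform_limit K (\<lambda>k z. f (z + complex_of_real (h (r k)))) g sequentially"
      using D unfolding class_D_def by blast
    have "finite {z\<in>cball 0 1. g z = 0}"
    proof (cases "g constant_on UNIV")
      case True
      then have "{z\<in>cball 0 1. g z = 0} = {}" using r(3) by (auto simp: constant_on_def)
      then show ?thesis by (simp only: finite.emptyI)
    next
      case False
      then show ?thesis by (intro holomorphic_compact_finite_zeros[OF r(2)]) auto
    qed
    then have "finite (norm ` {z\<in>cball 0 1. g z = 0})" by simp
    moreover have "infinite {0<..<1::real}" by simp
    ultimately obtain \<rho> where \<rho>: "\<rho> \<in> {0<..<1}" "\<rho> \<notin> norm ` {z\<in>cball 0 1. g z = 0}"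
      by (meson finite_subset subsetI)
    have "g z \<noteq> 0" if "z \<in> sphere 0 \<rho>" for z using \<rho> that by force
    moreover have "continuous_on (sphere 0 \<rho>) (\<lambda>z. norm (g z))"
      using r(2) by (intro continuous_on_norm holomorphic_on_imp_continuous_on holomorphic_on_subset[OF r(2)]) auto
    then obtain z0 where z0: "z0 \<in> sphere 0 \<rho>" "\<And>z. z \<in> sphere 0 \<rho> \<Longrightarrow> norm (g z0) \<le> norm (g z)"
      using continuous_attains_inf[of "sphere 0 \<rho>" "\<lambda>z. norm (g z)"] \<rho>(1) by (auto simp: sphere_eq_empty)
    define \<delta> where "\<delta> = norm (g z0)"
    ultimately have \<delta>: "0 < \<delta>" using z0 by simp
    have "uniform_limit (sphere 0 \<rho>) (\<lambda>k z. f (z + complex_of_real (h (r k)))) g sequentially" by (rule r(4)) simp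
    then have "eventually (\<lambda>k. \<forall>z\<in>sphere 0 \<rho>. dist (f (z + complex_of_real (h (r k)))) (g z) < \<delta> / 2) sequentially"
      by (rule uniform_limitD) (use \<delta> in simp)
    moreover obtain N :: nat where N: "2 / \<delta> < real N" using reals_Archimedean2 by blast
    have "eventually (\<lambda>k. N \<le> k) sequentially" by (rule eventually_ge_at_top)
    ultimately have "eventually (\<lambda>k. (\<forall>z\<in>sphere 0 \<rho>. dist (f (z + complex_of_real (h (r k)))) (g z) < \<delta> / 2) \<and> N \<le> k) sequentially"
      by (rule eventually_conj)
    then obtain k where k: "\<forall>z\<in>sphere 0 \<rho>. dist (f (z + complex_of_real (h (r k)))) (g z) < \<delta> / 2" "N \<le> k"
      using eventually_happens' sequentially_bot by blast
    have "\<delta> / 2 \<le> jensen f m (of_real (h (r k)))"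
    proof (rule jensen_ge[of \<rho>])
      fix z assume z: "dist z (complex_of_real (h (r k))) = \<rho>"
      define w where "w = z - complex_of_real (h (r k))"
      have w: "w \<in> sphere 0 \<rho>" using z by (simp add: w_def dist_norm norm_minus_commute)
      have "dist (f (w + complex_of_real (h (r k)))) (g w) < \<delta> / 2" using k(1) w by (rule bspec)
      then have "dist (f z) (g w) < \<delta> / 2" by (simp add: w_def)
      moreover have "\<delta> \<le> norm (g w)" using z0(2)[OF w] by (simp add: \<delta>_def)
      ultimately show "\<delta> / 2 \<le> norm (f z)" using norm_triangle_ineq2[of "g w" "f z"] by (simp add: dist_norm norm_minus_commute)
    qed (use \<rho> \<delta> in auto)
    also have "\<dots> < inverse (real (Suc (r k)))" by (rule h)
    also have "\<dots> \<le> inverse (real (Suc N))" using seq_suble[OF r(1), of k] k(2) by (intro le_imp_inverse_le) auto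
    also have "\<dots> \<le> \<delta> / 2" using N \<delta> by (simp add: field_simps)
    finally show False by simp
  qed
  then show thesis using that by blast
qed

section \<open>Reflection in the real axis and the Blaschke sum\<close>

definition refl :: "complex \<Rightarrow> complex" where
  "refl a = Complex (Re a) (- \<bar>Im a\<bar>)"

text \<open>For the cofactor \<open>g\<close> of \<open>A\<close> this is \<open>f\<close> divided
  by a finite Blaschke product, up to a factor of modulus 1: the modulus on the real line is kept
  and can only grow in the upper half plane.\<close>

definition reflprod :: "(complex \<Rightarrow> nat) \<Rightarrow> complex set \<Rightarrow> (complex \<Rightarrow> complex) \<Rightarrow> complex \<Rightarrow> complex" where
  "reflprod m A g z = g z * (\<Prod>a\<in>A. (z - refl a) ^ m a)"

lemma norm_refl [simp]: "norm (refl a) = norm a"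
  by (simp add: refl_def cmod_def)

lemma dist_refl_ge: 
  assumes "0 \<le> Im z"
  shows "norm (z - a) \<le> norm (z - refl a)"
proof -
  have "\<bar>Im z - Im a\<bar>\<^sup>2 \<le> (Im z + \<bar>Im a\<bar>)\<^sup>2" using assms by (intro power_mono) auto
  then show ?thesis by (simp add: cmod_def refl_def)
qed

lemma dist_refl_real: "Im z = 0 \<Longrightarrow> norm (z - refl a) = norm (z - a)"
  by (simp add: cmod_def refl_def)

text \<open>Moving finitely many zeros changes neither the exponent B nor the modulus on the real
  line. Phragmen--Lindelof then turns a growth bound whose constant depends on \<open>A\<close> into
  one that does not.\<close>

lemma reflprod_half_plane_le:
  assumes g: "cofactor f m A g" and A: "finite A"
    and et: "\<And>z. norm (f z) \<le> K * exp (B * norm z)" "0 \<le> B"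
    and M: "0 < M" "\<And>x::real. norm (f (of_real x)) \<le> M" and z: "0 \<le> Im z"
  shows "norm (reflprod m A g z) \<le> M * exp (B * Im z)"
proof -
  define F where "F = reflprod m A g"
  have holF: "F holomorphic_on UNIV" unfolding F_def reflprod_def
    using g by (intro holomorphic_intros) (auto simp: cofactor_def)
  have nf: "norm (f z) = norm (g z) * (\<Prod>a\<in>A. norm (z - a) ^ m a)" for z
    using g by (simp add: cofactor_def zprod_def norm_mult prod_norm[symmetric] norm_power)
  have nF: "norm (F z) = norm (g z) * (\<Prod>a\<in>A. norm (z - refl a) ^ m a)" for z
    by (simp add: F_def reflprod_def norm_mult prod_norm[symmetric] norm_power)
  have K0: "0 \<le> K" using order_trans[OF norm_ge_zero et(1)[of 0]] by simp
  define \<rho> where "\<rho> = (\<Sum>a\<in>A. norm a)"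
  have \<rho>: "norm a \<le> \<rho>" if "a \<in> A" for a unfolding \<rho>_def using A that by (intro member_le_sum) auto
  define n where "n = (\<Sum>a\<in>A. m a)"
  \<comment> \<open>For |z| >= 2 |a| one has |z| + |a| <= 3 (|z| - |a|), so each moved factor costs
    at most 3.\<close>
  have far: "norm (F z) \<le> 3 ^ n * K * exp (B * norm z)" if z: "2 * \<rho> \<le> norm z" for z
  proof -
    have "norm (F z) \<le> norm (g z) * (\<Prod>a\<in>A. (3 * norm (z - a)) ^ m a)" unfolding nF
    proof (intro mult_left_mono prod_mono conjI power_mono)
      fix a assume a: "a \<in> A"
      have "norm (z - refl a) \<le> norm z + norm a" using norm_triangle_ineq4[of z "refl a"] by simp
      moreover have "norm z - norm a \<le> norm (z - a)" by (rule norm_triangle_ineq2)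
      ultimately show "norm (z - refl a) \<le> 3 * norm (z - a)" using \<rho>[OF a] z by linarith
    qed auto
    also have "\<dots> = 3 ^ n * norm (f z)"
      using A by (simp add: nf n_def power_sum power_mult_distrib prod.distrib)
    also have "\<dots> \<le> 3 ^ n * (K * exp (B * norm z))" by (intro mult_left_mono et) auto
    finally show ?thesis by (simp add: mult.assoc)
  qed
  have "compact (F ` cball 0 (2 * \<rho>))"
    by (intro compact_continuous_image holomorphic_on_imp_continuous_on holomorphic_on_subset[OF holF]) auto
  then have "bounded (F ` cball 0 (2 * \<rho>))" by (rule compact_imp_bounded)
  then obtain b where "\<forall>z\<in>cball 0 (2 * \<rho>). norm (F z) \<le> b" by (auto simp: bounded_iff)
  then have b: "\<And>z. norm z \<le> 2 * \<rho> \<Longrightarrow> norm (F z) \<le> b" by simp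
  define b' where "b' = max 0 b"
  have b': "b \<le> b'" "0 \<le> b'" by (auto simp: b'_def)
  define c where "c = 3 ^ n * K"
  have c0: "0 \<le> c" using K0 by (simp add: c_def)
  define K' where "K' = b' + c"
  have FK: "norm (F z) \<le> K' * exp (B * norm z)" for z
  proof (cases "2 * \<rho> \<le> norm z")
    case True
    have "3 ^ n * K * exp (B * norm z) \<le> K' * exp (B * norm z)" using b' by (intro mult_right_mono) (auto simp: K'_def c_def)
    then show ?thesis using far[OF True] by linarith
  next
    case False
    have "norm (F z) \<le> b" using b[of z] False by simp
    then have "norm (F z) \<le> K' * 1" unfolding K'_def mult_1_right using b' c0 by linarith
    also have "\<dots> \<le> K' * exp (B * norm z)" using et(2) c0 b' by (intro mult_left_mono) (auto simp: K'_def)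
    finally show ?thesis .
  qed
  have "norm (F (of_real x)) \<le> M" for x
  proof -
    have "norm (F (of_real x)) = norm (f (of_real x))"
      unfolding nf nF by (simp add: dist_refl_real)
    then show ?thesis using M(2) by simp
  qed
  from Phragmen_Lindelof_half_plane[OF holF FK M(1) this et(2) z] show ?thesis by (simp add: F_def)
qed

lemma norm_le_reflprod:
  assumes g: "cofactor f m A g" and z: "0 \<le> Im z"
  shows "norm (f z) \<le> norm (reflprod m A g z)"
proof -
  have "norm (f z) = norm (g z) * (\<Prod>a\<in>A. norm (z - a) ^ m a)"
    using g by (simp add: cofactor_def zprod_def norm_mult prod_norm[symmetric] norm_power)
  also have "\<dots> \<le> norm (g z) * (\<Prod>a\<in>A. norm (z - refl a) ^ m a)"
    by (intro mult_left_mono prod_mono conjI power_mono dist_refl_ge z) auto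
  also have "\<dots> = norm (reflprod m A g z)"
    by (simp add: reflprod_def norm_mult prod_norm[symmetric] norm_power)
  finally show ?thesis .
qed

text \<open>\<open>refl a - 2 * \<i>\<close>: semicircles are centred at \<open>2 * \<i>\<close> to keep them away from the zeros near
  the real axis.\<close>

definition shifted :: "complex \<Rightarrow> complex" where
  "shifted a = Complex (Re a) (- \<bar>Im a\<bar> - 2)"

lemma norm_shifted_ge: "norm a \<le> norm (shifted a)" "2 \<le> norm (shifted a)"
proof -
  have "\<bar>Im a\<bar>\<^sup>2 \<le> (\<bar>Im a\<bar> + 2)\<^sup>2" by (intro power_mono) auto
  also have "(\<bar>Im a\<bar> + 2)\<^sup>2 = (- \<bar>Im a\<bar> - 2)\<^sup>2" by (simp add: power2_eq_square algebra_simps)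
  finally have "\<bar>Im a\<bar>\<^sup>2 \<le> (- \<bar>Im a\<bar> - 2)\<^sup>2" .
  then show "norm a \<le> norm (shifted a)" by (simp add: cmod_def shifted_def)
  show "2 \<le> norm (shifted a)" using abs_Im_le_cmod[of "shifted a"] by (simp add: shifted_def)
qed

lemma norm_shifted_le: "norm (shifted a) \<le> norm a + 2"
proof -
  have "shifted a = refl a + Complex 0 (- 2)" by (simp add: complex_eq_iff shifted_def refl_def)
  then have "norm (shifted a) \<le> norm (refl a) + norm (Complex 0 (- 2))" using norm_triangle_ineq by metis
  then show ?thesis by (simp add: cmod_def[of "Complex 0 (-2)"])
qed

text \<open>Compare \<open>f\<close> with its reflected version at one point \<open>z1\<close> where
  \<open>f\<close> does not vanish. Every zero gains a factor of at least exp (p Im a / |shifted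
  a|^2), while the total gain is at most 1 / q, whichever finite set was reflected. Using
  \<open>shifted a\<close> keeps the weight regular for zeros near 0.\<close>

lemma Blaschke_half_plane:
  assumes ez: "entire_zeros f m"
    and et: "\<And>z. norm (f z) \<le> K * exp (B * norm z)" "0 \<le> B"
    and M: "0 < M" "\<And>x::real. norm (f (of_real x)) \<le> M"
  obtains W where "\<And>D. finite D \<Longrightarrow> (\<And>a. a \<in> D \<Longrightarrow> 0 < Im a) \<Longrightarrow>
    (\<Sum>a\<in>D. real (m a) * (Im a / (norm (shifted a))\<^sup>2)) \<le> W"
proof -
  interpret entire_zeros f m by fact
  have "\<exists>z. 0 < Im z \<and> f z \<noteq> 0"
  proof (rule ccontr)
    assume "\<not> ?thesis"
    then have *: "{z. 0 < Im z \<and> norm z \<le> 4} \<subseteq> {a. 0 < m a \<and> norm a \<le> 4}" using zero_iff by blast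
    have "finite {a. 0 < m a \<and> norm a \<le> 4}" using lf unfolding locally_finite_mult_def by blast
    with * have "finite {z. 0 < Im z \<and> norm z \<le> 4}" by (rule finite_subset)
    moreover have "ball (2 * \<i>) 1 \<subseteq> {z. 0 < Im z \<and> norm z \<le> 4}"
    proof
      fix z assume "z \<in> ball (2 * \<i>) 1"
      then have z: "norm (z - 2 * \<i>) < 1" by (simp add: dist_norm norm_minus_commute)
      then have "\<bar>Im z - 2\<bar> < 1" using abs_Im_le_cmod[of "z - 2 * \<i>"] by simp
      moreover have "norm z \<le> norm (z - 2 * \<i>) + norm (2 * \<i>)" using norm_triangle_ineq[of "z - 2 * \<i>" "2 * \<i>"] by simp
      ultimately show "z \<in> {z. 0 < Im z \<and> norm z \<le> 4}" using z by (auto simp: norm_mult)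
    qed
    ultimately have "finite (ball (2 * \<i>) 1)" using finite_subset by blast
    then show False using uncountable_ball[of 1 "2 * \<i>"] countable_finite by auto
  qed
  then obtain z1 where z1: "0 < Im z1" "f z1 \<noteq> 0" by blast
  define y where "y = Im z1"
  define q where "q = norm (f z1) / (M * exp (B * y))"
  have q: "0 < q" using z1 M by (simp add: q_def)
  \<comment> \<open>Since |shifted a| >= 2, this gives |z1 - refl a| <= |z1| + |a| <= k |shifted
    a|.\<close>
  define k where "k = norm z1 / 2 + 1"
  have k: "0 < k" unfolding k_def using norm_ge_zero[of z1] by linarith
  \<comment> \<open>The squared distances of z1 from \<open>a\<close> and \<open>refl a\<close>
    differ by 4 y Im a; returning from squares to moduli halves the exponent.\<close>
  define p where "p = 2 * y / k\<^sup>2"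
  have p: "0 < p" using z1 k by (simp add: p_def y_def)
  define W where "W = - ln q / p"
  have "(\<Sum>a\<in>D. real (m a) * (Im a / (norm (shifted a))\<^sup>2)) \<le> W"
    if D: "finite D" "\<And>a. a \<in> D \<Longrightarrow> 0 < Im a" for D
  proof -
    obtain g where g: "cofactor f m D g" using ex_cofactor[OF D(1)] by blast
    have fz: "norm (f z1) = norm (g z1) * (\<Prod>a\<in>D. norm (z1 - a) ^ m a)"
      using g by (simp add: cofactor_def zprod_def norm_mult prod_norm[symmetric] norm_power)
    have Fz: "norm (g z1) * (\<Prod>a\<in>D. norm (z1 - refl a) ^ m a) \<le> M * exp (B * y)"
      using reflprod_half_plane_le[OF g D(1) et M, of z1] z1
      by (simp add: reflprod_def norm_mult prod_norm[symmetric] norm_power y_def)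
    define e where "e = (\<lambda>a. Im a / (norm (shifted a))\<^sup>2)"
    have fac: "norm (z1 - a) \<le> norm (z1 - refl a) * exp (- p * e a)" if a: "a \<in> D" for a
    proof -
      have ia: "0 < Im a" using D(2)[OF a] .
      define N where "N = norm (z1 - refl a)"
      have N2: "N\<^sup>2 = (norm (z1 - a))\<^sup>2 + 4 * y * Im a"
        using ia unfolding N_def cmod_power2 by (simp add: refl_def y_def power2_sum power2_diff)
      have "0 < 4 * y * Im a" using ia z1 by (simp add: y_def)
      then have "0 < N\<^sup>2" using N2 zero_le_power2[of "norm (z1 - a)"] by linarith
      then have N0: "0 < N" unfolding N_def by simp
      have "N \<le> norm z1 + norm a" using norm_triangle_ineq4[of z1 "refl a"] by (simp add: N_def)
      also have "\<dots> \<le> norm z1 * (norm (shifted a) / 2) + norm (shifted a)"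
        using norm_shifted_ge[of a] mult_left_mono[of 1 "norm (shifted a) / 2" "norm z1"] by simp
      also have "\<dots> = k * norm (shifted a)" by (simp add: k_def algebra_simps)
      finally have "N\<^sup>2 \<le> (k * norm (shifted a))\<^sup>2" using N0 by (intro power_mono) auto
      then have le: "4 * y * Im a / (k * norm (shifted a))\<^sup>2 \<le> 4 * y * Im a / N\<^sup>2"
        using z1 ia N0 by (intro divide_left_mono mult_pos_pos) (auto simp: y_def)
      have "N\<^sup>2 * (1 + - (x / N\<^sup>2)) = N\<^sup>2 - x" for x using N0 by (simp add: right_diff_distrib)
      then have "(norm (z1 - a))\<^sup>2 = N\<^sup>2 * (1 + - (4 * y * Im a / N\<^sup>2))" using N2 by simp
      also have "\<dots> \<le> N\<^sup>2 * exp (- (4 * y * Im a / N\<^sup>2))" by (intro mult_left_mono exp_ge_add_one_self) auto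
      also have "\<dots> \<le> N\<^sup>2 * exp (- (4 * y * Im a / (k * norm (shifted a))\<^sup>2))" using le by (intro mult_left_mono) auto
      also have "\<dots> = (N * exp (- p * e a))\<^sup>2"
      proof -
        have "- (4 * y * Im a / (k * norm (shifted a))\<^sup>2) = 2 * (- p * e a)"
          by (simp add: p_def e_def power_mult_distrib)
        then show ?thesis by (simp only: power_mult_distrib exp_double)
      qed
      finally have "(norm (z1 - a))\<^sup>2 \<le> (N * exp (- p * e a))\<^sup>2" .
      then have "norm (z1 - a) \<le> N * exp (- p * e a)" by (rule power2_le_imp_le) (use N0 in simp)
      then show ?thesis by (simp add: N_def)
    qed
    have "norm (f z1) \<le> norm (g z1) * (\<Prod>a\<in>D. (norm (z1 - refl a) * exp (- p * e a)) ^ m a)"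
      unfolding fz by (intro mult_left_mono prod_mono conjI power_mono fac) auto
    also have "\<dots> = norm (g z1) * (\<Prod>a\<in>D. norm (z1 - refl a) ^ m a) * (\<Prod>a\<in>D. exp (real (m a) * (- p * e a)))"
      by (simp add: power_mult_distrib prod.distrib exp_of_nat_mult[symmetric] mult.assoc)
    also have "\<dots> \<le> M * exp (B * y) * (\<Prod>a\<in>D. exp (real (m a) * (- p * e a)))"
      by (intro mult_right_mono Fz prod_nonneg) auto
    also have "(\<Prod>a\<in>D. exp (real (m a) * (- p * e a))) = exp (\<Sum>a\<in>D. real (m a) * (- p * e a))"
      by (simp add: exp_sum[OF D(1)])
    also have "(\<Sum>a\<in>D. real (m a) * (- p * e a)) = - p * (\<Sum>a\<in>D. real (m a) * e a)"
      unfolding sum_distrib_left by (rule sum.cong) auto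
    finally have "q \<le> exp (- p * (\<Sum>a\<in>D. real (m a) * e a))"
      using M(1) by (simp add: q_def divide_le_eq mult.commute)
    then have "ln q \<le> - p * (\<Sum>a\<in>D. real (m a) * e a)"
      using ln_le_cancel_iff[OF q, of "exp (- p * (\<Sum>a\<in>D. real (m a) * e a))"] by simp
    then have "p * (\<Sum>a\<in>D. real (m a) * e a) \<le> - ln q" by simp
    then show ?thesis unfolding W_def by (subst pos_le_divide_eq[OF p]) (simp add: e_def mult.commute)
  qed
  then show thesis using that by blast
qed

text \<open>This is Im (1 / shifted a): the Blaschke weight |Im a| / |a|^2 made regular near 0,
  enlarged by a term that linear density makes summable.\<close>

definition bweight :: "complex \<Rightarrow> real" where
  "bweight a = (\<bar>Im a\<bar> + 2) / (norm (shifted a))\<^sup>2"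

lemma bweight_nonneg: "0 \<le> bweight a"
  by (simp add: bweight_def)

lemma entire_zeros_uminus:
  assumes "entire_zeros f m"
  shows "entire_zeros (\<lambda>z. f (- z)) (\<lambda>a. m (- a))"
proof -
  interpret entire_zeros f m by fact
  show ?thesis
  proof
    show "(\<lambda>z. f (- z)) holomorphic_on UNIV"
      using holomorphic_on_compose_gen[OF holomorphic_on_minus[OF holomorphic_on_id] hol] by (simp add: o_def id_def)
    show "has_mult (\<lambda>z. f (- z)) a (m (- a))" for a
    proof -
      obtain g r where g: "0 < r" "g holomorphic_on ball (- a) r"
        "\<And>z. z \<in> ball (- a) r \<Longrightarrow> f z = (z + a) ^ m (- a) * g z" "g (- a) \<noteq> 0"
        using mult[of "- a"] unfolding has_mult_def by auto
      have in_ball: "- z \<in> ball (- a) r" if "z \<in> ball a r" for z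
      proof -
        have "dist (- a) (- z) = dist a z" by (simp add: dist_norm norm_minus_commute)
        then show ?thesis using that by simp
      qed
      have "(g \<circ> uminus) holomorphic_on ball a r"
        by (rule holomorphic_on_compose_gen[OF _ g(2)]) (use in_ball in \<open>auto intro!: holomorphic_intros simp del: mem_ball\<close>)
      then have "(\<lambda>z. (- 1) ^ m (- a) * (g \<circ> uminus) z) holomorphic_on ball a r"
        by (intro holomorphic_intros)
      moreover have "f (- z) = (z - a) ^ m (- a) * ((- 1) ^ m (- a) * (g \<circ> uminus) z)" if "z \<in> ball a r" for z
      proof -
        have e: "- z + a = (- 1) * (z - a)" by simp
        have "f (- z) = (- z + a) ^ m (- a) * g (- z)" by (rule g(3)[OF in_ball[OF that]])
        then show ?thesis unfolding e power_mult_distrib by (simp add: mult_ac)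
      qed
      moreover have "(- 1) ^ m (- a) * (g \<circ> uminus) a \<noteq> 0" using g(4) by simp
      ultimately show ?thesis unfolding has_mult_def using g(1) by blast
    qed
    have "{a. 0 < m (- a) \<and> norm a \<le> R} = uminus ` {a. 0 < m a \<and> norm a \<le> R}" for R
    proof safe
      fix a assume "0 < m (- a)" "norm a \<le> R"
      then show "a \<in> uminus ` {a. 0 < m a \<and> norm a \<le> R}" by (intro image_eqI[of _ _ "- a"]) auto
    qed auto
    then show "locally_finite_mult (\<lambda>a. m (- a))" using lf by (simp add: locally_finite_mult_def)
  qed
qed

section \<open>Density of the zeros of a function of class D\<close>

locale class_D_zeros = entire_zeros f m for f m +
  fixes K B M \<delta> c :: real
  assumes et: "\<And>z. norm (f z) \<le> K * exp (B * norm z)" and B: "0 \<le> B"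
    and M: "0 < M" and bd: "\<And>x. norm (f (of_real x)) \<le> M"
    and \<delta>: "0 < \<delta>" and lower: "\<And>x. \<exists>z. dist z (Complex x 2) \<le> 1 \<and> \<delta> \<le> norm (f z)"
    and c: "0 < c" and jl: "\<And>x. c \<le> jensen f m (of_real x)"
begin

lemma strip_le: "norm (f z) \<le> M * exp (B * \<bar>Im z\<bar>)"
  by (rule Phragmen_Lindelof_plane[OF hol et M bd B])

lemma jensen_upper: "jensen f m (of_real x) \<le> M * exp B"
proof (rule jensen_le)
  fix z assume z: "dist z (complex_of_real x) = 1"
  then have "\<bar>Im z\<bar> \<le> 1" using abs_Im_le_cmod[of "z - of_real x"] by (simp add: dist_norm)
  then have "B * \<bar>Im z\<bar> \<le> B" using mult_left_mono[of "\<bar>Im z\<bar>" 1 B] B by simp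
  then have "M * exp (B * \<bar>Im z\<bar>) \<le> M * exp B" using M by simp
  then show "norm (f z) \<le> M * exp B" using strip_le[of z] by linarith
qed

definition count_const :: real where "count_const = (\<bar>ln (M / c)\<bar> + 2 * B) / ln 2"

text \<open>Jensen on the circle of radius 2 r: the strip bound gives M exp (2 B r) from above and
  \<open>jl\<close> gives c from below. Uniformity in the centre x is what the proof of (iii)
  exploits.\<close>

lemma count_real_centre: "1 \<le> r \<Longrightarrow> real (count_fn m (of_real x) r) \<le> count_const * r"
proof -
  assume r: "1 \<le> r"
  define n where "n = count_fn m (of_real x) r"
  have "jensen f m (of_real x) * 2 ^ n \<le> M * exp (2 * B * r)" unfolding n_def
  proof (rule two_power_count_le[OF r])
    fix z assume z: "dist z (complex_of_real x) = 2 * r"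
    then have "\<bar>Im z\<bar> \<le> 2 * r" using abs_Im_le_cmod[of "z - of_real x"] by (simp add: dist_norm)
    then have "B * \<bar>Im z\<bar> \<le> 2 * B * r" using mult_left_mono[of "\<bar>Im z\<bar>" "2 * r" B] B by simp
    then have "M * exp (B * \<bar>Im z\<bar>) \<le> M * exp (2 * B * r)" using M by simp
    then show "norm (f z) \<le> M * exp (2 * B * r)" using strip_le[of z] by linarith
  qed
  moreover have "c * 2 ^ n \<le> jensen f m (of_real x) * 2 ^ n" by (intro mult_right_mono jl) auto
  ultimately have "c * 2 ^ n \<le> M * exp (2 * B * r)" by linarith
  then have le: "2 ^ n \<le> M / c * exp (2 * B * r)" using c by (simp add: field_simps)
  define q where "q = M / c"
  have q: "0 < q" using M c by (simp add: q_def)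
  have "ln (2 ^ n) \<le> ln (q * exp (2 * B * r))"
    using q le[folded q_def] by (subst ln_le_cancel_iff) auto
  then have "real n * ln 2 \<le> ln (M / c) + 2 * B * r"
    using q by (simp add: ln_realpow ln_mult_pos flip: q_def)
  also have "\<dots> \<le> \<bar>ln (M / c)\<bar> * r + 2 * B * r"
    using r mult_left_mono[of 1 r "\<bar>ln (M / c)\<bar>"] by simp
  also have "\<dots> = (\<bar>ln (M / c)\<bar> + 2 * B) * r" by (simp add: algebra_simps)
  finally have "real n \<le> (\<bar>ln (M / c)\<bar> + 2 * B) * r / ln 2" by (simp add: pos_le_divide_eq)
  then show ?thesis by (simp add: n_def count_const_def)
qed

sublocale linear_count m count_const
  by unfold_locales (use lf count_real_centre[where x = 0] in auto)

text \<open>Three contributions: the Blaschke condition above the real axis, the same for the zeros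
  of f (- z) below it, and linear density for the 2 added to |Im a|.\<close>

lemma sum_bweight_bounded:
  obtains W where "\<And>D. finite D \<Longrightarrow> (\<Sum>a\<in>D. real (m a) * bweight a) \<le> W"
proof -
  obtain W1 where W1: "\<And>D. finite D \<Longrightarrow> (\<And>a. a \<in> D \<Longrightarrow> 0 < Im a) \<Longrightarrow>
    (\<Sum>a\<in>D. real (m a) * (Im a / (norm (shifted a))\<^sup>2)) \<le> W1"
    using Blaschke_half_plane[OF _ et B M bd] entire_zeros_axioms by blast
  obtain W2 where W2: "\<And>D. finite D \<Longrightarrow> (\<And>a. a \<in> D \<Longrightarrow> 0 < Im a) \<Longrightarrow>
    (\<Sum>a\<in>D. real (m (- a)) * (Im a / (norm (shifted a))\<^sup>2)) \<le> W2"
  proof (rule Blaschke_half_plane[OF entire_zeros_uminus[OF entire_zeros_axioms] _ B M])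
    show "norm (f (- z)) \<le> K * exp (B * norm z)" for z using et[of "- z"] by simp
    show "norm (f (- of_real x)) \<le> M" for x using bd[of "- x"] by simp
  qed blast
  \<comment> \<open>Zeros in the unit disc have added weight at most 2 / 2^2 <= 1; the 8 is twice
    the 4 of \<open>sum_inverse_square_le\<close> at R = 1.\<close>
  define W3 where "W3 = real (count_fn m 0 1) + 8 * count_const"
  have "(\<Sum>a\<in>D. real (m a) * bweight a) \<le> W1 + W2 + W3" if D: "finite D" for D
  proof -
    define u where "u = (\<lambda>a. real (m a) * (\<bar>Im a\<bar> / (norm (shifted a))\<^sup>2))"
    define v where "v = (\<lambda>a. real (m a) * (2 / (norm (shifted a))\<^sup>2))"
    have "(\<Sum>a\<in>D. real (m a) * bweight a) = sum u D + sum v D"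
      unfolding u_def v_def bweight_def sum.distrib[symmetric] by (rule sum.cong) (auto simp: add_divide_distrib algebra_simps)
    also have "sum u D = sum u {a\<in>D. 0 < Im a} + sum u {a\<in>D. Im a < 0}"
    proof -
      have "sum u {a\<in>D. 0 < Im a} + sum u {a\<in>D. Im a < 0} = sum u ({a\<in>D. 0 < Im a} \<union> {a\<in>D. Im a < 0})"
        by (rule sum.union_disjoint[symmetric]) (use D in auto)
      also have "\<dots> = sum u D" by (rule sum.mono_neutral_left) (use D in \<open>auto simp: u_def\<close>)
      finally show ?thesis by simp
    qed
    also have "sum u {a\<in>D. 0 < Im a} \<le> W1"
    proof -
      have "sum u {a\<in>D. 0 < Im a} = (\<Sum>a\<in>{a\<in>D. 0 < Im a}. real (m a) * (Im a / (norm (shifted a))\<^sup>2))"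
        by (rule sum.cong) (simp_all add: u_def)
      also have "\<dots> \<le> W1" by (rule W1) (use D in simp_all)
      finally show ?thesis .
    qed
    also have "sum u {a\<in>D. Im a < 0} \<le> W2"
    proof -
      have "sum u {a\<in>D. Im a < 0} = (\<Sum>a\<in>uminus ` {a\<in>D. Im a < 0}. real (m (- a)) * (Im a / (norm (shifted a))\<^sup>2))"
        by (subst sum.reindex) (auto simp: u_def shifted_def cmod_def intro!: sum.cong)
      also have "\<dots> \<le> W2" by (rule W2) (use D in auto)
      finally show ?thesis .
    qed
    also have "sum v D \<le> W3"
    proof -
      have "sum v D = sum v {a\<in>D. norm a < 1} + sum v {a\<in>D. 1 \<le> norm a}"
      proof -
        have "sum v {a\<in>D. norm a < 1} + sum v {a\<in>D. 1 \<le> norm a} = sum v ({a\<in>D. norm a < 1} \<union> {a\<in>D. 1 \<le> norm a})"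
          by (rule sum.union_disjoint[symmetric]) (use D in auto)
        also have "{a\<in>D. norm a < 1} \<union> {a\<in>D. 1 \<le> norm a} = D" by auto
        finally show ?thesis by simp
      qed
      also have "sum v {a\<in>D. norm a < 1} \<le> (\<Sum>a\<in>{a\<in>D. norm a < 1}. real (m a))"
      proof (rule sum_mono)
        fix a
        have "2\<^sup>2 \<le> (norm (shifted a))\<^sup>2" using norm_shifted_ge(2)[of a] by (intro power_mono) auto
        then have "2 / (norm (shifted a))\<^sup>2 \<le> 1" by (simp add: divide_le_eq)
        then show "v a \<le> real (m a)" unfolding v_def using mult_left_mono[of "2 / (norm (shifted a))\<^sup>2" 1 "real (m a)"] by simp
      qed
      also have "\<dots> \<le> real (count_fn m 0 1)" by (rule sum_mult_le_count_fn[OF lf]) auto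
      also have "sum v {a\<in>D. 1 \<le> norm a} \<le> (\<Sum>a\<in>{a\<in>D. 1 \<le> norm a}. 2 * (real (m a) / (norm a)\<^sup>2))"
      proof (rule sum_mono)
        fix a assume a: "a \<in> {a\<in>D. 1 \<le> norm a}"
        then have "0 < norm a" by auto
        then have "1 / (norm (shifted a))\<^sup>2 \<le> 1 / (norm a)\<^sup>2"
          using norm_shifted_ge[of a] by (intro divide_left_mono power_mono mult_pos_pos) auto
        then have "(2 * real (m a)) * (1 / (norm (shifted a))\<^sup>2) \<le> (2 * real (m a)) * (1 / (norm a)\<^sup>2)" by (intro mult_left_mono) auto
        then show "v a \<le> 2 * (real (m a) / (norm a)\<^sup>2)" by (simp add: v_def mult_ac)
      qed
      also have "\<dots> = 2 * (\<Sum>a\<in>{a\<in>D. 1 \<le> norm a}. real (m a) / (norm a)\<^sup>2)" by (simp add: sum_distrib_left)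
      also have "\<dots> \<le> 2 * (4 * count_const / 1)" by (intro mult_left_mono sum_inverse_square_le) (use D in auto)
      finally show ?thesis by (simp add: W3_def)
    qed
    finally show ?thesis by simp
  qed
  then show thesis using that by blast
qed

text \<open>A finite set whose sum is within \<epsilon> of the supremum leaves at most \<epsilon>
  for every finite set disjoint from it.\<close>

lemma bweight_tail:
  assumes e: "0 < \<epsilon>"
  obtains R0 where "\<And>D. finite D \<Longrightarrow> (\<And>a. a \<in> D \<Longrightarrow> R0 \<le> norm a) \<Longrightarrow> (\<Sum>a\<in>D. real (m a) * bweight a) \<le> \<epsilon>"
proof -
  define S where "S = (\<lambda>D. \<Sum>a\<in>D. real (m a) * bweight a)"
  obtain W where W: "\<And>D. finite D \<Longrightarrow> S D \<le> W" using sum_bweight_bounded unfolding S_def by blast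
  define s where "s = Sup (S ` {D. finite D})"
  have bdd: "bdd_above (S ` {D. finite D})" by (rule bdd_aboveI2[of _ _ W]) (use W in auto)
  have le: "S D \<le> s" if "finite D" for D unfolding s_def using that by (intro cSUP_upper bdd) auto
  have "\<exists>x\<in>S ` {D. finite D}. s - \<epsilon> < x"
    using less_cSup_iff[OF _ bdd, of "s - \<epsilon>"] e by (auto simp: s_def)
  then obtain D0 where D0: "finite D0" "s - \<epsilon> < S D0" by auto
  define R0 where "R0 = (\<Sum>a\<in>D0. norm a) + 1"
  have "S D \<le> \<epsilon>" if D: "finite D" "\<And>a. a \<in> D \<Longrightarrow> R0 \<le> norm a" for D
  proof -
    have "a \<notin> D0" if "a \<in> D" for a
    proof
      assume "a \<in> D0"
      then have "norm a \<le> (\<Sum>a\<in>D0. norm a)" using D0 by (intro member_le_sum) auto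
      then show False using D(2)[OF \<open>a \<in> D\<close>] by (simp add: R0_def)
    qed
    then have "S (D0 \<union> D) = S D0 + S D" unfolding S_def by (intro sum.union_disjoint) (use D0 D in auto)
    then show ?thesis using le[of "D0 \<union> D"] D0 D by simp
  qed
  then show thesis using that unfolding S_def by blast
qed

text \<open>A zero in the annulus either lies in a disc of radius \<epsilon> t about t or - t, where
  \<open>count_real_centre\<close> allows O(\<epsilon> t) of them, or satisfies |Im a| >= \<epsilon>
  t / 2. In the latter case its weight is at least \<epsilon> / (20 t), and the small tail of the
  Blaschke sum limits the number.\<close>

lemma annulus_count_smallo:
  "(\<lambda>t. real (count_fn m 0 (t + 1)) - real (count_fn m 0 t)) \<in> o[at_top](\<lambda>t. t)"
proof (rule landau_o.smallI)
  fix e :: real assume e: "0 < e"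
  \<comment> \<open>Chosen so that \<open>count_const\<close> times \<epsilon> is at most e / 8; two
    discs then hold at most e t / 4. Below, \<eta> is matched to it so that the far zeros number at
    most 20 t \<eta> / \<epsilon> = e t / 2.\<close>
  define \<epsilon> where "\<epsilon> = e / (8 * (count_const + 1))"
  have \<epsilon>: "0 < \<epsilon>" using e C_nonneg by (simp add: \<epsilon>_def)
  define \<eta> where "\<eta> = e * \<epsilon> / 40"
  have \<eta>: "0 < \<eta>" using e \<epsilon> by (simp add: \<eta>_def)
  obtain R0 where R0: "\<And>D. finite D \<Longrightarrow> (\<And>a. a \<in> D \<Longrightarrow> R0 \<le> norm a) \<Longrightarrow> (\<Sum>a\<in>D. real (m a) * bweight a) \<le> \<eta>"
    by (rule bweight_tail[OF \<eta>]) blast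
  \<comment> \<open>The bound 2 / \<epsilon> makes \<epsilon> t >= 2: the discs have radius at least
    1, and the width 1 of the annulus is absorbed in \<epsilon> t / 2.\<close>
  define T where "T = max 3 (max R0 (2 / \<epsilon>))"
  have "norm (real (count_fn m 0 (t + 1)) - real (count_fn m 0 t)) \<le> e * norm t" if t: "T \<le> t" for t
  proof -
    have t1: "3 \<le> t" "R0 \<le> t" "2 / \<epsilon> \<le> t" using t by (auto simp: T_def)
    have \<epsilon>t: "2 \<le> \<epsilon> * t" using t1(3) \<epsilon> by (simp add: divide_le_eq mult.commute)
    define D where "D = {a. 0 < m a \<and> dist a 0 \<le> t + 1} - {a. 0 < m a \<and> dist a 0 \<le> t}"
    have finD: "finite D" unfolding D_def using finite_count_set[OF lf] by blast
    have Dt: "t < norm a" "norm a \<le> t + 1" if "a \<in> D" for a using that by (auto simp: D_def)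
    have eq: "real (count_fn m 0 (t + 1)) - real (count_fn m 0 t) = (\<Sum>a\<in>D. real (m a))"
      unfolding D_def count_fn_def of_nat_sum
      by (rule sum_diff[symmetric, OF finite_count_set[OF lf]]) auto
    define near where "near = D \<inter> (cball (of_real t) (\<epsilon> * t) \<union> cball (of_real (- t)) (\<epsilon> * t))"
    define far where "far = D - near"
    have farw: "\<epsilon> / (20 * t) \<le> bweight a" if a: "a \<in> far" for a
    proof -
      have aD: "a \<in> D" using a by (simp add: far_def)
      have "\<epsilon> * t / 2 \<le> \<bar>Im a\<bar>"
      proof (rule ccontr)
        assume "\<not> ?thesis"
        then have im: "\<bar>Im a\<bar> < \<epsilon> * t / 2" by simp
        have "norm a \<le> \<bar>Re a\<bar> + \<bar>Im a\<bar>" by (rule cmod_le)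
        then have "t - \<epsilon> * t / 2 \<le> \<bar>Re a\<bar>" using Dt[OF aD] im by linarith
        moreover have "\<bar>Re a\<bar> \<le> t + 1" using abs_Re_le_cmod[of a] Dt[OF aD] by linarith
        ultimately have re: "\<bar>\<bar>Re a\<bar> - t\<bar> \<le> \<epsilon> * t / 2" using \<epsilon>t by linarith
        have "a \<in> near"
        proof (cases "0 \<le> Re a")
          case True
          have "norm (a - of_real t) \<le> \<bar>Re a - t\<bar> + \<bar>Im a\<bar>" using cmod_le[of "a - of_real t"] by simp
          then have "dist (of_real t) a \<le> \<epsilon> * t" using re im True by (simp add: dist_norm norm_minus_commute)
          then show ?thesis using aD by (simp add: near_def)
        next
          case False
          have "norm (a - of_real (- t)) \<le> \<bar>Re a + t\<bar> + \<bar>Im a\<bar>" using cmod_le[of "a - of_real (- t)"] by simp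
          then have "dist (of_real (- t)) a \<le> \<epsilon> * t" using re im False unfolding dist_norm norm_minus_commute[of "of_real (- t)"] by linarith
          then show ?thesis using aD by (simp add: near_def)
        qed
        then show False using a by (simp add: far_def)
      qed
      moreover have "norm (shifted a) \<le> 3 * t"
        using norm_shifted_le[of a] Dt[OF aD] t1 by linarith
      then have "(norm (shifted a))\<^sup>2 \<le> (3 * t)\<^sup>2" by (intro power_mono) auto
      moreover have "0 < norm (shifted a)" using norm_shifted_ge(2)[of a] by linarith
      ultimately have "(\<epsilon> * t / 2) / (3 * t)\<^sup>2 \<le> bweight a" unfolding bweight_def by (intro frac_le) auto
      moreover have "(\<epsilon> * t / 2) / (3 * t)\<^sup>2 = \<epsilon> / (18 * t)" using t1 by (simp add: power2_eq_square)
      moreover have "\<epsilon> / (20 * t) \<le> \<epsilon> / (18 * t)" using t1 \<epsilon> by (intro divide_left_mono) auto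
      ultimately show ?thesis by linarith
    qed
    have "(\<Sum>a\<in>far. real (m a)) * (\<epsilon> / (20 * t)) \<le> (\<Sum>a\<in>far. real (m a) * bweight a)"
      unfolding sum_distrib_right by (intro sum_mono mult_left_mono farw) auto
    also have "\<dots> \<le> \<eta>"
    proof (rule R0)
      show "finite far" using finD by (simp add: far_def)
      show "R0 \<le> norm a" if "a \<in> far" for a using Dt[of a] that t1 by (auto simp: far_def)
    qed
    finally have "(\<Sum>a\<in>far. real (m a)) \<le> \<eta> / (\<epsilon> / (20 * t))" using \<epsilon> t1 by (subst pos_le_divide_eq) auto
    also have "\<dots> = e * t / 2" using \<epsilon> t1 by (simp add: \<eta>_def)
    finally have f1: "(\<Sum>a\<in>far. real (m a)) \<le> e * t / 2" .
    have n1: "(\<Sum>a\<in>near. real (m a)) \<le> e * t / 2"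
    proof -
      have one: "(\<Sum>a\<in>near \<inter> cball (of_real x) (\<epsilon> * t). real (m a)) \<le> count_const * (\<epsilon> * t)" for x
      proof -
        have "(\<Sum>a\<in>near \<inter> cball (of_real x) (\<epsilon> * t). real (m a)) \<le> real (count_fn m (of_real x) (\<epsilon> * t))"
          by (rule sum_mult_le_count_fn[OF lf]) auto
        also have "\<dots> \<le> count_const * (\<epsilon> * t)" using \<epsilon>t by (intro count_real_centre) auto
        finally show ?thesis .
      qed
      define N1 where "N1 = near \<inter> cball (of_real t) (\<epsilon> * t)"
      define N2 where "N2 = near \<inter> cball (of_real (- t)) (\<epsilon> * t)"
      have fin12: "finite N1" "finite N2" using finD by (auto simp: N1_def N2_def near_def)
      have "(\<Sum>a\<in>near. real (m a)) = (\<Sum>a\<in>N1 \<union> N2. real (m a))"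
        by (rule sum.cong) (auto simp: N1_def N2_def near_def)
      also have "\<dots> = (\<Sum>a\<in>N1. real (m a)) + (\<Sum>a\<in>N2. real (m a)) - (\<Sum>a\<in>N1 \<inter> N2. real (m a))"
        by (rule sum_Un[OF fin12])
      also have "\<dots> \<le> (\<Sum>a\<in>N1. real (m a)) + (\<Sum>a\<in>N2. real (m a))" by (simp add: sum_nonneg)
      also have "\<dots> \<le> count_const * (\<epsilon> * t) + count_const * (\<epsilon> * t)" unfolding N1_def N2_def by (intro add_mono one)
      also have "\<dots> = 2 * t * (count_const * \<epsilon>)" by simp
      also have "\<dots> \<le> 2 * t * (e / 8)"
      proof (rule mult_left_mono)
        have "count_const * e \<le> (count_const + 1) * e" using e by simp
        then show "count_const * \<epsilon> \<le> e / 8" using C_nonneg by (simp add: \<epsilon>_def divide_le_eq algebra_simps)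
      qed (use t1 in simp)
      also have "\<dots> \<le> e * t / 2" using e t1 by simp
      finally show ?thesis .
    qed
    have "(\<Sum>a\<in>D. real (m a)) = (\<Sum>a\<in>far. real (m a)) + (\<Sum>a\<in>near. real (m a))"
      unfolding far_def by (rule sum.subset_diff) (use finD in \<open>auto simp: near_def\<close>)
    then have "(\<Sum>a\<in>D. real (m a)) \<le> e * t" using f1 n1 by simp
    moreover have "0 \<le> (\<Sum>a\<in>D. real (m a))" by (intro sum_nonneg) auto
    ultimately show ?thesis unfolding eq using t1 by simp
  qed
  then show "\<forall>\<^sub>F t in at_top. norm (real (count_fn m 0 (t + 1)) - real (count_fn m 0 t)) \<le> e * norm t"
    unfolding eventually_at_top_linorder by blast
qed

end

subsection \<open>The semicircle kernel\<close>

text \<open>For Im s < 0, the closed form of the mean of 1 / (z - s) over the upper half of the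
  circle |z| = R; the logarithms are the end values of an antiderivative in the angle.\<close>

definition arcker :: "real \<Rightarrow> complex \<Rightarrow> complex" where
  "arcker R s = - 1 / s + (Ln (- of_real R - s) - Ln (of_real R - s)) / (\<i> * of_real pi * s)"

lemma arcker_integral:
  assumes R: "0 \<le> R" and s: "Im s < 0"
  shows "((\<lambda>\<theta>. 1 / (of_real R * exp (\<i> * of_real \<theta>) - s)) has_integral of_real pi * arcker R s) {0..pi}"
proof -
  define \<phi> where "\<phi> = (\<lambda>w. Ln (of_real R * exp (\<i> * w) - s) / (\<i> * s) - w / s)"
  have s0: "s \<noteq> 0" using s by auto
  have "((\<lambda>\<theta>. 1 / (of_real R * exp (\<i> * of_real \<theta>) - s)) has_integral \<phi> (of_real pi) - \<phi> (of_real 0)) {0..pi}"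
  proof (rule fundamental_theorem_of_calculus)
    fix \<theta> assume \<theta>: "\<theta> \<in> {0..pi}"
    define u where "u = of_real R * exp (\<i> * of_real \<theta>) - s"
    have "0 \<le> R * sin \<theta>" using R \<theta> by (simp add: sin_ge_zero)
    \<comment> \<open>Along the whole semicircle z - s stays in the upper half plane, so the
      principal logarithm has no jump.\<close>
    then have iu: "0 < Im u" using s by (simp add: u_def Im_exp)
    then have u: "u \<notin> \<real>\<^sub>\<le>\<^sub>0" "u \<noteq> 0" by (auto simp: complex_nonpos_Reals_iff)
    have "(\<phi> has_field_derivative (of_real R * (\<i> * exp (\<i> * of_real \<theta>)) / u) / (\<i> * s) - 1 / s) (at (of_real \<theta>))"
      unfolding \<phi>_def using u s0 unfolding u_def
      by (auto intro!: derivative_eq_intros simp: field_simps)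
    also have "(of_real R * (\<i> * exp (\<i> * of_real \<theta>)) / u) / (\<i> * s) - 1 / s = 1 / u"
    proof -
      have "of_real R * exp (\<i> * of_real \<theta>) = u + s" by (simp add: u_def)
      then have "(of_real R * (\<i> * exp (\<i> * of_real \<theta>)) / u) / (\<i> * s) = (u + s) / (u * s)"
        using s0 u by (simp add: field_simps)
      then show ?thesis using s0 u by (simp add: field_simps)
    qed
    finally show "((\<lambda>\<theta>. \<phi> (of_real \<theta>)) has_vector_derivative 1 / (of_real R * exp (\<i> * of_real \<theta>) - s)) (at \<theta> within {0..pi})"
      unfolding u_def by (rule has_vector_derivative_real_field)
  qed simp
  also have "\<phi> (of_real pi) - \<phi> (of_real 0) = of_real pi * arcker R s"
  proof -
    have "exp (\<i> * of_real pi) = -1" by (simp add: exp_pi_i')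
    then show ?thesis using s0 by (simp add: \<phi>_def arcker_def field_simps)
  qed
  finally show ?thesis .
qed

lemma ln_norm_diff_le:
  fixes u v :: complex
  assumes d: "0 < d" "d \<le> norm u" "d \<le> norm v" and p: "\<bar>norm u - norm v\<bar> \<le> p"
  shows "\<bar>ln (norm u) - ln (norm v)\<bar> \<le> p / d"
proof -
  have *: "ln x - ln y \<le> p / d" if "d \<le> x" "d \<le> y" "x - y \<le> p" "0 \<le> p" for x y
  proof -
    have xy: "0 < x" "0 < y" using d that by linarith+
    have "ln x - ln y = ln (x / y)" using xy by (simp add: ln_div)
    also have "\<dots> \<le> x / y - 1" using xy by (intro ln_le_minus_one) simp
    also have "\<dots> = (x - y) / y" using xy by (simp add: diff_divide_distrib)
    also have "\<dots> \<le> p / y" using that xy by (intro divide_right_mono) auto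
    also have "\<dots> \<le> p / d" using that xy d by (intro divide_left_mono) auto
    finally show ?thesis .
  qed
  have "0 \<le> p" using p by linarith
  then have "ln (norm u) - ln (norm v) \<le> p / d" "ln (norm v) - ln (norm u) \<le> p / d"
    using p d by (auto intro!: *)
  then show ?thesis by linarith
qed

lemma Arg_upper_le:
  assumes "0 < Im w"
  shows "0 < Im (Ln w)" "Im (Ln w) < pi"
    "0 < Re w \<Longrightarrow> Im (Ln w) \<le> Im w / Re w" "Re w < 0 \<Longrightarrow> pi - Im (Ln w) \<le> Im w / - Re w"
proof -
  have w0: "w \<noteq> 0" using assms by auto
  show "0 < Im (Ln w)" "Im (Ln w) < pi" using Im_Ln_pos_lt_imp[OF assms] by auto
  show "Im (Ln w) \<le> Im w / Re w" if "0 < Re w"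
    using arctan_le_self[of "Im w / Re w"] assms that by (simp add: Im_Ln_eq[OF w0])
  show "pi - Im (Ln w) \<le> Im w / - Re w" if "Re w < 0"
  proof -
    have "0 \<le> - (Im w / Re w)" using assms that by (simp add: divide_nonneg_neg)
    then have "arctan (- (Im w / Re w)) \<le> - (Im w / Re w)" by (rule arctan_le_self)
    then show ?thesis using assms that by (simp add: Im_Ln_eq[OF w0] arctan_minus)
  qed
qed

text \<open>Compared with the sharp cutoff \<open>[norm a < R]\<close>: for real \<open>s\<close> the real part of
  \<open>arcker R s\<close> is \<open>0\<close> if \<open>\<bar>s\<bar> < R\<close> and \<open>- 1 / s\<close> if \<open>\<bar>s\<bar> > R\<close>.\<close>

definition kernel_error :: "real \<Rightarrow> complex \<Rightarrow> real" where
  "kernel_error R a = Re (arcker R (shifted a)) + (if R \<le> norm a then Re (1 / shifted a) else 0)"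

text \<open>With s = \<open>shifted a\<close>, let d1 be the argument of R - s and d2 be pi minus
  the argument of - R - s, and let L be the logarithm of the ratio of the distances of s from - R
  and R. Then \<open>arcker R s\<close> is (- d1 - d2 - i L) / (pi s). Thus L is multiplied by Im (1
  / s), which is the Blaschke weight, and the angles by Re (1 / s).\<close>

lemma kernel_error_cases:
  assumes R: "0 < R"
  obtains \<delta> L where
    "kernel_error R a = (L * bweight a - \<delta> * Re a / (norm (shifted a))\<^sup>2) / pi"
    "\<bar>\<delta>\<bar> \<le> 2 * pi"
    "norm a < R \<Longrightarrow> \<bar>Re a\<bar> < R \<Longrightarrow> \<bar>\<delta>\<bar> \<le> 2 * (\<bar>Im a\<bar> + 2) / (R - \<bar>Re a\<bar>)"
    "R < \<bar>Re a\<bar> \<Longrightarrow> \<bar>\<delta>\<bar> \<le> (\<bar>Im a\<bar> + 2) / (\<bar>Re a\<bar> - R)"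
    "\<And>d p. 0 < d \<Longrightarrow> d \<le> norm (of_real R - shifted a) \<Longrightarrow> d \<le> norm (of_real R + shifted a)
      \<Longrightarrow> \<bar>norm (of_real R + shifted a) - norm (of_real R - shifted a)\<bar> \<le> p \<Longrightarrow> \<bar>L\<bar> \<le> p / d"
proof -
  define x where "x = Re a"
  define h where "h = \<bar>Im a\<bar> + 2"
  define s where "s = shifted a"
  have s: "Re s = x" "Im s = - h" by (simp_all add: s_def shifted_def x_def h_def)
  have h: "2 \<le> h" by (simp add: h_def)
  define u where "u = - of_real R - s"
  define v where "v = of_real R - s"
  have uv: "Re u = - R - x" "Im u = h" "Re v = R - x" "Im v = h" by (simp_all add: u_def v_def s)
  have ne: "s \<noteq> 0" "u \<noteq> 0" "v \<noteq> 0" using h s uv by (auto simp: complex_eq_iff)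
  define L where "L = ln (norm u) - ln (norm v)"
  define d1 where "d1 = Im (Ln v)"
  define d2 where "d2 = pi - Im (Ln u)"
  have d1: "0 < d1" "d1 < pi" "0 < R - x \<Longrightarrow> d1 \<le> h / (R - x)" "R - x < 0 \<Longrightarrow> pi - d1 \<le> h / (x - R)"
    using Arg_upper_le[of v] h by (simp_all add: d1_def uv)
  have d2: "0 < d2" "d2 < pi" "0 < R + x \<Longrightarrow> d2 \<le> h / (R + x)" "R + x < 0 \<Longrightarrow> pi - d2 \<le> h / (- R - x)"
    using Arg_upper_le[of u] h by (simp_all add: d2_def uv add.commute)
  \<comment> \<open>For s near the real axis d1 + d2 is close to 0 inside the circle and close to pi
    outside it; the cutoff term of \<open>kernel_error\<close> subtracts exactly this pi.\<close>
  define \<delta> where "\<delta> = (if R \<le> norm a then d1 + d2 - pi else d1 + d2)"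
  have n2: "(norm s)\<^sup>2 = x\<^sup>2 + h\<^sup>2" by (simp add: cmod_power2 s)
  have "Ln u - Ln v = Complex L (pi - d1 - d2)"
    using ne by (simp add: complex_eq_iff L_def d1_def d2_def)
  then have "arcker R s = - 1 / s + Complex L (pi - d1 - d2) / (\<i> * of_real pi * s)"
    by (simp add: arcker_def u_def v_def)
  also have "\<dots> = (Complex (- d1 - d2) (- L) / of_real pi) * (1 / s)"
  proof -
    have "Complex L (pi - d1 - d2) = \<i> * (of_real pi + Complex (- d1 - d2) (- L))" by (simp add: complex_eq_iff)
    then show ?thesis using ne by (simp add: field_simps)
  qed
  finally have arc: "arcker R s = (Complex (- d1 - d2) (- L) / of_real pi) * (1 / s)" .
  have split: "Re ((Complex p q / of_real pi) * t) = (p * Re t - q * Im t) / pi" for p q t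
    by (simp add: Re_divide_of_real Im_divide_of_real diff_divide_distrib)
  have inv: "Re (1 / s) = x / (norm s)\<^sup>2" "Im (1 / s) = h / (norm s)\<^sup>2"
    by (simp_all add: Re_divide Im_divide s n2)
  have "Re (arcker R s) = ((- d1 - d2) * (x / (norm s)\<^sup>2) - (- L) * (h / (norm s)\<^sup>2)) / pi"
    unfolding arc split inv ..
  moreover note inv(1)
  ultimately have "kernel_error R a = (L * h / (norm s)\<^sup>2 - \<delta> * x / (norm s)\<^sup>2) / pi"
    unfolding kernel_error_def s_def[symmetric] \<delta>_def
    by (simp add: field_simps add_divide_distrib diff_divide_distrib)
  then have "kernel_error R a = (L * bweight a - \<delta> * Re a / (norm (shifted a))\<^sup>2) / pi"
    by (simp add: bweight_def h_def x_def s_def)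
  moreover have "\<bar>\<delta>\<bar> \<le> 2 * pi" using d1(1,2) d2(1,2) by (auto simp: \<delta>_def abs_le_iff)
  moreover have "\<bar>\<delta>\<bar> \<le> 2 * (\<bar>Im a\<bar> + 2) / (R - \<bar>Re a\<bar>)" if "norm a < R" "\<bar>Re a\<bar> < R"
  proof -
    have "d1 \<le> h / (R - x)" "d2 \<le> h / (R + x)" using d1(3) d2(3) that(2) by (auto simp: x_def)
    moreover have "h / (R - x) \<le> h / (R - \<bar>x\<bar>)" "h / (R + x) \<le> h / (R - \<bar>x\<bar>)"
      using that(2) h by (auto intro!: divide_left_mono mult_pos_pos simp: x_def)
    moreover have "2 * h / (R - \<bar>x\<bar>) = h / (R - \<bar>x\<bar>) + h / (R - \<bar>x\<bar>)" by simp
    ultimately have "d1 + d2 \<le> 2 * h / (R - \<bar>x\<bar>)" by linarith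
    then show ?thesis using that(1) d1(1) d2(1) by (simp add: \<delta>_def h_def x_def)
  qed
  moreover have "\<bar>\<delta>\<bar> \<le> (\<bar>Im a\<bar> + 2) / (\<bar>Re a\<bar> - R)" if "R < \<bar>Re a\<bar>"
  proof -
    have na: "R \<le> norm a" using that abs_Re_le_cmod[of a] by linarith
    have pos: "h / (R + \<bar>x\<bar>) \<le> h / (\<bar>x\<bar> - R)"
      using that h R by (auto intro!: divide_left_mono mult_pos_pos simp: x_def)
    have "\<bar>d1 + d2 - pi\<bar> \<le> h / (\<bar>x\<bar> - R)"
    proof (cases "0 \<le> x")
      case True
      then have "pi - d1 \<le> h / (\<bar>x\<bar> - R)" "d2 \<le> h / (R + \<bar>x\<bar>)" using d1(4) d2(3) that R by (auto simp: x_def)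
      then show ?thesis using d1 d2 pos by linarith
    next
      case False
      then have e: "- R - x = \<bar>x\<bar> - R" "R - x = R + \<bar>x\<bar>" by auto
      have "pi - d2 \<le> h / (\<bar>x\<bar> - R)" using d2(4) False that unfolding e(1) by (auto simp: x_def)
      moreover have "d1 \<le> h / (R + \<bar>x\<bar>)" using d1(3) R unfolding e(2) by auto
      ultimately have "pi - d2 \<le> h / (\<bar>x\<bar> - R)" "d1 \<le> h / (R + \<bar>x\<bar>)" by blast+
      then show ?thesis using d1 d2 pos by linarith
    qed
    then show ?thesis using na by (simp add: \<delta>_def h_def x_def)
  qed
  moreover have "\<bar>L\<bar> \<le> p / d" if "0 < d" "d \<le> norm (of_real R - shifted a)" "d \<le> norm (of_real R + shifted a)"
    "\<bar>norm (of_real R + shifted a) - norm (of_real R - shifted a)\<bar> \<le> p" for d p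
  proof -
    have "norm u = norm (of_real R + shifted a)" unfolding u_def s_def
      by (metis minus_add_distrib norm_minus_cancel uminus_add_conv_diff add.commute diff_conv_add_uminus)
    then show ?thesis unfolding L_def using that by (intro ln_norm_diff_le) (auto simp: v_def s_def)
  qed
  ultimately show thesis by (rule that)
qed

text \<open>Three regimes. For |s| <= R / 2 both distances to the corners are comparable with R,
  which wins a factor |s| / R. At distance at least \<epsilon> R from the corners the error is the
  Blaschke weight times O(1 / \<epsilon>). Near a corner only O(1 / R) is available, to be paired
  with a small count.\<close>

lemma kernel_error_bounds:
  assumes R: "0 < R"
  shows kernel_error_small: "2 * norm (shifted a) \<le> R \<Longrightarrow> \<bar>kernel_error R a\<bar> \<le> 4 * (norm (shifted a) / R) * bweight a"
    and kernel_error_off: "\<And>\<epsilon>. 0 < \<epsilon> \<Longrightarrow> \<epsilon> \<le> 1 \<Longrightarrow> R \<le> 2 * norm (shifted a) \<Longrightarrow>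
      \<epsilon> * R \<le> norm (of_real R - shifted a) \<Longrightarrow> \<epsilon> * R \<le> norm (of_real R + shifted a) \<Longrightarrow>
      \<bar>kernel_error R a\<bar> \<le> 10 / \<epsilon> * bweight a"
    and kernel_error_near: "R \<le> 2 * norm (shifted a) \<Longrightarrow> \<bar>kernel_error R a\<bar> \<le> 8 / R"
proof -
  obtain \<delta> L where ke: "kernel_error R a = (L * bweight a - \<delta> * Re a / (norm (shifted a))\<^sup>2) / pi"
    and \<delta>: "\<bar>\<delta>\<bar> \<le> 2 * pi"
      "norm a < R \<Longrightarrow> \<bar>Re a\<bar> < R \<Longrightarrow> \<bar>\<delta>\<bar> \<le> 2 * (\<bar>Im a\<bar> + 2) / (R - \<bar>Re a\<bar>)"
      "R < \<bar>Re a\<bar> \<Longrightarrow> \<bar>\<delta>\<bar> \<le> (\<bar>Im a\<bar> + 2) / (\<bar>Re a\<bar> - R)"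
    and L: "\<And>d p. 0 < d \<Longrightarrow> d \<le> norm (of_real R - shifted a) \<Longrightarrow> d \<le> norm (of_real R + shifted a)
      \<Longrightarrow> \<bar>norm (of_real R + shifted a) - norm (of_real R - shifted a)\<bar> \<le> p \<Longrightarrow> \<bar>L\<bar> \<le> p / d"
    by (rule kernel_error_cases[OF R]) blast
  define s where "s = shifted a"
  define h where "h = \<bar>Im a\<bar> + 2"
  define x where "x = \<bar>Re a\<bar>"
  define N where "N = norm s"
  have N: "2 \<le> N" "norm a \<le> N" using norm_shifted_ge[of a] by (simp_all add: N_def s_def)
  have h: "2 \<le> h" by (simp add: h_def)
  have x: "0 \<le> x" "x \<le> N" using abs_Re_le_cmod[of s] by (auto simp: x_def N_def s_def shifted_def)
  have bw: "bweight a = h / N\<^sup>2" by (simp add: bweight_def h_def N_def s_def)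
  have diffs: "\<bar>norm (of_real R + s) - norm (of_real R - s)\<bar> \<le> 2 * N"
    "\<bar>norm (of_real R + s) - norm (of_real R - s)\<bar> \<le> 2 * R"
  proof -
    have "\<bar>norm (of_real R + s) - norm (of_real R - s)\<bar> \<le> norm ((of_real R + s) - (of_real R - s))" by (rule norm_triangle_ineq3)
    also have "(of_real R + s) - (of_real R - s) = 2 * s" by simp
    finally show "\<bar>norm (of_real R + s) - norm (of_real R - s)\<bar> \<le> 2 * N" by (simp add: norm_mult N_def)
    have "\<bar>norm (of_real R + s) - norm (- (of_real R - s))\<bar> \<le> norm ((of_real R + s) - (- (of_real R - s)))" by (rule norm_triangle_ineq3)
    also have "(of_real R + s) - (- (of_real R - s)) = of_real (2 * R)" by simp
    finally show "\<bar>norm (of_real R + s) - norm (of_real R - s)\<bar> \<le> 2 * R" using R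
      unfolding norm_minus_cancel norm_of_real by simp
  qed
  have main: "\<bar>kernel_error R a\<bar> \<le> (l + d) / pi * (1 / N\<^sup>2)" if "\<bar>L\<bar> * h \<le> l" "\<bar>\<delta>\<bar> * x \<le> d" for l d
  proof -
    have "\<bar>kernel_error R a\<bar> = \<bar>L * h - \<delta> * Re a\<bar> / N\<^sup>2 / pi"
      unfolding ke bw s_def[symmetric] N_def[symmetric] by (simp add: diff_divide_distrib[symmetric] abs_mult)
    also have "\<bar>L * h - \<delta> * Re a\<bar> \<le> \<bar>L\<bar> * h + \<bar>\<delta>\<bar> * x"
      using abs_triangle_ineq4[of "L * h" "\<delta> * Re a"] h by (simp add: abs_mult x_def)
    also have "\<dots> \<le> l + d" using that by linarith
    finally show ?thesis by (simp add: divide_right_mono mult.commute)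
  qed
  have pi3: "3 \<le> pi" using pi_gt3 by simp
  show "\<bar>kernel_error R a\<bar> \<le> 4 * (norm (shifted a) / R) * bweight a" if "2 * norm (shifted a) \<le> R"
  proof -
    have NR: "2 * N \<le> R" using that by (simp add: N_def s_def)
    have "R / 2 \<le> norm (of_real R - s)" "R / 2 \<le> norm (of_real R + s)"
      using norm_triangle_ineq2[of "of_real R" s] norm_diff_ineq[of "of_real R" s] NR R by (auto simp: N_def)
    then have "\<bar>L\<bar> \<le> 2 * N / (R / 2)" using R diffs by (intro L) (auto simp: s_def)
    then have "\<bar>L\<bar> * h \<le> 2 * N / (R / 2) * h" using h by (intro mult_right_mono) auto
    moreover have "\<bar>\<delta>\<bar> * x \<le> 4 * h / R * N"
    proof (rule mult_mono)
      have "\<bar>\<delta>\<bar> \<le> 2 * h / (R - x)" unfolding h_def x_def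
        by (rule \<delta>(2)) (use N x NR in \<open>auto simp: x_def\<close>)
      also have "\<dots> \<le> 2 * h / (R / 2)" using x NR R N h by (intro divide_left_mono mult_pos_pos) auto
      finally show "\<bar>\<delta>\<bar> \<le> 4 * h / R" by simp
    qed (use x h R in auto)
    ultimately have "\<bar>kernel_error R a\<bar> \<le> (2 * N / (R / 2) * h + 4 * h / R * N) / pi * (1 / N\<^sup>2)" by (rule main)
    also have "\<dots> = 8 / pi * ((N / R) * bweight a)" by (simp add: bw field_simps)
    also have "\<dots> \<le> 4 * ((N / R) * bweight a)"
      using pi3 R N bweight_nonneg[of a] by (intro mult_right_mono mult_nonneg_nonneg) (auto simp: divide_le_eq)
    finally show ?thesis by (simp add: N_def s_def mult.assoc)
  qed
  show "\<bar>kernel_error R a\<bar> \<le> 8 / R" if "R \<le> 2 * norm (shifted a)"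
  proof -
    have NR: "R \<le> 2 * N" using that by (simp add: N_def s_def)
    \<comment> \<open>The imaginary parts alone keep s at distance h from both corners. As the
      distances differ by at most 2 R, this bounds |L| h by 2 R even next to a corner.\<close>
    have "h \<le> norm (of_real R - s)" "h \<le> norm (of_real R + s)"
      using abs_Im_le_cmod[of "of_real R - s"] abs_Im_le_cmod[of "of_real R + s"] by (auto simp: s_def shifted_def h_def)
    then have "\<bar>L\<bar> \<le> 2 * R / h" using h diffs by (intro L) (auto simp: s_def)
    then have "\<bar>L\<bar> * h \<le> 2 * R" using h by (simp add: pos_le_divide_eq)
    then have "\<bar>L\<bar> * h \<le> 4 * N" using NR by linarith
    moreover have "\<bar>\<delta>\<bar> * x \<le> 2 * pi * N" using \<delta>(1) x by (intro mult_mono) auto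
    ultimately have "\<bar>kernel_error R a\<bar> \<le> (4 * N + 2 * pi * N) / pi * (1 / N\<^sup>2)" by (rule main)
    also have "\<dots> = (4 / pi + 2) * (1 / N)" using N by (simp add: field_simps power2_eq_square)
    also have "\<dots> \<le> 4 * (1 / N)" using pi3 N by (intro mult_right_mono) (auto simp: divide_le_eq)
    also have "\<dots> \<le> 8 / R" using NR R N by (simp add: divide_simps)
    finally show ?thesis .
  qed
  show "\<bar>kernel_error R a\<bar> \<le> 10 / \<epsilon> * bweight a" if \<epsilon>: "0 < \<epsilon>" "\<epsilon> \<le> 1" and "R \<le> 2 * norm (shifted a)"
    and off: "\<epsilon> * R \<le> norm (of_real R - shifted a)" "\<epsilon> * R \<le> norm (of_real R + shifted a)" for \<epsilon>
  proof -
    have \<epsilon>R: "0 < \<epsilon> * R" "\<epsilon> * R \<le> R" using \<epsilon> R by auto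
    have "\<bar>L\<bar> \<le> 2 * R / (\<epsilon> * R)" using \<epsilon>R off diffs by (intro L) (auto simp: s_def)
    then have "\<bar>L\<bar> \<le> 2 / \<epsilon>" using R by simp
    then have 1: "\<bar>L\<bar> * h \<le> 2 / \<epsilon> * h" using h by (intro mult_right_mono) auto
    have 2: "\<bar>\<delta>\<bar> * x \<le> 8 * pi / \<epsilon> * h"
    proof -
      have near: "norm (of_real R - s) \<le> \<bar>R - Re a\<bar> + h" "norm (of_real R + s) \<le> \<bar>R + Re a\<bar> + h"
        using cmod_le[of "of_real R - s"] cmod_le[of "of_real R + s"] by (auto simp: s_def shifted_def h_def)
      \<comment> \<open>When \<open>h\<close> is small, being far from both corners means being far
        horizontally, where the angle bounds apply. When \<open>h\<close> is large the trivial bound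
        for \<delta> is enough. The case distinction below follows this split.\<close>
      have offx: "\<epsilon> * R / 2 \<le> \<bar>x - R\<bar>" if "h < \<epsilon> * R / 2"
      proof (cases "0 \<le> Re a")
        case True
        then have "\<bar>x - R\<bar> = \<bar>R - Re a\<bar>" by (simp add: x_def)
        then show ?thesis using near(1) off(1) that by (simp add: s_def)
      next
        case False
        then have "\<bar>x - R\<bar> = \<bar>R + Re a\<bar>" by (simp add: x_def)
        then show ?thesis using near(2) off(2) that by (simp add: s_def)
      qed
      consider "R + \<epsilon> * R / 2 \<le> x" | "x < R + \<epsilon> * R / 2" "\<epsilon> * R / 2 \<le> h" | "x \<le> R - \<epsilon> * R / 2" "h < \<epsilon> * R / 2"
        using offx by linarith
      then show ?thesis
      proof cases
        case 1
        have xR: "0 < x - R" "R < \<bar>Re a\<bar>" using 1 \<epsilon>R by (auto simp: x_def)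
        have "\<bar>\<delta>\<bar> \<le> h / (x - R)" using \<delta>(3)[OF xR(2)] by (simp add: h_def x_def)
        then have "\<bar>\<delta>\<bar> * x \<le> h / (x - R) * x" using x by (intro mult_right_mono) auto
        also have "\<dots> = h * (1 + R / (x - R))" using xR by (simp add: field_simps)
        also have "R / (x - R) \<le> R / (\<epsilon> * R / 2)" using 1 xR R \<epsilon>R by (intro divide_left_mono mult_pos_pos) auto
        also have "\<dots> = 2 / \<epsilon>" using R by simp
        also have "h * (1 + 2 / \<epsilon>) \<le> h * (3 / \<epsilon>)" using \<epsilon> h by (intro mult_left_mono) (auto simp: field_simps)
        also have "\<dots> \<le> h * (8 * pi / \<epsilon>)" using \<epsilon> h pi3 by (intro mult_left_mono divide_right_mono) auto
        finally show ?thesis using h by (simp add: mult.commute)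
      next
        case 2
        have "\<bar>\<delta>\<bar> * x \<le> 2 * pi * (2 * R)" using \<delta>(1) x 2 \<epsilon>R by (intro mult_mono) auto
        also have "\<dots> = 8 * pi / \<epsilon> * (\<epsilon> * R / 2)" using \<epsilon> by simp
        also have "\<dots> \<le> 8 * pi / \<epsilon> * h" using 2 \<epsilon> by (intro mult_left_mono) auto
        finally show ?thesis .
      next
        case 3
        have na: "norm a < R" using cmod_le[of a] 3 by (simp add: x_def h_def)
        have "\<bar>\<delta>\<bar> \<le> 2 * h / (R - x)" using \<delta>(2)[OF na] 3 \<epsilon>R by (auto simp: h_def x_def)
        also have "\<dots> \<le> 2 * h / (\<epsilon> * R / 2)" using 3 h \<epsilon>R by (intro divide_left_mono mult_pos_pos) auto
        finally have "\<bar>\<delta>\<bar> * x \<le> 2 * h / (\<epsilon> * R / 2) * R" using x 3 \<epsilon>R h by (intro mult_mono) auto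
        also have "\<dots> = 4 / \<epsilon> * h" using R by simp
        also have "\<dots> \<le> 8 * pi / \<epsilon> * h" using \<epsilon> h pi3 by (intro mult_right_mono divide_right_mono) auto
        finally show ?thesis .
      qed
    qed
    have "\<bar>kernel_error R a\<bar> \<le> (2 / \<epsilon> * h + 8 * pi / \<epsilon> * h) / pi * (1 / N\<^sup>2)" by (rule main[OF 1 2])
    also have "\<dots> = (2 / pi + 8) * (1 / \<epsilon> * bweight a)" using \<epsilon> by (simp add: bw field_simps)
    also have "\<dots> \<le> 10 * (1 / \<epsilon> * bweight a)"
      using pi3 \<epsilon> bweight_nonneg[of a] by (intro mult_right_mono mult_nonneg_nonneg) (auto simp: divide_le_eq)
    finally show ?thesis by simp
  qed
qed

section \<open>Summing the kernel error over the zeros; logarithms of the cofactors\<close>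

context class_D_zeros
begin

text \<open>Five groups of zeros contribute at most e / 6 each: bounded ones by the factor |s| / R,
  the others with |s| <= R / 2 and those off the corners by a tail of the Blaschke sum, and one
  group at each corner by \<open>count_real_centre\<close>.\<close>

lemma sum_kernel_error_small:
  assumes e: "0 < e"
  obtains R0 where "\<And>R D. R0 \<le> R \<Longrightarrow> finite D \<Longrightarrow> (\<Sum>a\<in>D. real (m a) * \<bar>kernel_error R a\<bar>) \<le> e"
proof -
  \<comment> \<open>A corner group costs at most 16 * \<open>count_const\<close> * \<epsilon>, and
    96 = 6 * 16. In the same way 60 = 6 * 10 and 12 = 6 * 2 below come from the constants of the
    other regimes.\<close>
  define \<epsilon> where "\<epsilon> = min 1 (e / (96 * (count_const + 1)))"
  have \<epsilon>: "0 < \<epsilon>" "\<epsilon> \<le> 1" "96 * (count_const * \<epsilon>) \<le> e"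
  proof -
    show "0 < \<epsilon>" "\<epsilon> \<le> 1" using e C_nonneg by (auto simp: \<epsilon>_def)
    have "\<epsilon> \<le> e / (96 * (count_const + 1))" by (simp add: \<epsilon>_def)
    then have "\<epsilon> * (96 * (count_const + 1)) \<le> e" using C_nonneg by (simp add: pos_le_divide_eq)
    moreover have "\<epsilon> * (96 * (count_const + 1)) = 96 * (count_const * \<epsilon>) + 96 * \<epsilon>" by (simp add: algebra_simps)
    ultimately show "96 * (count_const * \<epsilon>) \<le> e" using \<open>0 < \<epsilon>\<close> by linarith
  qed
  define T where "T = (\<lambda>D. \<Sum>a\<in>D. real (m a) * bweight a)"
  obtain W where W: "\<And>D. finite D \<Longrightarrow> T D \<le> W" using sum_bweight_bounded unfolding T_def by blast
  have W0: "0 \<le> W" using W[of "{}"] by (simp add: T_def)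
  have "0 < e * \<epsilon> / 60" using e \<epsilon> by simp
  then obtain R1 where R1: "\<And>D. finite D \<Longrightarrow> (\<And>a. a \<in> D \<Longrightarrow> R1 \<le> norm a) \<Longrightarrow> T D \<le> e * \<epsilon> / 60"
    unfolding T_def by (rule bweight_tail) blast
  have "0 < e / 12" using e by simp
  then obtain R2 where R2: "\<And>D. finite D \<Longrightarrow> (\<And>a. a \<in> D \<Longrightarrow> R2 \<le> norm a) \<Longrightarrow> T D \<le> e / 12"
    unfolding T_def by (rule bweight_tail) blast
  define P where "P = max R2 0 + 2"
  have P: "2 \<le> P" "R2 + 2 \<le> P" by (auto simp: P_def)
  \<comment> \<open>8 and 4 R1 turn R < 2 |shifted a| into R1 <= |a|; 24 P W / e makes 4 P W / R at
    most e / 6; 1 / \<epsilon> makes the corner discs large enough for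
    \<open>count_real_centre\<close>.\<close>
  define R0 where "R0 = max (max 8 (4 * R1)) (max (24 * P * W / e) (1 / \<epsilon>))"
  have "(\<Sum>a\<in>D. real (m a) * \<bar>kernel_error R a\<bar>) \<le> e" if R: "R0 \<le> R" and D: "finite D" for R D
  proof -
    have R8: "8 \<le> R" "4 * R1 \<le> R" "24 * P * W / e \<le> R" "1 / \<epsilon> \<le> R" using R by (auto simp: R0_def)
    have R_pos: "0 < R" using R8 by linarith
    have \<epsilon>R: "1 \<le> \<epsilon> * R" using R8(4) \<epsilon> by (simp add: divide_le_eq mult.commute)
    define v where "v = (\<lambda>a. real (m a) * \<bar>kernel_error R a\<bar>)"
    have v0: "0 \<le> v a" for a by (simp add: v_def)
    define D1 where "D1 = {a\<in>D. 2 * norm (shifted a) \<le> R \<and> norm (shifted a) \<le> P}"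
    define D2 where "D2 = {a\<in>D. 2 * norm (shifted a) \<le> R \<and> P < norm (shifted a)}"
    define D3 where "D3 = {a\<in>D. R < 2 * norm (shifted a) \<and> \<epsilon> * R \<le> norm (of_real R - shifted a) \<and> \<epsilon> * R \<le> norm (of_real R + shifted a)}"
    define D4 where "D4 = {a\<in>D. R < 2 * norm (shifted a) \<and> norm (of_real R - shifted a) < \<epsilon> * R}"
    define D5 where "D5 = {a\<in>D. R < 2 * norm (shifted a) \<and> norm (of_real R + shifted a) < \<epsilon> * R}"
    note Ddefs = D1_def D2_def D3_def D4_def D5_def
    have fin: "finite D1" "finite D2" "finite D3" "finite D4" "finite D5" using D by (auto simp: Ddefs)
    have un: "sum v (A \<union> B) \<le> sum v A + sum v B" if "finite A" "finite B" for A B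
      using sum_Un[OF that, of v] sum_nonneg[of "A \<inter> B" v] v0 by simp
    have near: "sum v D' \<le> e / 6" if D': "D' \<subseteq> cball (of_real x) (2 * (\<epsilon> * R))" "finite D'" "\<And>a. a \<in> D' \<Longrightarrow> R \<le> 2 * norm (shifted a)" for D' x
    proof -
      have "sum v D' \<le> (\<Sum>a\<in>D'. real (m a) * (8 / R))" unfolding v_def
        by (intro sum_mono mult_left_mono kernel_error_near R_pos D') auto
      also have "\<dots> = (\<Sum>a\<in>D'. real (m a)) * (8 / R)" by (rule sum_distrib_right[symmetric])
      also have "\<dots> \<le> (count_const * (2 * (\<epsilon> * R))) * (8 / R)"
      proof (rule mult_right_mono)
        have "(\<Sum>a\<in>D'. real (m a)) \<le> real (count_fn m (of_real x) (2 * (\<epsilon> * R)))"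
          by (rule sum_mult_le_count_fn[OF lf D'(1)])
        also have "\<dots> \<le> count_const * (2 * (\<epsilon> * R))" using \<epsilon>R by (intro count_real_centre) auto
        finally show "(\<Sum>a\<in>D'. real (m a)) \<le> count_const * (2 * (\<epsilon> * R))" .
      qed (use R_pos in simp)
      also have "\<dots> = 16 * (count_const * \<epsilon>)" using R_pos by simp
      also have "\<dots> \<le> e / 6" using \<epsilon>(3) by simp
      finally show ?thesis .
    qed
    \<comment> \<open>The distance from x to \<open>shifted a\<close> dominates both |x - Re a| and
      |Im a|, so in terms of \<open>a\<close> itself the radius at most doubles.\<close>
    have nn: "norm (a - of_real x) \<le> 2 * (\<epsilon> * R)" if "norm (of_real x - shifted a) < \<epsilon> * R" for a x
    proof -
      have "\<bar>x - Re a\<bar> \<le> norm (of_real x - shifted a)" "\<bar>Im a\<bar> + 2 \<le> norm (of_real x - shifted a)"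
        using abs_Re_le_cmod[of "of_real x - shifted a"] abs_Im_le_cmod[of "of_real x - shifted a"] by (auto simp: shifted_def)
      then show ?thesis using cmod_le[of "a - of_real x"] that by simp
    qed
    have n4: "sum v D4 \<le> e / 6"
      by (rule near[of D4 R]) (use nn[of R] fin in \<open>auto simp: D4_def dist_norm norm_minus_commute\<close>)
    have n5: "sum v D5 \<le> e / 6"
    proof (rule near[of D5 "- R"])
      show "D5 \<subseteq> cball (of_real (- R)) (2 * (\<epsilon> * R))"
      proof
        fix a assume "a \<in> D5"
        then have "norm (of_real R + shifted a) < \<epsilon> * R" by (simp add: D5_def)
        moreover have "norm (of_real R + shifted a) = norm (of_real (- R) - shifted a)"
          using norm_minus_cancel[of "of_real R + shifted a"] by simp
        ultimately show "a \<in> cball (of_real (- R)) (2 * (\<epsilon> * R))"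
          using nn[of "- R" a] unfolding mem_cball dist_norm by (metis norm_minus_commute)
      qed
    qed (use fin in \<open>auto simp: D5_def\<close>)
    have "D \<subseteq> (((D1 \<union> D2) \<union> D3) \<union> D4) \<union> D5" unfolding Ddefs by auto
    then have "sum v D \<le> sum v ((((D1 \<union> D2) \<union> D3) \<union> D4) \<union> D5)" using fin v0 by (intro sum_mono2) auto
    also have "\<dots> \<le> sum v D1 + sum v D2 + sum v D3 + sum v D4 + sum v D5"
      using un[OF fin(1,2)] un[of "D1 \<union> D2" D3] un[of "D1 \<union> D2 \<union> D3" D4] un[of "D1 \<union> D2 \<union> D3 \<union> D4" D5] fin by simp
    also have "sum v D1 \<le> e / 6"
    proof -
      have "sum v D1 \<le> (\<Sum>a\<in>D1. 4 * (P / R) * (real (m a) * bweight a))"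
      proof (rule sum_mono)
        fix a assume a: "a \<in> D1"
        have "\<bar>kernel_error R a\<bar> \<le> 4 * (norm (shifted a) / R) * bweight a"
          using a by (intro kernel_error_small R_pos) (simp add: D1_def)
        also have "\<dots> \<le> 4 * (P / R) * bweight a"
          using a R_pos bweight_nonneg[of a] by (intro mult_right_mono mult_left_mono divide_right_mono) (auto simp: D1_def)
        finally have "real (m a) * \<bar>kernel_error R a\<bar> \<le> real (m a) * (4 * (P / R) * bweight a)" by (rule mult_left_mono) simp
        then show "v a \<le> 4 * (P / R) * (real (m a) * bweight a)" by (simp add: v_def mult_ac)
      qed
      also have "\<dots> = 4 * (P / R) * T D1" by (simp add: T_def sum_distrib_left)
      also have "\<dots> \<le> 4 * (P / R) * W" using P R_pos W[OF fin(1)] by (intro mult_left_mono) auto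
      also have "\<dots> \<le> e / 6"
      proof -
        have "24 * P * W \<le> e * R" using R8(3) e by (simp add: divide_le_eq mult.commute)
        then show ?thesis using R_pos by (simp add: divide_le_eq mult_ac)
      qed
      finally show ?thesis .
    qed
    also have "sum v D2 \<le> e / 6"
    proof -
      have "sum v D2 \<le> (\<Sum>a\<in>D2. 2 * (real (m a) * bweight a))"
      proof (rule sum_mono)
        fix a assume a: "a \<in> D2"
        have "\<bar>kernel_error R a\<bar> \<le> 4 * (norm (shifted a) / R) * bweight a"
          using a by (intro kernel_error_small R_pos) (simp add: D2_def)
        also have "\<dots> \<le> 2 * bweight a"
          using a R_pos bweight_nonneg[of a] by (intro mult_right_mono) (auto simp: D2_def divide_le_eq)
        finally have "real (m a) * \<bar>kernel_error R a\<bar> \<le> real (m a) * (2 * bweight a)" by (rule mult_left_mono) simp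
        then show "v a \<le> 2 * (real (m a) * bweight a)" by (simp add: v_def mult_ac)
      qed
      also have "\<dots> = 2 * T D2" by (simp add: T_def sum_distrib_left)
      also have "T D2 \<le> e / 12"
      proof (rule R2[OF fin(2)])
        fix a assume "a \<in> D2"
        then have "P < norm (shifted a)" by (simp add: D2_def)
        moreover have "norm (shifted a) \<le> norm a + 2" by (rule norm_shifted_le)
        ultimately show "R2 \<le> norm a" using P by linarith
      qed
      finally show ?thesis by simp
    qed
    also have "sum v D3 \<le> e / 6"
    proof -
      have "sum v D3 \<le> (\<Sum>a\<in>D3. 10 / \<epsilon> * (real (m a) * bweight a))"
      proof (rule sum_mono)
        fix a assume a: "a \<in> D3"
        have "\<bar>kernel_error R a\<bar> \<le> 10 / \<epsilon> * bweight a"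
          using a by (intro kernel_error_off R_pos \<epsilon>) (auto simp: D3_def)
        then have "real (m a) * \<bar>kernel_error R a\<bar> \<le> real (m a) * (10 / \<epsilon> * bweight a)" by (rule mult_left_mono) simp
        then show "v a \<le> 10 / \<epsilon> * (real (m a) * bweight a)" by (simp add: v_def mult_ac)
      qed
      also have "\<dots> = 10 / \<epsilon> * T D3" by (simp add: T_def sum_distrib_left)
      also have "\<dots> \<le> 10 / \<epsilon> * (e * \<epsilon> / 60)"
      proof (rule mult_left_mono)
        show "T D3 \<le> e * \<epsilon> / 60"
        proof (rule R1[OF fin(3)])
          fix a assume "a \<in> D3"
          then have "R < 2 * norm (shifted a)" by (simp add: D3_def)
          moreover have "norm (shifted a) \<le> norm a + 2" by (rule norm_shifted_le)
          ultimately show "R1 \<le> norm a" using R8 by linarith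
        qed
      qed (use \<epsilon> in simp)
      also have "\<dots> = e / 6" using \<epsilon> by simp
      finally show ?thesis .
    qed
    finally have "sum v D \<le> e" using n4 n5 e by linarith
    then show ?thesis by (simp add: v_def)
  qed
  then show thesis using that by blast
qed

text \<open>On |w| = 2 N every divided factor has modulus at least N, and at 0 at most N. The powers
  of N cancel, so the cofactor is at most exp (k N) times its value at 0, with k independent of N,
  and \<open>zero_free_log_bounds\<close> applies.\<close>

lemma cofactor_log:
  obtains C1 where "0 < C1" "\<And>N g. 1 \<le> N \<Longrightarrow> cofactor f m (disc_zeros m N) g \<Longrightarrow>
    \<exists>l. l holomorphic_on ball 0 N \<and> (\<forall>z. norm z < N \<longrightarrow> g z = g 0 * exp (l z)) \<and>
      (\<forall>z. norm z \<le> N / 4 \<longrightarrow> norm (deriv l z - deriv l 0) \<le> C1 * norm z / N) \<and>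
      (\<forall>z. norm z \<le> N / 4 \<longrightarrow> norm (l z - deriv l 0 * z) \<le> C1 * (norm z)\<^sup>2 / N)"
proof -
  \<comment> \<open>A possible zero at the origin is divided out first, so that \<open>h 0\<close>
    supplies a lower bound at 0 that is the same for all N.\<close>
  define A0 where "A0 = {a. a = 0 \<and> 0 < m a}"
  have finA0: "finite A0" by (simp add: A0_def)
  obtain h where h: "cofactor f m A0 h" using ex_cofactor[OF finA0] by blast
  have h0: "h 0 \<noteq> 0" by (rule cofactor_nonzero[OF mult h finA0]) (auto simp: A0_def)
  define K' where "K' = max 1 K"
  define k where "k = \<bar>ln (K' / norm (h 0))\<bar> + 1 + 2 * B"
  have k: "0 < k" using B by (simp add: k_def)
  have main: "\<exists>l. l holomorphic_on ball 0 N \<and> (\<forall>z. norm z < N \<longrightarrow> g z = g 0 * exp (l z)) \<and>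
      (\<forall>z. norm z \<le> N / 4 \<longrightarrow> norm (deriv l z - deriv l 0) \<le> 128 * k * norm z / N) \<and>
      (\<forall>z. norm z \<le> N / 4 \<longrightarrow> norm (l z - deriv l 0 * z) \<le> 128 * k * (norm z)\<^sup>2 / N)"
    if N: "1 \<le> N" and g: "cofactor f m (disc_zeros m N) g" for N g
  proof -
    define Z where "Z = disc_zeros m N"
    define n where "n = (\<Sum>a\<in>Z. m a)"
    have finZ: "finite Z" unfolding Z_def by (rule finite_dz)
    have holg: "g holomorphic_on UNIV" and fg: "\<And>z. f z = zprod m Z z * g z"
      using g by (auto simp: cofactor_def Z_def)
    have gnz: "g z \<noteq> 0" if "norm z < N" for z
      by (rule cofactor_nonzero[OF mult g finite_dz]) (use that in \<open>auto simp: disc_zeros_def\<close>)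
    have up: "norm (g z) \<le> K' * exp (2 * B * N) / N ^ n" if z: "norm z \<le> 2 * N" for z
    proof (rule maximum_modulus_cball[of g UNIV 0 "2 * N"])
      fix w assume "dist w (0::complex) = 2 * N"
      then have w: "norm w = 2 * N" by simp
      have "N ^ n = (\<Prod>a\<in>Z. N ^ m a)" by (simp add: n_def power_sum)
      also have "\<dots> \<le> (\<Prod>a\<in>Z. norm (w - a) ^ m a)"
      proof (intro prod_mono conjI power_mono)
        fix a assume "a \<in> Z"
        then show "N \<le> norm (w - a)" using norm_triangle_ineq2[of w a] w by (simp add: Z_def disc_zeros_def)
      qed (use N in auto)
      also have "\<dots> = norm (zprod m Z w)" by (simp add: zprod_def prod_norm[symmetric] norm_power)
      finally have "N ^ n * norm (g w) \<le> norm (zprod m Z w) * norm (g w)" by (rule mult_right_mono) simp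
      also have "\<dots> = norm (f w)" by (simp add: fg norm_mult)
      also have "\<dots> \<le> K * exp (B * norm w)" by (rule et)
      also have "\<dots> \<le> K' * exp (2 * B * N)" unfolding w by (simp add: K'_def mult_ac)
      finally show "norm (g w) \<le> K' * exp (2 * B * N) / N ^ n" using N by (simp add: pos_le_divide_eq mult.commute)
    qed (use holg N z in auto)
    have low: "norm (h 0) / N ^ n \<le> norm (g 0)"
    proof -
      have sub: "A0 \<subseteq> Z" using N by (auto simp: A0_def Z_def disc_zeros_def)
      have "h 0 = zprod m (Z - A0) 0 * g 0" using cofactor_subset[OF sub finZ h] g by (simp add: Z_def)
      then have "norm (h 0) = (\<Prod>a\<in>Z - A0. norm a ^ m a) * norm (g 0)"
        by (simp add: norm_mult zprod_def prod_norm[symmetric] norm_power)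
      also have "(\<Prod>a\<in>Z - A0. norm a ^ m a) \<le> (\<Prod>a\<in>Z - A0. N ^ m a)"
        by (intro prod_mono conjI power_mono) (auto simp: Z_def disc_zeros_def)
      also have "\<dots> = N ^ (\<Sum>a\<in>Z - A0. m a)" by (simp add: power_sum)
      also have "\<dots> \<le> N ^ n" unfolding n_def using N finZ by (intro power_increasing sum_mono2) auto
      finally have "norm (h 0) \<le> N ^ n * norm (g 0)" by (simp add: mult_right_mono)
      then show ?thesis using N by (simp add: divide_le_eq mult.commute)
    qed
    have bdd: "norm (g z) \<le> exp (k * N) * norm (g 0)" if "norm z < N" for z
    proof -
      define q where "q = K' / norm (h 0)"
      have q: "0 < q" using h0 by (simp add: q_def K'_def)
      have "norm (g z) \<le> K' * exp (2 * B * N) / N ^ n" using up that N by simp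
      also have "\<dots> = q * exp (2 * B * N) * (norm (h 0) / N ^ n)" using h0 by (simp add: q_def)
      also have "\<dots> \<le> q * exp (2 * B * N) * norm (g 0)" using q low by (intro mult_left_mono) auto
      also have "q * exp (2 * B * N) \<le> exp (k * N)"
      proof -
        have "q = exp (ln q)" using q by simp
        then have "q * exp (2 * B * N) = exp (ln q + 2 * B * N)" by (simp add: exp_add)
        moreover have "ln q \<le> \<bar>ln q\<bar> * N" using N mult_left_mono[of 1 N "\<bar>ln q\<bar>"] by simp
        then have "ln q + 2 * B * N \<le> k * N" using N by (simp add: k_def q_def algebra_simps)
        ultimately show ?thesis by simp
      qed
      finally show ?thesis by (simp add: mult_right_mono)
    qed
    have kN: "0 < k * N" "0 < N" using k N by auto
    have eq: "128 * (k * N) * y / N\<^sup>2 = 128 * k * y / N" for y using N by (simp add: power2_eq_square)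
    show ?thesis
    proof (rule zero_free_log_bounds[OF holg kN(2) gnz bdd kN(1)])
      fix l assume l: "l holomorphic_on ball 0 N" "\<And>z. norm z < N \<Longrightarrow> g z = g 0 * exp (l z)"
        "\<And>z. norm z \<le> N / 4 \<Longrightarrow> norm (deriv l z - deriv l 0) \<le> 128 * (k * N) * norm z / N\<^sup>2"
        "\<And>z. norm z \<le> N / 4 \<Longrightarrow> norm (l z - deriv l 0 * z) \<le> 128 * (k * N) * (norm z)\<^sup>2 / N\<^sup>2"
      show ?thesis using l unfolding eq by (intro exI[of _ l] conjI allI impI)
    qed
  qed
  show thesis by (rule that[of "128 * k"]) (use k main in auto)
qed

end

subsection \<open>The exponent of the partial products\<close>

lemma prod_roots_derivative:
  fixes p :: "complex \<Rightarrow> complex"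
  assumes "finite A" "\<And>a. a \<in> A \<Longrightarrow> z \<noteq> p a"
  shows "((\<lambda>z. \<Prod>a\<in>A. (z - p a) ^ m a) has_field_derivative
    (\<Prod>a\<in>A. (z - p a) ^ m a) * (\<Sum>a\<in>A. of_nat (m a) / (z - p a))) (at z)"
  using assms
proof (induction A)
  case empty
  then show ?case by simp
next
  case (insert b A)
  define P where "P = (\<lambda>z. \<Prod>a\<in>A. (z - p a) ^ m a)"
  define S where "S = (\<Sum>a\<in>A. of_nat (m a) / (z - p a))"
  have nz: "z - p b \<noteq> 0" using insert.prems by simp
  have IH: "(P has_field_derivative P z * S) (at z)" using insert unfolding P_def S_def by simp
  have pw: "((\<lambda>z. (z - p b) ^ m b) has_field_derivative (z - p b) ^ m b * (of_nat (m b) / (z - p b))) (at z)"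
  proof -
    have "((\<lambda>z. (z - p b) ^ m b) has_field_derivative of_nat (m b) * (z - p b) ^ (m b - 1)) (at z)"
      by (auto intro!: derivative_eq_intros)
    moreover have "of_nat (m b) * (z - p b) ^ (m b - 1) = (z - p b) ^ m b * (of_nat (m b) / (z - p b))"
      using nz by (cases "m b") (auto simp: field_simps)
    ultimately show ?thesis by simp
  qed
  have "((\<lambda>z. (z - p b) ^ m b * P z) has_field_derivative
     (z - p b) ^ m b * (of_nat (m b) / (z - p b)) * P z + P z * S * (z - p b) ^ m b) (at z)"
    by (rule DERIV_mult[OF pw IH])
  moreover have "(z - p b) ^ m b * (of_nat (m b) / (z - p b)) * P z + P z * S * (z - p b) ^ m b
     = ((z - p b) ^ m b * P z) * (of_nat (m b) / (z - p b) + S)"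
    by (simp add: algebra_simps)
  ultimately show ?case using insert.hyps by (simp add: P_def S_def)
qed

lemma (in entire_zeros) ex_nonzero:
  assumes "open S" "S \<noteq> {}"
  obtains z where "z \<in> S" "f z \<noteq> 0"
proof -
  obtain z e where z: "0 < e" "ball z e \<subseteq> S" using assms open_contains_ball by blast
  define e' where "e' = min e 1"
  have e': "0 < e'" "ball z e' \<subseteq> S" "ball z e' \<subseteq> cball z 1" using z by (auto simp: e'_def)
  have "\<exists>w\<in>ball z e'. f w \<noteq> 0"
  proof (rule ccontr)
    assume "\<not> ?thesis"
    then have "ball z e' \<subseteq> {a. 0 < m a \<and> dist a z \<le> 1}" using zero_iff e'(3) by (auto simp: dist_commute subset_iff)
    then have "finite (ball z e')" using finite_count_set[OF lf] finite_subset by blast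
    then show False using uncountable_ball[OF e'(1)] countable_finite by blast
  qed
  then show thesis using e'(2) that by blast
qed

lemma Re_inverse_refl: "Re (1 / refl a) = Re (1 / a)"
  by (simp add: Re_divide refl_def)

locale class_D_cofactors = class_D_zeros +
  fixes G :: "real \<Rightarrow> complex \<Rightarrow> complex"
  assumes G: "\<And>R. cofactor f m (disc_zeros m R) (G R)"
begin

text \<open>\<open>\<beta> R - recip_sum m R\<close> does not depend on \<open>R\<close>, and on compact sets \<open>f\<close> is, up to constants, asymptotic to
  \<open>exp (\<beta> R * z)\<close> times the product over the zeros in the disc of radius \<open>R\<close>.\<close>

definition \<beta> :: "real \<Rightarrow> complex" where
  "\<beta> R = deriv (G R) 0 / G R 0"

lemma G_holomorphic: "G R holomorphic_on S"
  using G[of R] holomorphic_on_subset unfolding cofactor_def by blast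

lemma G_nonzero: "norm z < R \<Longrightarrow> G R z \<noteq> 0"
  by (rule cofactor_nonzero[OF mult G finite_dz]) (auto simp: disc_zeros_def)

lemma G_derivative: "(G R has_field_derivative deriv (G R) z) (at z)"
  using holomorphic_derivI[OF G_holomorphic[of R UNIV] open_UNIV UNIV_I] .

text \<open>The logarithmic derivative at 0 of \<open>G R\<close>, written as \<open>G R'\<close>
  times the factors of the zeros in between.\<close>

lemma \<beta>_diff:
  assumes R: "0 < R" "R \<le> R'"
  shows "\<beta> R' - \<beta> R = (\<Sum>a\<in>disc_zeros m R' - disc_zeros m R. of_nat (m a) / a)"
proof -
  define D where "D = disc_zeros m R' - disc_zeros m R"
  have finD: "finite D" unfolding D_def using finite_dz by auto
  have D0: "0 \<noteq> a" if "a \<in> D" for a using that R by (auto simp: D_def disc_zeros_def)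
  have eq: "G R z = zprod m D z * G R' z" for z
    unfolding D_def by (rule cofactor_subset[OF _ finite_dz G G]) (use R in \<open>auto simp: disc_zeros_def\<close>)
  define S where "S = (\<Sum>a\<in>D. of_nat (m a) / (0 - a))"
  have "(zprod m D has_field_derivative zprod m D 0 * S) (at 0)"
    unfolding zprod_def S_def by (rule prod_roots_derivative[OF finD]) (use D0 in auto)
  from DERIV_mult[OF this G_derivative[of R' 0]]
  have "(G R has_field_derivative zprod m D 0 * S * G R' 0 + deriv (G R') 0 * zprod m D 0) (at 0)"
    by (simp add: eq[abs_def])
  then have "deriv (G R) 0 = zprod m D 0 * S * G R' 0 + deriv (G R') 0 * zprod m D 0" by (rule DERIV_imp_deriv)
  moreover have "zprod m D 0 \<noteq> 0" using D0 by (intro zprod_nonzero finD) auto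
  moreover have "G R' 0 \<noteq> 0" using G_nonzero[of 0 R'] R by simp
  ultimately have "\<beta> R = S + \<beta> R'" unfolding \<beta>_def eq[of 0] by (simp add: field_simps)
  moreover have "S = - (\<Sum>a\<in>D. of_nat (m a) / a)" unfolding S_def sum_negf[symmetric] by (rule sum.cong) auto
  ultimately show ?thesis by (simp add: D_def)
qed

definition Fn :: "nat \<Rightarrow> complex \<Rightarrow> complex" where
  "Fn n = reflprod m (disc_zeros m (real n)) (G (real n))"

lemma Fn_holomorphic: "Fn n holomorphic_on S"
  unfolding Fn_def reflprod_def by (intro holomorphic_intros G_holomorphic)

lemma Fn_le: "0 \<le> Im z \<Longrightarrow> norm (Fn n z) \<le> M * exp (B * Im z)"
  unfolding Fn_def by (rule reflprod_half_plane_le[OF G finite_dz et B M bd])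

lemma Fn_ge: "0 \<le> Im z \<Longrightarrow> norm (f z) \<le> norm (Fn n z)"
  unfolding Fn_def by (rule norm_le_reflprod[OF G])

lemma Fn_nonzero:
  assumes "0 < Im z" "norm z < real n"
  shows "Fn n z \<noteq> 0"
proof -
  have "z - refl a \<noteq> 0" for a using assms by (auto simp: refl_def complex_eq_iff)
  then show ?thesis using G_nonzero[OF assms(2)] finite_dz by (simp add: Fn_def reflprod_def prod_zero_iff)
qed

text \<open>The bound \<open>Fn_le\<close> is independent of n, so Montel's theorem gives a limit.
  Its zeros are excluded by Hurwitz's theorem, because \<open>Fn n\<close> is zero free in the upper
  half of the disc of radius n; |F| >= |f| prevents F from vanishing identically.\<close>

lemma ex_limit_function:
  obtains F r where "strict_mono (r :: nat \<Rightarrow> nat)" "F holomorphic_on {z. 0 < Im z}"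
    "\<And>K. compact K \<Longrightarrow> K \<subseteq> {z. 0 < Im z} \<Longrightarrow> uniform_limit K (\<lambda>k. Fn (r k)) F sequentially"
    "\<And>z. 0 < Im z \<Longrightarrow> norm (F z) \<le> M * exp (B * Im z)"
    "\<And>z. 0 < Im z \<Longrightarrow> norm (f z) \<le> norm (F z)"
    "\<And>z. 0 < Im z \<Longrightarrow> F z \<noteq> 0"
proof -
  define U where "U = {z. 0 < Im z}"
  have opU: "open U" unfolding U_def by (rule open_halfspace_Im_gt)
  obtain F r where F: "F holomorphic_on U" "strict_mono (r :: nat \<Rightarrow> nat)"
    "\<And>z. z \<in> U \<Longrightarrow> (\<lambda>n. Fn (r n) z) \<longlonglongrightarrow> F z"
    "\<And>K. compact K \<Longrightarrow> K \<subseteq> U \<Longrightarrow> uniform_limit K (Fn \<circ> r) F sequentially"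
  proof (rule Montel[of U "range Fn" Fn])
    fix K assume K: "compact K" "K \<subseteq> U"
    then obtain b where b: "\<And>z. z \<in> K \<Longrightarrow> norm z \<le> b" using compact_imp_bounded bounded_iff by metis
    have "norm (Fn n z) \<le> M * exp (B * b)" if z: "z \<in> K" for n z
    proof -
      have "norm (Fn n z) \<le> M * exp (B * Im z)" using z K by (intro Fn_le) (auto simp: U_def subset_iff intro: less_imp_le)
      also have "\<dots> \<le> M * exp (B * b)"
        using M B b[OF z] abs_Im_le_cmod[of z] by (intro mult_left_mono) (auto intro!: mult_left_mono)
      finally show ?thesis .
    qed
    then show "\<exists>B. \<forall>h\<in>range Fn. \<forall>z\<in>K. norm (h z) \<le> B" by blast
  qed (use opU Fn_holomorphic in auto)
  have le: "norm (F z) \<le> M * exp (B * Im z)" if "0 < Im z" for z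
    by (rule tendsto_upperbound[OF tendsto_norm[OF F(3)]]) (use that Fn_le in \<open>auto simp: U_def\<close>)
  have ge: "norm (f z) \<le> norm (F z)" if "0 < Im z" for z
    by (rule tendsto_lowerbound[OF tendsto_norm[OF F(3)]]) (use that Fn_ge in \<open>auto simp: U_def\<close>)
  have nz: "F z0 \<noteq> 0" if z0: "0 < Im z0" for z0
  proof
    assume F0: "F z0 = 0"
    define S where "S = U \<inter> ball 0 (norm z0 + 1)"
    have S: "open S" "z0 \<in> S" "S \<subseteq> U" using opU z0 by (auto simp: S_def U_def)
    have "convex S" unfolding S_def U_def by (intro convex_Int convex_halfspace_Im_gt convex_ball)
    \<comment> \<open>Skipping \<open>n0\<close> indices puts \<open>S\<close> inside every disc in
      which the remaining functions are zero free.\<close>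
    define n0 where "n0 = nat \<lceil>norm z0 + 1\<rceil>"
    have "F z0 \<noteq> 0"
    proof (rule Hurwitz_no_zeros[of S "\<lambda>k. Fn (r (k + n0))" F z0])
      show "connected S" using \<open>convex S\<close> by (rule convex_connected)
      show "F holomorphic_on S" using F(1) S(3) by (rule holomorphic_on_subset)
      show "uniform_limit K (\<lambda>k. Fn (r (k + n0))) F sequentially" if "compact K" "K \<subseteq> S" for K
      proof -
        have "uniform_limit K (Fn \<circ> r) F sequentially" using that S(3) by (intro F(4)) auto
        then have ev: "eventually (\<lambda>n. \<forall>x\<in>K. dist (Fn (r n) x) (F x) < e) sequentially" if "0 < e" for e
          using that unfolding uniform_limit_iff o_def by blast
        have "eventually (\<lambda>n. \<forall>x\<in>K. dist (Fn (r (n + n0)) x) (F x) < e) sequentially" if "0 < e" for e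
          using iffD2[OF eventually_sequentially_seg[of "\<lambda>n. \<forall>x\<in>K. dist (Fn (r n) x) (F x) < e" n0] ev[OF that]] .
        then show ?thesis unfolding uniform_limit_iff by blast
      qed
      show "\<not> F constant_on S"
      proof
        assume "F constant_on S"
        then have "F w = 0" if "w \<in> S" for w using F0 S(2) that unfolding constant_on_def by metis
        moreover obtain w where "w \<in> S" "f w \<noteq> 0" using ex_nonzero[OF S(1)] S(2) by blast
        ultimately show False using ge[of w] S(3) by (auto simp: U_def)
      qed
      show "Fn (r (k + n0)) z \<noteq> 0" if z: "z \<in> S" for k z
      proof (rule Fn_nonzero)
        show "0 < Im z" using z S(3) by (auto simp: U_def)
        have "norm z < norm z0 + 1" using z by (simp add: S_def)
        also have "\<dots> \<le> real n0" unfolding n0_def by linarith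
        also have "\<dots> \<le> real (r (k + n0))" using seq_suble[OF F(2), of "k + n0"] by simp
        finally show "norm z < real (r (k + n0))" .
      qed
    qed (use S Fn_holomorphic in auto)
    then show False using F0 by simp
  qed
  show thesis
  proof (rule that[of r F])
    show "F holomorphic_on {z. 0 < Im z}" using F(1) by (simp add: U_def)
    show "uniform_limit K (\<lambda>k. Fn (r k)) F sequentially" if "compact K" "K \<subseteq> {z. 0 < Im z}" for K
      using F(4)[of K] that by (simp add: U_def o_def)
  qed (use F le ge nz in auto)
qed

text \<open>A logarithm Q of the inverse of the normalised F has nonnegative real part, and Re (F' /
  F) = - Re (Q'), which the Schwarz--Pick derivative estimate bounds by Re Q / Im z. The first bound
  transports a lower bound of |f| by Harnack; the second is obtained after subtracting from Re Q the
  largest multiple of Im z below it.\<close>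

lemma limit_log_derivative:
  assumes holF: "F holomorphic_on {z. 0 < Im z}"
    and le: "\<And>z. 0 < Im z \<Longrightarrow> norm (F z) \<le> M * exp (B * Im z)"
    and ge: "\<And>z. 0 < Im z \<Longrightarrow> norm (f z) \<le> norm (F z)"
    and nz: "\<And>z. 0 < Im z \<Longrightarrow> F z \<noteq> 0"
  obtains K1 where "0 \<le> K1" "\<And>z. 2 \<le> Im z \<Longrightarrow> \<bar>Re (deriv F z / F z)\<bar> \<le> K1"
    "\<And>\<epsilon>. 0 < \<epsilon> \<Longrightarrow> \<exists>\<rho>. \<forall>z. 0 < Im z \<and> \<rho> \<le> norm z \<longrightarrow> \<bar>Re (deriv F z / F z)\<bar> \<le> \<epsilon> * (norm z / Im z)\<^sup>2"
proof -
  define U where "U = {z. 0 < Im z}"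
  have opU: "open U" unfolding U_def by (rule open_halfspace_Im_gt)
  define Mc where "Mc = complex_of_real (M + 1)"
  have M1: "Mc \<noteq> 0" "norm Mc = M + 1" using M unfolding Mc_def of_real_eq_0_iff norm_of_real by auto
  \<comment> \<open>The exponential removes the type, so |E| <= 1 on the half plane; its logarithmic
    derivative i B has real part 0.\<close>
  define E where "E = (\<lambda>z. F z * exp (\<i> * of_real B * z) / Mc)"
  have holE: "E holomorphic_on U" unfolding E_def U_def using M1 by (intro holomorphic_intros holF) auto
  have "contractible U" unfolding U_def by (intro convex_imp_contractible convex_halfspace_Im_gt)
  moreover have "E z \<noteq> 0" if "z \<in> U" for z using nz[of z] that M1 by (simp add: E_def U_def)
  ultimately obtain q where q: "q holomorphic_on U" "\<And>z. z \<in> U \<Longrightarrow> E z = exp (q z)"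
    using contractible_imp_holomorphic_log[OF holE] by blast
  define Q where "Q = (\<lambda>z. - q z)"
  have holQ: "Q holomorphic_on {z. 0 < Im z}" unfolding Q_def using q(1) by (intro holomorphic_intros) (simp add: U_def)
  have ReQ: "Re (Q z) = - ln (norm (F z) * exp (- B * Im z) / (M + 1))" if "0 < Im z" for z
  proof -
    have "norm (E z) = exp (Re (q z))" using q(2)[of z] that by (simp add: U_def)
    moreover have "norm (E z) = norm (F z) * exp (- B * Im z) / (M + 1)"
      using M1 by (simp add: E_def norm_mult norm_divide)
    ultimately have "Re (q z) = ln (norm (F z) * exp (- B * Im z) / (M + 1))" by (metis ln_exp)
    then show ?thesis by (simp add: Q_def)
  qed
  have ReQ0: "0 \<le> Re (Q z)" if z: "0 < Im z" for z
  proof -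
    have "norm (F z) * exp (- B * Im z) \<le> M * exp (B * Im z) * exp (- B * Im z)" by (intro mult_right_mono le z) auto
    also have "\<dots> = M" by (simp add: mult.assoc flip: exp_add)
    finally have "norm (F z) * exp (- B * Im z) / (M + 1) \<le> 1" using M by (simp add: divide_le_eq)
    moreover have "0 < norm (F z) * exp (- B * Im z) / (M + 1)" using nz[OF z] M by simp
    ultimately show ?thesis unfolding ReQ[OF z] by (simp only: neg_0_le_iff_le ln_le_zero_iff)
  qed
  have dQ: "Re (deriv F z / F z) = - Re (deriv Q z)" if z: "0 < Im z" for z
  proof -
    have zU: "z \<in> U" using z by (simp add: U_def)
    have dq: "(q has_field_derivative deriv q z) (at z)" by (rule holomorphic_derivI[OF q(1) opU zU])
    have dF: "(F has_field_derivative deriv F z) (at z)" using holomorphic_derivI[OF holF] opU zU by (simp add: U_def)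
    have "(E has_field_derivative (deriv F z * exp (\<i> * of_real B * z) + F z * (exp (\<i> * of_real B * z) * (\<i> * of_real B))) / Mc) (at z)"
      unfolding E_def using M1 by (auto intro!: derivative_eq_intros dF simp: field_simps)
    moreover have "(E has_field_derivative exp (q z) * deriv q z) (at z)"
      by (rule has_field_derivative_transform_within_open[OF DERIV_fun_exp[OF dq] opU zU]) (simp add: q(2))
    ultimately have "(deriv F z * exp (\<i> * of_real B * z) + F z * (exp (\<i> * of_real B * z) * (\<i> * of_real B))) / Mc
      = E z * deriv q z" using DERIV_unique q(2)[OF zU] by metis
    then have "(deriv F z * X + F z * (X * (\<i> * of_real B))) / Mc = (F z * X * deriv q z) / Mc"
      if "X = exp (\<i> * of_real B * z)" for X unfolding E_def that by simp
    then have "deriv F z * X + F z * (X * (\<i> * of_real B)) = F z * X * deriv q z"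
      if "X = exp (\<i> * of_real B * z)" for X using M1 that by (simp only: divide_cancel_right) blast
    then obtain X where X: "X \<noteq> 0" "deriv F z * X + F z * (X * (\<i> * of_real B)) = F z * X * deriv q z"
      using exp_not_eq_zero by blast
    have "X * (deriv F z + F z * (\<i> * of_real B)) = X * (F z * deriv q z)" using X(2) by (simp add: algebra_simps)
    then have "deriv F z + F z * (\<i> * of_real B) = F z * deriv q z" using X(1) by (simp only: mult_cancel_left) blast
    then have "deriv F z / F z + \<i> * of_real B = deriv q z"
      using nz[OF z] by (simp add: field_simps)
    moreover have "deriv Q z = - deriv q z" unfolding Q_def using dq by (intro DERIV_imp_deriv DERIV_minus)
    ultimately have "deriv F z / F z = - deriv Q z - \<i> * of_real B" by (simp add: algebra_simps)
    then show ?thesis by simp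
  qed
  \<comment> \<open>An upper bound for Re Q at points of height at most 3 where |f| >=
    \<delta>.\<close>
  define K0 where "K0 = max 0 (- ln (\<delta> * exp (- B * 3) / (M + 1)))"
  \<comment> \<open>The point z1 below has height between 1 and 3 and |Re z1 - Re z| <= 1, so |z -
    cnj z1| <= 3 Im z; the 9 is the square of this 3 in Harnack's inequality.\<close>
  have A: "\<bar>Re (deriv F z / F z)\<bar> \<le> 9 * K0" if z: "2 \<le> Im z" for z
  proof -
    obtain z1 where z1: "dist z1 (Complex (Re z) 2) \<le> 1" "\<delta> \<le> norm (f z1)" using lower[of "Re z"] by blast
    have re1: "\<bar>Re z1 - Re z\<bar> \<le> 1" and im1: "\<bar>Im z1 - 2\<bar> \<le> 1"
      using abs_Re_le_cmod[of "z1 - Complex (Re z) 2"] abs_Im_le_cmod[of "z1 - Complex (Re z) 2"] z1(1) by (auto simp: dist_norm)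
    have y1: "1 \<le> Im z1" "Im z1 \<le> 3" "0 < Im z1" using im1 by linarith+
    have z0: "0 < Im z" using z by simp
    have "B * Im z1 \<le> B * 3" using B y1 by (intro mult_left_mono) auto
    then have "\<delta> * exp (- B * 3) \<le> norm (F z1) * exp (- B * Im z1)"
      using ge[OF y1(3)] z1(2) \<delta> by (intro mult_mono) auto
    then have "\<delta> * exp (- B * 3) / (M + 1) \<le> norm (F z1) * exp (- B * Im z1) / (M + 1)"
      using M by (intro divide_right_mono) auto
    moreover have "0 < \<delta> * exp (- B * 3) / (M + 1)" using \<delta> M by simp
    ultimately have "ln (\<delta> * exp (- B * 3) / (M + 1)) \<le> ln (norm (F z1) * exp (- B * Im z1) / (M + 1))"
      by (subst ln_le_cancel_iff) auto
    then have Q1: "Re (Q z1) \<le> K0" unfolding ReQ[OF y1(3)] by (simp add: K0_def)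
    have "norm (z - cnj z1) \<le> \<bar>Re z - Re z1\<bar> + \<bar>Im z + Im z1\<bar>" using cmod_le[of "z - cnj z1"] by simp
    also have "\<dots> \<le> 3 * Im z" using re1 y1 z by linarith
    finally have "(norm (z - cnj z1))\<^sup>2 \<le> (3 * Im z)\<^sup>2" by (intro power_mono) auto
    then have "Re (Q z1) * (norm (z - cnj z1))\<^sup>2 / (Im z * Im z1) \<le> K0 * (3 * Im z)\<^sup>2 / (Im z * 1)"
      using Q1 ReQ0[OF y1(3)] y1 z0 by (intro frac_le mult_mono) (auto simp: K0_def)
    also have "\<dots> = 9 * K0 * Im z" using z0 by (simp add: power2_eq_square)
    finally have "Re (Q z) \<le> 9 * K0 * Im z"
      using Harnack_half_plane[OF holQ ReQ0 z0 y1(3)] by linarith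
    then have "Re (Q z) / Im z \<le> 9 * K0" using z0 by (simp add: divide_le_eq)
    then have "norm (deriv Q z) \<le> 9 * K0" using deriv_le_Re_half_plane[OF holQ ReQ0 z0] by linarith
    then show ?thesis using dQ[OF z0] abs_Re_le_cmod[of "deriv Q z"] by simp
  qed
  have Bd: "\<exists>\<rho>. \<forall>z. 0 < Im z \<and> \<rho> \<le> norm z \<longrightarrow> \<bar>Re (deriv F z / F z)\<bar> \<le> \<epsilon> * (norm z / Im z)\<^sup>2" if \<epsilon>: "0 < \<epsilon>" for \<epsilon>
  proof -
    \<comment> \<open>Subtracting \<kappa> Im z, with \<kappa> the infimum of Re Q / Im z, leaves a
      nonnegative real part whose quotient by Im z is arbitrarily small at a suitable z0. Harnack
      spreads this smallness to all z with |z| >= |z0|, and the added derivative i \<kappa> has no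
      real part.\<close>
    define X where "X = (\<lambda>z. Re (Q z) / Im z) ` U"
    have ne: "X \<noteq> {}" using opU by (auto simp: X_def U_def intro!: exI[of _ \<i>])
    have bdd: "bdd_below X" by (rule bdd_belowI[of _ 0]) (use ReQ0 in \<open>auto simp: X_def U_def\<close>)
    define \<kappa> where "\<kappa> = Inf X"
    have \<kappa>: "\<kappa> * Im z \<le> Re (Q z)" if "0 < Im z" for z
    proof -
      have "\<kappa> \<le> Re (Q z) / Im z" unfolding \<kappa>_def by (rule cInf_lower[OF _ bdd]) (use that in \<open>auto simp: X_def U_def\<close>)
      then show ?thesis using that by (simp add: pos_le_divide_eq)
    qed
    have "\<exists>x\<in>X. x < \<kappa> + \<epsilon> / 4" using cInf_less_iff[OF ne bdd, of "\<kappa> + \<epsilon> / 4"] \<epsilon> by (simp add: \<kappa>_def)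
    then obtain z0 where z0: "0 < Im z0" "Re (Q z0) / Im z0 < \<kappa> + \<epsilon> / 4" by (auto simp: X_def U_def)
    define Q1 where "Q1 = (\<lambda>z. Q z + \<i> * of_real \<kappa> * z)"
    have holQ1: "Q1 holomorphic_on {z. 0 < Im z}" unfolding Q1_def by (intro holomorphic_intros holQ)
    have ReQ1: "0 \<le> Re (Q1 z)" if "0 < Im z" for z using \<kappa>[OF that] by (simp add: Q1_def)
    have Q1z0: "Re (Q1 z0) \<le> \<epsilon> / 4 * Im z0" using z0 by (simp add: Q1_def divide_less_eq algebra_simps)
    have "\<bar>Re (deriv F z / F z)\<bar> \<le> \<epsilon> * (norm z / Im z)\<^sup>2" if z: "0 < Im z" "norm z0 \<le> norm z" for z
    proof -
      have "norm (z - cnj z0) \<le> 2 * norm z" using norm_triangle_ineq4[of z "cnj z0"] z(2) by simp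
      then have sq: "(norm (z - cnj z0))\<^sup>2 \<le> (2 * norm z)\<^sup>2" by (intro power_mono) auto
      have "Re (Q1 z) \<le> Re (Q1 z0) * (norm (z - cnj z0))\<^sup>2 / (Im z * Im z0)"
        by (rule Harnack_half_plane[OF holQ1 ReQ1 z(1) z0(1)])
      also have "\<dots> \<le> (\<epsilon> / 4 * Im z0) * (2 * norm z)\<^sup>2 / (Im z * Im z0)"
        using Q1z0 sq ReQ1[OF z0(1)] z z0(1) \<epsilon> by (intro divide_right_mono mult_mono) auto
      also have "\<dots> = \<epsilon> * (norm z)\<^sup>2 / Im z" using z0(1) by (simp add: power2_eq_square)
      finally have "Re (Q1 z) / Im z \<le> \<epsilon> * (norm z)\<^sup>2 / Im z / Im z" using z by (intro divide_right_mono) auto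
      then have "norm (deriv Q1 z) \<le> \<epsilon> * (norm z / Im z)\<^sup>2"
        using deriv_le_Re_half_plane[OF holQ1 ReQ1 z(1)] by (simp add: power2_eq_square)
      moreover have "deriv Q1 z = deriv Q z + \<i> * of_real \<kappa>"
      proof -
        have "(Q has_field_derivative deriv Q z) (at z)"
          using holomorphic_derivI[OF holQ] opU z(1) by (simp add: U_def)
        then have "(Q1 has_field_derivative deriv Q z + \<i> * of_real \<kappa>) (at z)"
          unfolding Q1_def by (auto intro!: derivative_eq_intros)
        then show ?thesis by (rule DERIV_imp_deriv)
      qed
      then have "Re (deriv Q1 z) = Re (deriv Q z)" by simp
      ultimately show ?thesis using dQ[OF z(1)] abs_Re_le_cmod[of "deriv Q1 z"] by simp
    qed
    then show ?thesis by blast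
  qed
  show thesis by (rule that[of "9 * K0"]) (use A Bd in \<open>auto simp: K0_def\<close>)
qed

end

section \<open>The partial fraction expansion and its means over semicircles\<close>

context class_D_cofactors
begin

text \<open>The real part of the logarithmic derivative of \<open>Fn n\<close>, with the cofactor's
  contribution frozen at its value in 0.\<close>

definition Tn :: "nat \<Rightarrow> complex \<Rightarrow> real" where
  "Tn n z = Re (\<beta> (real n)) + (\<Sum>a\<in>disc_zeros m (real n). real (m a) * Re (1 / (z - refl a)))"

lemma cofactor_log_\<beta>:
  obtains C1 where "0 < C1"
    "\<And>N z. 1 \<le> N \<Longrightarrow> norm z \<le> N / 4 \<Longrightarrow> norm (deriv (G N) z / G N z - \<beta> N) \<le> C1 * norm z / N"
    "\<And>N z. 1 \<le> N \<Longrightarrow> norm z \<le> N / 4 \<Longrightarrow> \<bar>ln (norm (G N z) / norm (G N 0)) - Re (\<beta> N * z)\<bar> \<le> C1 * (norm z)\<^sup>2 / N"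
proof -
  obtain C1 where C1: "0 < C1" "\<And>N g. 1 \<le> N \<Longrightarrow> cofactor f m (disc_zeros m N) g \<Longrightarrow>
    \<exists>l. l holomorphic_on ball 0 N \<and> (\<forall>z. norm z < N \<longrightarrow> g z = g 0 * exp (l z)) \<and>
      (\<forall>z. norm z \<le> N / 4 \<longrightarrow> norm (deriv l z - deriv l 0) \<le> C1 * norm z / N) \<and>
      (\<forall>z. norm z \<le> N / 4 \<longrightarrow> norm (l z - deriv l 0 * z) \<le> C1 * (norm z)\<^sup>2 / N)"
    by (rule cofactor_log) blast
  have "norm (deriv (G N) z / G N z - \<beta> N) \<le> C1 * norm z / N \<and>
    \<bar>ln (norm (G N z) / norm (G N 0)) - Re (\<beta> N * z)\<bar> \<le> C1 * (norm z)\<^sup>2 / N" if N: "1 \<le> N" and z: "norm z \<le> N / 4" for N z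
  proof -
    obtain l where l: "l holomorphic_on ball 0 N" "\<And>z. norm z < N \<Longrightarrow> G N z = G N 0 * exp (l z)"
      "\<And>z. norm z \<le> N / 4 \<Longrightarrow> norm (deriv l z - deriv l 0) \<le> C1 * norm z / N"
      "\<And>z. norm z \<le> N / 4 \<Longrightarrow> norm (l z - deriv l 0 * z) \<le> C1 * (norm z)\<^sup>2 / N"
      using C1(2)[OF N G] by blast
    have ld: "deriv (G N) w / G N w = deriv l w" if w: "norm w < N" for w
    proof -
      have dl: "(l has_field_derivative deriv l w) (at w)"
        by (rule holomorphic_derivI[OF l(1) open_ball]) (use w in simp)
      have "((\<lambda>z. G N 0 * exp (l z)) has_field_derivative G N 0 * (exp (l w) * deriv l w)) (at w)"
        by (intro DERIV_cmult DERIV_fun_exp dl)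
      then have "(G N has_field_derivative G N 0 * (exp (l w) * deriv l w)) (at w)"
        by (rule has_field_derivative_transform_within_open[OF _ open_ball[of 0 N]]) (use w l(2) in auto)
      then have "deriv (G N) w = G N w * deriv l w" using DERIV_imp_deriv l(2)[OF w] by fastforce
      then show ?thesis using G_nonzero[OF w] by simp
    qed
    have z': "norm z < N" "norm (0::complex) < N" using z N by auto
    have b0: "\<beta> N = deriv l 0" using ld[OF z'(2)] by (simp add: \<beta>_def)
    have "norm (G N z) / norm (G N 0) = exp (Re (l z))"
      using l(2)[OF z'(1)] G_nonzero[OF z'(2)] by (simp add: norm_mult)
    then have "ln (norm (G N z) / norm (G N 0)) - Re (\<beta> N * z) = Re (l z - deriv l 0 * z)" by (simp add: b0)
    then have "\<bar>ln (norm (G N z) / norm (G N 0)) - Re (\<beta> N * z)\<bar> \<le> norm (l z - deriv l 0 * z)"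
      by (simp only: abs_Re_le_cmod)
    then show ?thesis using ld[OF z'(1)] b0 l(3)[OF z] l(4)[OF z] by simp
  qed
  then show thesis using that C1(1) by blast
qed

lemma Fn_log_derivative:
  assumes z: "0 < Im z" "norm z < real n"
  shows "Re (deriv (Fn n) z / Fn n z) = Re (deriv (G (real n)) z / G (real n) z)
    + (\<Sum>a\<in>disc_zeros m (real n). real (m a) * Re (1 / (z - refl a)))"
proof -
  define A where "A = disc_zeros m (real n)"
  define S where "S = (\<Sum>a\<in>A. of_nat (m a) / (z - refl a))"
  define P where "P = (\<lambda>z. \<Prod>a\<in>A. (z - refl a) ^ m a)"
  have ne: "z \<noteq> refl a" for a using z by (auto simp: refl_def complex_eq_iff)
  have finA: "finite A" by (simp add: A_def finite_dz)
  have "(P has_field_derivative P z * S) (at z)" unfolding P_def S_def by (rule prod_roots_derivative[OF finA ne])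
  from DERIV_mult[OF G_derivative[of "real n" z] this]
  have "(Fn n has_field_derivative deriv (G (real n)) z * P z + P z * S * G (real n) z) (at z)"
    by (simp add: Fn_def[abs_def] reflprod_def[abs_def] P_def A_def)
  then have d: "deriv (Fn n) z = deriv (G (real n)) z * P z + P z * S * G (real n) z" by (rule DERIV_imp_deriv)
  have P0: "P z \<noteq> 0" using ne finA by (simp add: P_def prod_zero_iff)
  have "Fn n z = G (real n) z * P z" by (simp add: Fn_def reflprod_def P_def A_def)
  then have "deriv (Fn n) z / Fn n z = deriv (G (real n)) z / G (real n) z + S"
    using P0 G_nonzero[OF z(2)] by (simp add: d field_simps)
  moreover have "Re S = (\<Sum>a\<in>A. real (m a) * Re (1 / (z - refl a)))"
    unfolding S_def Re_sum by (rule sum.cong) (simp_all add: Re_divide)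
  ultimately show ?thesis by (simp add: A_def)
qed

text \<open>Enlarging the disc changes Re (\<beta>) by the sum of Re (1 / a), which equals Re (1 /
  refl a). This cancels the leading term of 1 / (z - refl a), and the remainders are of size |z| /
  |a|^2.\<close>

lemma Tn_diff:
  assumes n: "1 \<le> n" "n \<le> n'" and z: "2 * norm z \<le> real n"
  shows "\<bar>Tn n' z - Tn n z\<bar> \<le> 8 * count_const * norm z / real n"
proof -
  define D where "D = disc_zeros m (real n') - disc_zeros m (real n)"
  have finD: "finite D" unfolding D_def using finite_dz by auto
  have nD: "real n \<le> norm a" if "a \<in> D" for a using that by (auto simp: D_def disc_zeros_def)
  have "Re (\<beta> (real n')) - Re (\<beta> (real n)) = (\<Sum>a\<in>D. real (m a) * Re (1 / refl a))"
  proof -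
    have "\<beta> (real n') - \<beta> (real n) = (\<Sum>a\<in>D. of_nat (m a) / a)" unfolding D_def by (rule \<beta>_diff) (use n in auto)
    then have "Re (\<beta> (real n')) - Re (\<beta> (real n)) = Re (\<Sum>a\<in>D. of_nat (m a) / a)" by (metis minus_complex.simps(1))
    also have "\<dots> = (\<Sum>a\<in>D. real (m a) * Re (1 / a))" unfolding Re_sum by (rule sum.cong) (simp_all add: Re_divide)
    finally show ?thesis by (simp only: Re_inverse_refl)
  qed
  moreover have "(\<Sum>a\<in>disc_zeros m (real n'). real (m a) * Re (1 / (z - refl a)))
      - (\<Sum>a\<in>disc_zeros m (real n). real (m a) * Re (1 / (z - refl a)))
    = (\<Sum>a\<in>D. real (m a) * Re (1 / (z - refl a)))"
    unfolding D_def by (rule sum_diff[symmetric, OF finite_dz]) (use n in \<open>auto simp: disc_zeros_def\<close>)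
  ultimately have "Tn n' z - Tn n z = (\<Sum>a\<in>D. real (m a) * Re (1 / refl a)) + (\<Sum>a\<in>D. real (m a) * Re (1 / (z - refl a)))"
    by (simp add: Tn_def)
  also have "\<dots> = (\<Sum>a\<in>D. real (m a) * (Re (1 / refl a) + Re (1 / (z - refl a))))"
    by (simp add: sum.distrib distrib_left)
  finally have eq: "Tn n' z - Tn n z = (\<Sum>a\<in>D. real (m a) * (Re (1 / refl a) + Re (1 / (z - refl a))))" .
  have "\<bar>Tn n' z - Tn n z\<bar> \<le> (\<Sum>a\<in>D. \<bar>real (m a) * (Re (1 / refl a) + Re (1 / (z - refl a)))\<bar>)" unfolding eq by (rule sum_abs)
  also have "\<dots> \<le> (\<Sum>a\<in>D. 2 * norm z * (real (m a) / (norm a)\<^sup>2))"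
  proof (rule sum_mono)
    fix a assume a: "a \<in> D"
    define s where "s = refl a"
    have s: "norm s = norm a" "0 < norm s" "2 * norm z \<le> norm s" using nD[OF a] n z by (auto simp: s_def)
    have zs: "norm s / 2 \<le> norm (z - s)" using norm_triangle_ineq2[of s z] s by (simp add: norm_minus_commute)
    then have ne: "s \<noteq> 0" "z - s \<noteq> 0" using s by auto
    have "1 / s + 1 / (z - s) = z / (s * (z - s))" using ne by (simp add: field_simps)
    then have "norm (1 / s + 1 / (z - s)) = norm z / (norm s * norm (z - s))" by (simp add: norm_divide norm_mult)
    also have "\<dots> \<le> norm z / (norm s * (norm s / 2))" using zs s by (intro divide_left_mono mult_left_mono mult_pos_pos) auto
    also have "\<dots> = 2 * norm z / (norm a)\<^sup>2" by (simp add: s power2_eq_square)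
    finally have "\<bar>Re (1 / s) + Re (1 / (z - s))\<bar> \<le> 2 * norm z / (norm a)\<^sup>2"
      using abs_Re_le_cmod[of "1 / s + 1 / (z - s)"] by (simp only: plus_complex.simps)
    then have "real (m a) * \<bar>Re (1 / s) + Re (1 / (z - s))\<bar> \<le> real (m a) * (2 * norm z / (norm a)\<^sup>2)" by (rule mult_left_mono) simp
    then show "\<bar>real (m a) * (Re (1 / refl a) + Re (1 / (z - refl a)))\<bar> \<le> 2 * norm z * (real (m a) / (norm a)\<^sup>2)"
      by (simp add: abs_mult s_def mult_ac)
  qed
  also have "\<dots> = 2 * norm z * (\<Sum>a\<in>D. real (m a) / (norm a)\<^sup>2)" by (simp add: sum_distrib_left)
  also have "\<dots> \<le> 2 * norm z * (4 * count_const / real n)"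
    by (intro mult_left_mono sum_inverse_square_le finD nD) (use n in auto)
  finally show ?thesis by (simp add: mult_ac)
qed

text \<open>Along the subsequence \<open>Tn\<close> tends to Re (F' / F). The uniform comparison
  \<open>Tn_diff\<close> extends the bounds for F to all n, at the price of a term that vanishes as
  n grows.\<close>

lemma Tn_bounds:
  obtains K1 where "0 \<le> K1"
    "\<And>n z. 1 \<le> n \<Longrightarrow> 2 * norm z \<le> real n \<Longrightarrow> 2 \<le> Im z \<Longrightarrow> \<bar>Tn n z\<bar> \<le> K1 + 8 * count_const * norm z / real n"
    "\<And>\<epsilon>. 0 < \<epsilon> \<Longrightarrow> \<exists>\<rho>. \<forall>n z. 1 \<le> n \<and> 2 * norm z \<le> real n \<and> 0 < Im z \<and> \<rho> \<le> norm z \<longrightarrow>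
      \<bar>Tn n z\<bar> \<le> \<epsilon> * (norm z / Im z)\<^sup>2 + 8 * count_const * norm z / real n"
proof -
  obtain F r where F: "strict_mono (r :: nat \<Rightarrow> nat)" "F holomorphic_on {z. 0 < Im z}"
    "\<And>K. compact K \<Longrightarrow> K \<subseteq> {z. 0 < Im z} \<Longrightarrow> uniform_limit K (\<lambda>k. Fn (r k)) F sequentially"
    "\<And>z. 0 < Im z \<Longrightarrow> norm (F z) \<le> M * exp (B * Im z)"
    "\<And>z. 0 < Im z \<Longrightarrow> norm (f z) \<le> norm (F z)"
    "\<And>z. 0 < Im z \<Longrightarrow> F z \<noteq> 0"
    by (rule ex_limit_function) blast
  obtain K1 where K1: "0 \<le> K1" "\<And>z. 2 \<le> Im z \<Longrightarrow> \<bar>Re (deriv F z / F z)\<bar> \<le> K1"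
    "\<And>\<epsilon>. 0 < \<epsilon> \<Longrightarrow> \<exists>\<rho>. \<forall>z. 0 < Im z \<and> \<rho> \<le> norm z \<longrightarrow> \<bar>Re (deriv F z / F z)\<bar> \<le> \<epsilon> * (norm z / Im z)\<^sup>2"
    using limit_log_derivative[OF F(2,4,5,6)] by blast
  obtain C1 where C1: "0 < C1"
    "\<And>N z. 1 \<le> N \<Longrightarrow> norm z \<le> N / 4 \<Longrightarrow> norm (deriv (G N) z / G N z - \<beta> N) \<le> C1 * norm z / N"
    by (rule cofactor_log_\<beta>) blast
  have key: "\<bar>Tn n z\<bar> \<le> \<bar>Re (deriv F z / F z)\<bar> + 8 * count_const * norm z / real n"
    if n: "1 \<le> n" "2 * norm z \<le> real n" and z: "0 < Im z" for n z
  proof -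
    have rk: "filterlim r at_top sequentially" using F(1) by (rule filterlim_subseq)
    have opU: "open {z. 0 < Im z}" by (rule open_halfspace_Im_gt)
    obtain e where e: "0 < e" "cball z e \<subseteq> {z. 0 < Im z}" using opU z open_contains_cball by blast
    have ul: "uniform_limit (ball z e) (\<lambda>k. Fn (r k)) F sequentially"
      by (rule uniform_limit_on_subset[OF F(3)[OF _ e(2)]]) auto
    have "(\<lambda>k. deriv (Fn (r k)) z) \<longlonglongrightarrow> deriv F z"
      by (rule deriv_complex_uniform_limit[OF ul]) (use e Fn_holomorphic in auto)
    moreover have "(\<lambda>k. Fn (r k) z) \<longlonglongrightarrow> F z" by (rule tendsto_uniform_limitI[OF ul]) (use e in auto)
    ultimately have "(\<lambda>k. Re (deriv (Fn (r k)) z / Fn (r k) z)) \<longlonglongrightarrow> Re (deriv F z / F z)"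
      using F(6)[OF z] by (intro tendsto_Re tendsto_divide)
    moreover have "(\<lambda>k. Tn (r k) z - Re (deriv (Fn (r k)) z / Fn (r k) z)) \<longlonglongrightarrow> 0"
    proof (rule Lim_null_comparison)
      have "eventually (\<lambda>k. nat \<lceil>4 * norm z + 1\<rceil> \<le> r k) sequentially"
        using rk unfolding filterlim_at_top by blast
      then show "eventually (\<lambda>k. norm (Tn (r k) z - Re (deriv (Fn (r k)) z / Fn (r k) z)) \<le> C1 * norm z / real (r k)) sequentially"
      proof eventually_elim
        case (elim k)
        then have big: "4 * norm z + 1 \<le> real (r k)" by linarith
        then have b: "norm z < real (r k)" "1 \<le> real (r k)" "norm z \<le> real (r k) / 4"
          using norm_ge_zero[of z] by linarith+
        have "Tn (r k) z - Re (deriv (Fn (r k)) z / Fn (r k) z) = - Re (deriv (G (real (r k))) z / G (real (r k)) z - \<beta> (real (r k)))"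
          unfolding Fn_log_derivative[OF z b(1)] by (simp add: Tn_def)
        then have "norm (Tn (r k) z - Re (deriv (Fn (r k)) z / Fn (r k) z)) \<le> norm (deriv (G (real (r k))) z / G (real (r k)) z - \<beta> (real (r k)))"
          using abs_Re_le_cmod[of "deriv (G (real (r k))) z / G (real (r k)) z - \<beta> (real (r k))"] by simp
        also have "\<dots> \<le> C1 * norm z / real (r k)" by (rule C1(2)[OF b(2,3)])
        finally show ?case .
      qed
      have "filterlim (\<lambda>k. real (r k)) at_top sequentially"
        using filterlim_compose[OF filterlim_real_sequentially rk] .
      then show "(\<lambda>k. C1 * norm z / real (r k)) \<longlonglongrightarrow> 0" by (intro tendsto_divide_0[OF tendsto_const] filterlim_at_top_imp_at_infinity)
    qed
    ultimately have "(\<lambda>k. Re (deriv (Fn (r k)) z / Fn (r k) z) + (Tn (r k) z - Re (deriv (Fn (r k)) z / Fn (r k) z)))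
        \<longlonglongrightarrow> Re (deriv F z / F z) + 0" by (rule tendsto_add)
    then have T: "(\<lambda>k. Tn (r k) z) \<longlonglongrightarrow> Re (deriv F z / F z)" by simp
    have "\<bar>Re (deriv F z / F z) - Tn n z\<bar> \<le> 8 * count_const * norm z / real n"
    proof (rule tendsto_upperbound)
      show "(\<lambda>k. \<bar>Tn (r k) z - Tn n z\<bar>) \<longlonglongrightarrow> \<bar>Re (deriv F z / F z) - Tn n z\<bar>" by (intro tendsto_intros T)
      have "eventually (\<lambda>k. n \<le> r k) sequentially" using rk unfolding filterlim_at_top by blast
      then show "eventually (\<lambda>k. \<bar>Tn (r k) z - Tn n z\<bar> \<le> 8 * count_const * norm z / real n) sequentially"
        by eventually_elim (rule Tn_diff[OF n(1) _ n(2)])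
    qed simp
    then show ?thesis by linarith
  qed
  show thesis
  proof (rule that[OF K1(1)])
    show "\<bar>Tn n z\<bar> \<le> K1 + 8 * count_const * norm z / real n" if "1 \<le> n" "2 * norm z \<le> real n" "2 \<le> Im z" for n z
      using key[OF that(1,2)] K1(2)[OF that(3)] that(3) by linarith
    show "\<exists>\<rho>. \<forall>n z. 1 \<le> n \<and> 2 * norm z \<le> real n \<and> 0 < Im z \<and> \<rho> \<le> norm z \<longrightarrow>
      \<bar>Tn n z\<bar> \<le> \<epsilon> * (norm z / Im z)\<^sup>2 + 8 * count_const * norm z / real n" if "0 < \<epsilon>" for \<epsilon>
    proof -
      obtain \<rho> where \<rho>: "\<And>z. 0 < Im z \<Longrightarrow> \<rho> \<le> norm z \<Longrightarrow> \<bar>Re (deriv F z / F z)\<bar> \<le> \<epsilon> * (norm z / Im z)\<^sup>2"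
        using K1(3)[OF \<open>0 < \<epsilon>\<close>] by blast
      have "\<bar>Tn n z\<bar> \<le> \<epsilon> * (norm z / Im z)\<^sup>2 + 8 * count_const * norm z / real n"
        if "1 \<le> n" "2 * norm z \<le> real n" "0 < Im z" "\<rho> \<le> norm z" for n z
        using key[OF that(1,2,3)] \<rho>[OF that(3,4)] by linarith
      then show ?thesis by blast
    qed
  qed
qed

definition Vn :: "nat \<Rightarrow> real \<Rightarrow> real" where
  "Vn n R = Re (\<beta> (real n)) + (\<Sum>a\<in>disc_zeros m (real n). real (m a) * Re (arcker R (shifted a)))"

definition arcpt :: "real \<Rightarrow> real \<Rightarrow> complex" where
  "arcpt R \<theta> = of_real R * exp (\<i> * of_real \<theta>) + 2 * \<i>"

lemma Tn_integral:
  assumes R: "0 \<le> R"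
  shows "((\<lambda>\<theta>. Tn n (arcpt R \<theta>)) has_integral pi * Vn n R) {0..pi}"
proof -
  have one: "((\<lambda>\<theta>. Re (1 / (arcpt R \<theta> - refl a))) has_integral pi * Re (arcker R (shifted a))) {0..pi}" for a
  proof -
    have "Im (shifted a) < 0" by (simp add: shifted_def)
    from has_integral_Re[OF arcker_integral[OF R this]]
    have "((\<lambda>\<theta>. Re (1 / (of_real R * exp (\<i> * of_real \<theta>) - shifted a))) has_integral pi * Re (arcker R (shifted a))) {0..pi}"
      by simp
    moreover have "of_real R * exp (\<i> * of_real \<theta>) - shifted a = arcpt R \<theta> - refl a" for \<theta>
      by (simp add: arcpt_def complex_eq_iff shifted_def refl_def)
    ultimately show ?thesis by simp
  qed
  have "((\<lambda>\<theta>. Re (\<beta> (real n)) + (\<Sum>a\<in>disc_zeros m (real n). real (m a) * Re (1 / (arcpt R \<theta> - refl a)))) has_integral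
      (pi - 0) *\<^sub>R Re (\<beta> (real n)) + (\<Sum>a\<in>disc_zeros m (real n). real (m a) * (pi * Re (arcker R (shifted a))))) {0..pi}"
    using has_integral_const_real[of "Re (\<beta> (real n))" 0 pi]
    by (intro has_integral_add has_integral_sum finite_dz has_integral_mult_right one) auto
  moreover have "(pi - 0) *\<^sub>R Re (\<beta> (real n)) + (\<Sum>a\<in>disc_zeros m (real n). real (m a) * (pi * Re (arcker R (shifted a)))) = pi * Vn n R"
    by (simp add: Vn_def distrib_left sum_distrib_left mult_ac)
  ultimately show ?thesis by (simp add: Tn_def)
qed

text \<open>On two short arcs at the ends of the semicircle only a bounded estimate is available,
  valid because the centre 2 i keeps the height at least 2. On the middle arc |z| / Im z is bounded,
  so the decaying estimate applies.\<close>

lemma Vn_small: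
  assumes e: "0 < e"
  obtains R0 where "\<And>R. R0 \<le> R \<Longrightarrow> \<exists>N. \<forall>n\<ge>N. \<bar>Vn n R\<bar> \<le> e"
proof -
  obtain K1 where K1: "0 \<le> K1"
    "\<And>n z. 1 \<le> n \<Longrightarrow> 2 * norm z \<le> real n \<Longrightarrow> 2 \<le> Im z \<Longrightarrow> \<bar>Tn n z\<bar> \<le> K1 + 8 * count_const * norm z / real n"
    "\<And>\<epsilon>. 0 < \<epsilon> \<Longrightarrow> \<exists>\<rho>. \<forall>n z. 1 \<le> n \<and> 2 * norm z \<le> real n \<and> 0 < Im z \<and> \<rho> \<le> norm z \<longrightarrow>
      \<bar>Tn n z\<bar> \<le> \<epsilon> * (norm z / Im z)\<^sup>2 + 8 * count_const * norm z / real n"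
    by (rule Tn_bounds) blast
  \<comment> \<open>The two end arcs cost e1 each and the middle arc, of length less than 4, at most
    8 e1; the total 10 e1 stays below e.\<close>
  define e1 where "e1 = min 1 e / 16"
  have e1: "0 < e1" "e1 \<le> 1 / 16" "16 * e1 \<le> e" using e by (auto simp: e1_def)
  define \<alpha> where "\<alpha> = e1 / (K1 + 1)"
  have \<alpha>: "0 < \<alpha>" "\<alpha> \<le> e1" "(K1 + 1) * \<alpha> = e1"
    using e1 K1(1) by (auto simp: \<alpha>_def divide_le_eq intro: mult_left_mono)
  have \<alpha>pi: "\<alpha> \<le> pi - \<alpha>" "\<alpha> \<le> pi" "\<alpha> < pi / 2" using \<alpha> e1 pi_gt3 by linarith+
  define \<sigma> where "\<sigma> = sin \<alpha>"
  have \<sigma>: "0 < \<sigma>" using \<alpha> \<alpha>pi by (simp add: \<sigma>_def sin_gt_zero)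
  \<comment> \<open>On the middle arc |z| / Im z <= 2 / \<sigma>, so \<epsilon> times its square is
    at most e1.\<close>
  define \<epsilon> where "\<epsilon> = e1 * \<sigma>\<^sup>2 / 4"
  have \<epsilon>: "0 < \<epsilon>" using e1 \<sigma> by (simp add: \<epsilon>_def)
  obtain \<rho> where \<rho>: "\<And>n z. 1 \<le> n \<Longrightarrow> 2 * norm z \<le> real n \<Longrightarrow> 0 < Im z \<Longrightarrow> \<rho> \<le> norm z \<Longrightarrow>
      \<bar>Tn n z\<bar> \<le> \<epsilon> * (norm z / Im z)\<^sup>2 + 8 * count_const * norm z / real n"
    using K1(3)[OF \<epsilon>] by blast
  define R0 where "R0 = max 2 (\<rho> + 2)"
  have "\<exists>N. \<forall>n\<ge>N. \<bar>Vn n R\<bar> \<le> e" if R: "R0 \<le> R" for R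
  proof -
    have R2: "2 \<le> R" "\<rho> + 2 \<le> R" using R by (auto simp: R0_def)
    \<comment> \<open>As |z| <= 2 R on the semicircle, this gives 2 |z| <= n and makes the
      comparison term of \<open>Tn_bounds\<close> at most e1.\<close>
    define N where "N = nat \<lceil>max (4 * R) (16 * count_const * R / e1)\<rceil> + 1"
    have "\<bar>Vn n R\<bar> \<le> e" if n: "N \<le> n" for n
    proof -
      have n1: "4 * R \<le> real n" "16 * count_const * R / e1 \<le> real n" "1 \<le> n" using n unfolding N_def by linarith+
      have pt: "norm (arcpt R \<theta>) \<le> 2 * R" "\<rho> \<le> norm (arcpt R \<theta>)" "Im (arcpt R \<theta>) = R * sin \<theta> + 2" for \<theta>
      proof -
        have nR: "norm (of_real R * exp (\<i> * of_real \<theta>)) = R" using R2 by (simp add: norm_mult)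
        show "norm (arcpt R \<theta>) \<le> 2 * R"
          using norm_triangle_ineq[of "of_real R * exp (\<i> * of_real \<theta>)" "2 * \<i>"] R2 unfolding arcpt_def nR by (simp add: norm_mult)
        show "\<rho> \<le> norm (arcpt R \<theta>)"
          using norm_diff_ineq[of "of_real R * exp (\<i> * of_real \<theta>)" "2 * \<i>"] R2 unfolding arcpt_def nR by (simp add: norm_mult)
        show "Im (arcpt R \<theta>) = R * sin \<theta> + 2" by (simp add: arcpt_def Im_exp)
      qed
      have tail: "8 * count_const * norm (arcpt R \<theta>) / real n \<le> e1" for \<theta>
      proof -
        have "8 * count_const * norm (arcpt R \<theta>) \<le> 8 * count_const * (2 * R)" using C_nonneg pt(1) by (intro mult_left_mono) auto
        also have "\<dots> \<le> e1 * real n" using n1(2) e1 by (simp add: pos_divide_le_eq mult_ac)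
        finally show ?thesis using n1(3) by (simp add: divide_le_eq)
      qed
      have two: "2 * norm (arcpt R \<theta>) \<le> real n" for \<theta> using pt(1)[of \<theta>] n1 by linarith
      have all: "\<bar>Tn n (arcpt R \<theta>)\<bar> \<le> K1 + 1" if "\<theta> \<in> {0..pi}" for \<theta>
      proof -
        have "2 \<le> Im (arcpt R \<theta>)" unfolding pt(3) using that R2 by (simp add: sin_ge_zero)
        from K1(2)[OF n1(3) two this] tail[of \<theta>] e1 show ?thesis by linarith
      qed
      have mid: "\<bar>Tn n (arcpt R \<theta>)\<bar> \<le> 2 * e1" if \<theta>: "\<theta> \<in> {\<alpha>..pi - \<alpha>}" for \<theta>
      proof -
        have sin: "\<sigma> \<le> sin \<theta>"
        proof (cases "\<theta> \<le> pi / 2")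
          case True
          then show ?thesis unfolding \<sigma>_def using \<theta> \<alpha> by (intro sin_monotone_2pi_le) auto
        next
          case False
          have "sin \<alpha> \<le> sin (pi - \<theta>)" using \<theta> \<alpha> False by (intro sin_monotone_2pi_le) auto
          then show ?thesis by (simp add: \<sigma>_def)
        qed
        have "R * \<sigma> \<le> R * sin \<theta>" using sin R2 by (intro mult_left_mono) auto
        then have im: "R * \<sigma> \<le> Im (arcpt R \<theta>)" unfolding pt(3) by simp
        have R\<sigma>: "0 < R * \<sigma>" using R2 \<sigma> by simp
        have "norm (arcpt R \<theta>) / Im (arcpt R \<theta>) \<le> 2 * R / (R * \<sigma>)" using pt(1) im R\<sigma> R2 by (intro frac_le) auto
        also have "\<dots> = 2 / \<sigma>" using R2 by simp
        finally have "(norm (arcpt R \<theta>) / Im (arcpt R \<theta>))\<^sup>2 \<le> (2 / \<sigma>)\<^sup>2" using im R\<sigma> by (intro power_mono) auto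
        then have "\<epsilon> * (norm (arcpt R \<theta>) / Im (arcpt R \<theta>))\<^sup>2 \<le> \<epsilon> * (2 / \<sigma>)\<^sup>2" using \<epsilon> by (intro mult_left_mono) auto
        also have "\<dots> = e1" using \<sigma> by (simp add: \<epsilon>_def power_divide)
        finally have "\<epsilon> * (norm (arcpt R \<theta>) / Im (arcpt R \<theta>))\<^sup>2 \<le> e1" .
        then show ?thesis using \<rho>[OF n1(3) two _ pt(2), of \<theta>] im R\<sigma> tail[of \<theta>] by linarith
      qed
      define t where "t = (\<lambda>\<theta>. Tn n (arcpt R \<theta>))"
      have hi: "(t has_integral pi * Vn n R) {0..pi}" unfolding t_def using R2 by (intro Tn_integral) auto
      then have ti: "t integrable_on {0..pi}" by blast
      have sub: "t integrable_on {u..v}" if "{u..v} \<subseteq> {0..pi}" for u v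
        by (rule integrable_subinterval_real[OF ti that])
      have "pi * Vn n R = integral {0..pi} t" using hi by (simp add: integral_unique)
      also have "\<dots> = integral {0..\<alpha>} t + integral {\<alpha>..pi} t"
        by (rule Henstock_Kurzweil_Integration.integral_combine[symmetric]) (use \<alpha> \<alpha>pi ti in auto)
      also have "integral {\<alpha>..pi} t = integral {\<alpha>..pi - \<alpha>} t + integral {pi - \<alpha>..pi} t"
        by (rule Henstock_Kurzweil_Integration.integral_combine[symmetric]) (use \<alpha> \<alpha>pi sub in auto)
      finally have split: "pi * Vn n R = integral {0..\<alpha>} t + (integral {\<alpha>..pi - \<alpha>} t + integral {pi - \<alpha>..pi} t)" .
      have ib: "\<bar>integral {u..v} t\<bar> \<le> b * (v - u)"
        if "0 \<le> b" "u \<le> v" "{u..v} \<subseteq> {0..pi}" "\<And>\<theta>. \<theta> \<in> {u..v} \<Longrightarrow> \<bar>t \<theta>\<bar> \<le> b" for u v b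
        using has_integral_bound_real[OF that(1), of "{}" t "integral {u..v} t" u v] sub[OF that(3)] that(2,4)
        by (simp add: integrable_integral)
      have b1: "\<bar>integral {0..\<alpha>} t\<bar> \<le> (K1 + 1) * (\<alpha> - 0)" by (rule ib) (use \<alpha> \<alpha>pi K1(1) all in \<open>auto simp: t_def\<close>)
      have b2: "\<bar>integral {\<alpha>..pi - \<alpha>} t\<bar> \<le> 2 * e1 * (pi - \<alpha> - \<alpha>)" by (rule ib) (use \<alpha> \<alpha>pi e1 mid in \<open>auto simp: t_def\<close>)
      have b3: "\<bar>integral {pi - \<alpha>..pi} t\<bar> \<le> (K1 + 1) * (pi - (pi - \<alpha>))" by (rule ib) (use \<alpha> \<alpha>pi K1(1) all in \<open>auto simp: t_def\<close>)
      have "2 * e1 * (pi - \<alpha> - \<alpha>) \<le> 2 * e1 * 4" using e1 \<alpha> pi_less_4 by (intro mult_left_mono) auto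
      then have "\<bar>pi * Vn n R\<bar> \<le> 10 * e1" unfolding split using b1 b2 b3 \<alpha>(3) by simp
      also have "\<dots> \<le> pi * e"
      proof -
        have "1 * e \<le> pi * e" using e pi_gt3 by (intro mult_right_mono) auto
        then show ?thesis using e1 by linarith
      qed
      finally show ?thesis by (simp add: abs_mult)
    qed
    then show ?thesis by blast
  qed
  then show thesis using that by blast
qed

end

section \<open>Vanishing of the exponent and convergence of the reciprocal sums\<close>

context class_D_cofactors
begin

text \<open>\<open>Vn n R\<close> combines Re (\<beta> n) with the semicircle kernel. By
  \<open>\<beta>_diff\<close> the former is Re (\<beta> R) plus the sum of Re (1 / a) over R <= |a|
  < n, which the cutoff part of the kernel cancels. What is left is small: the mean, the kernel
  errors, and the cost of replacing a by \<open>shifted a\<close>, which is O(1 / R).\<close>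

lemma Re_\<beta>_tendsto_0: "((\<lambda>R. Re (\<beta> R)) \<longlongrightarrow> 0) at_top"
proof (rule tendstoI)
  fix e :: real assume e: "0 < e"
  then have e4: "0 < e / 4" by simp
  obtain R1 where R1: "\<And>R. R1 \<le> R \<Longrightarrow> \<exists>N. \<forall>n\<ge>N. \<bar>Vn n R\<bar> \<le> e / 4"
    by (rule Vn_small[OF e4]) blast
  obtain R2 where R2: "\<And>R D. R2 \<le> R \<Longrightarrow> finite D \<Longrightarrow> (\<Sum>a\<in>D. real (m a) * \<bar>kernel_error R a\<bar>) \<le> e / 4"
    by (rule sum_kernel_error_small[OF e4]) blast
  define R0 where "R0 = max (max 1 (32 * count_const / e)) (max R1 R2)"
  have "\<bar>Re (\<beta> R)\<bar> < e" if R: "R0 \<le> R" for R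
  proof -
    have R': "1 \<le> R" "32 * count_const / e \<le> R" "R1 \<le> R" "R2 \<le> R" using R by (auto simp: R0_def)
    obtain N where N: "\<And>n. N \<le> n \<Longrightarrow> \<bar>Vn n R\<bar> \<le> e / 4" using R1[OF R'(3)] by blast
    define n where "n = max N (nat \<lceil>R\<rceil>)"
    have n: "N \<le> n" "R \<le> real n" unfolding n_def by linarith+
    define D where "D = disc_zeros m (real n) - disc_zeros m R"
    have finD: "finite D" unfolding D_def using finite_dz by auto
    have nD: "R \<le> norm a" if "a \<in> D" for a using that by (auto simp: D_def disc_zeros_def)
    have b: "Re (\<beta> (real n)) = Re (\<beta> R) + (\<Sum>a\<in>D. real (m a) * Re (1 / a))"
    proof -
      have "\<beta> (real n) = \<beta> R + (\<Sum>a\<in>D. of_nat (m a) / a)" using \<beta>_diff[of R "real n"] R'(1) n(2) by (simp add: D_def algebra_simps)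
      then have "Re (\<beta> (real n)) = Re (\<beta> R) + Re (\<Sum>a\<in>D. of_nat (m a) / a)" by simp
      also have "Re (\<Sum>a\<in>D. of_nat (m a) / a) = (\<Sum>a\<in>D. real (m a) * Re (1 / a))"
        unfolding Re_sum by (rule sum.cong) (simp_all add: Re_divide)
      finally show ?thesis .
    qed
    have k: "(\<Sum>a\<in>disc_zeros m (real n). real (m a) * kernel_error R a)
      = (\<Sum>a\<in>disc_zeros m (real n). real (m a) * Re (arcker R (shifted a))) + (\<Sum>a\<in>D. real (m a) * Re (1 / shifted a))"
    proof -
      have "(\<Sum>a\<in>disc_zeros m (real n). real (m a) * (if R \<le> norm a then Re (1 / shifted a) else 0))
        = (\<Sum>a\<in>D. real (m a) * Re (1 / shifted a))"
        by (rule sum.mono_neutral_cong_right) (use finite_dz in \<open>auto simp: D_def disc_zeros_def\<close>)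
      then show ?thesis unfolding kernel_error_def distrib_left sum.distrib by simp
    qed
    have "Re (\<beta> R) = Vn n R - (\<Sum>a\<in>disc_zeros m (real n). real (m a) * kernel_error R a)
        + (\<Sum>a\<in>D. real (m a) * (Re (1 / shifted a) - Re (1 / a)))"
      unfolding Vn_def b k by (simp add: sum_subtractf right_diff_distrib)
    moreover have "\<bar>\<Sum>a\<in>disc_zeros m (real n). real (m a) * kernel_error R a\<bar> \<le> e / 4"
    proof -
      have "\<bar>\<Sum>a\<in>disc_zeros m (real n). real (m a) * kernel_error R a\<bar> \<le> (\<Sum>a\<in>disc_zeros m (real n). \<bar>real (m a) * kernel_error R a\<bar>)"
        by (rule sum_abs)
      also have "\<dots> = (\<Sum>a\<in>disc_zeros m (real n). real (m a) * \<bar>kernel_error R a\<bar>)" by (simp add: abs_mult)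
      also have "\<dots> \<le> e / 4" by (rule R2[OF R'(4) finite_dz])
      finally show ?thesis .
    qed
    moreover have "\<bar>\<Sum>a\<in>D. real (m a) * (Re (1 / shifted a) - Re (1 / a))\<bar> \<le> e / 4"
    proof -
      have "\<bar>\<Sum>a\<in>D. real (m a) * (Re (1 / shifted a) - Re (1 / a))\<bar> \<le> (\<Sum>a\<in>D. \<bar>real (m a) * (Re (1 / shifted a) - Re (1 / a))\<bar>)"
        by (rule sum_abs)
      also have "\<dots> \<le> (\<Sum>a\<in>D. 2 * (real (m a) / (norm a)\<^sup>2))"
      proof (rule sum_mono)
        fix a assume a: "a \<in> D"
        have na: "0 < norm a" using nD[OF a] R'(1) by linarith
        have ne: "refl a \<noteq> 0" "shifted a \<noteq> 0" using na norm_shifted_ge(2)[of a] norm_refl[of a] by force+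
        have "refl a - shifted a = 2 * \<i>" by (simp add: complex_eq_iff refl_def shifted_def)
        moreover have "1 / shifted a - 1 / refl a = (refl a - shifted a) / (shifted a * refl a)" using ne by (simp add: field_simps)
        ultimately have "norm (1 / shifted a - 1 / refl a) = 2 / (norm (shifted a) * norm a)" by (simp add: norm_divide norm_mult)
        also have "\<dots> \<le> 2 / (norm a * norm a)" using na norm_shifted_ge(1)[of a] by (intro divide_left_mono mult_right_mono mult_pos_pos) auto
        finally have "norm (1 / shifted a - 1 / refl a) \<le> 2 / (norm a)\<^sup>2" by (simp add: power2_eq_square)
        moreover have "Re (1 / shifted a) - Re (1 / a) = Re (1 / shifted a - 1 / refl a)"
          unfolding minus_complex.simps Re_inverse_refl ..
        ultimately have "\<bar>Re (1 / shifted a) - Re (1 / a)\<bar> \<le> 2 / (norm a)\<^sup>2"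
          using abs_Re_le_cmod[of "1 / shifted a - 1 / refl a"] by linarith
        then have "real (m a) * \<bar>Re (1 / shifted a) - Re (1 / a)\<bar> \<le> real (m a) * (2 / (norm a)\<^sup>2)" by (rule mult_left_mono) simp
        then show "\<bar>real (m a) * (Re (1 / shifted a) - Re (1 / a))\<bar> \<le> 2 * (real (m a) / (norm a)\<^sup>2)" by (simp add: abs_mult mult_ac)
      qed
      also have "\<dots> = 2 * (\<Sum>a\<in>D. real (m a) / (norm a)\<^sup>2)" by (simp add: sum_distrib_left)
      also have "\<dots> \<le> 2 * (4 * count_const / R)" by (intro mult_left_mono sum_inverse_square_le finD nD R') auto
      also have "\<dots> \<le> e / 4" using R' e by (simp add: divide_le_eq mult_ac)
      finally show ?thesis .
    qed
    ultimately show ?thesis using N[OF n(1)] e by linarith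
  qed
  then show "eventually (\<lambda>R. dist (Re (\<beta> R)) 0 < e) at_top"
    unfolding eventually_at_top_linorder by (auto simp: dist_norm)
qed

text \<open>The logarithm of the ratio is Re (\<beta> R) x + O(x^2 / R), so the preceding limit is
  exactly what rules out a real exponential factor.\<close>

lemma cofactor_ratio_tendsto_1:
  "((\<lambda>R. norm (G R (of_real x)) / norm (G R 0)) \<longlongrightarrow> 1) at_top"
proof -
  obtain C1 where C1: "0 < C1"
    "\<And>N z. 1 \<le> N \<Longrightarrow> norm z \<le> N / 4 \<Longrightarrow> \<bar>ln (norm (G N z) / norm (G N 0)) - Re (\<beta> N * z)\<bar> \<le> C1 * (norm z)\<^sup>2 / N"
    by (rule cofactor_log_\<beta>) blast
  define u where "u = (\<lambda>R. ln (norm (G R (of_real x)) / norm (G R 0)))"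
  have ev: "eventually (\<lambda>R. 4 * \<bar>x\<bar> + 1 \<le> R) at_top" by (rule eventually_ge_at_top)
  have "((\<lambda>R. u R - Re (\<beta> R) * x) \<longlongrightarrow> 0) at_top"
  proof (rule Lim_null_comparison)
    show "eventually (\<lambda>R. norm (u R - Re (\<beta> R) * x) \<le> C1 * x\<^sup>2 * inverse R) at_top"
      using ev
    proof eventually_elim
      case (elim R)
      have "\<bar>ln (norm (G R (of_real x)) / norm (G R 0)) - Re (\<beta> R * of_real x)\<bar> \<le> C1 * (norm (of_real x :: complex))\<^sup>2 / R"
        by (rule C1(2)) (use elim in auto)
      then show ?case by (simp add: u_def divide_inverse)
    qed
    have "((\<lambda>R. C1 * x\<^sup>2 * inverse R) \<longlongrightarrow> C1 * x\<^sup>2 * 0) at_top"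
      by (intro tendsto_intros tendsto_inverse_0_at_top filterlim_ident)
    then show "((\<lambda>R. C1 * x\<^sup>2 * inverse R) \<longlongrightarrow> 0) at_top" by simp
  qed
  then have "((\<lambda>R. (u R - Re (\<beta> R) * x) + Re (\<beta> R) * x) \<longlongrightarrow> 0 + 0 * x) at_top"
    by (intro tendsto_add tendsto_mult Re_\<beta>_tendsto_0 tendsto_const)
  then have "(u \<longlongrightarrow> 0) at_top" by simp
  then have "((\<lambda>R. exp (u R)) \<longlongrightarrow> exp 0) at_top" by (rule tendsto_exp)
  moreover have "eventually (\<lambda>R. exp (u R) = norm (G R (of_real x)) / norm (G R 0)) at_top"
    using ev
  proof eventually_elim
    case (elim R)
    then have "G R (of_real x) \<noteq> 0" "G R 0 \<noteq> 0" by (auto intro!: G_nonzero)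
    then show ?case by (simp add: u_def)
  qed
  ultimately show ?thesis using Lim_transform_eventually by fastforce
qed

text \<open>Absolute convergence: for |a| >= 1 one has |shifted a| <= 3 |a|, hence |Im (1 / a)| is
  at most 9 times the Blaschke weight.\<close>

lemma Im_recip_sum_converges: "\<exists>l. ((\<lambda>R. Im (recip_sum m R)) \<longlongrightarrow> l) at_top"
proof -
  define U where "U = {a. 0 < m a \<and> 0 < norm a}"
  define g where "g = (\<lambda>a. real (m a) * Im (1 / a))"
  define S where "S = (\<lambda>R. {a. 0 < m a \<and> 0 < norm a \<and> norm a < R})"
  have finS: "finite (S R)" for R
    by (rule finite_subset[OF _ finite_dz[of R]]) (auto simp: S_def disc_zeros_def)
  obtain W where W: "\<And>D. finite D \<Longrightarrow> (\<Sum>a\<in>D. real (m a) * bweight a) \<le> W"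
    by (rule sum_bweight_bounded) blast
  have gb: "\<bar>g a\<bar> \<le> 9 * (real (m a) * bweight a)" if a: "1 \<le> norm a" for a
  proof -
    have "norm (shifted a) \<le> 3 * norm a" using norm_shifted_le[of a] a by linarith
    then have "(norm (shifted a))\<^sup>2 \<le> (3 * norm a)\<^sup>2" by (intro power_mono) auto
    moreover have "0 < norm (shifted a)" using norm_shifted_ge(2)[of a] by linarith
    ultimately have "\<bar>Im a\<bar> / (3 * norm a)\<^sup>2 \<le> bweight a" unfolding bweight_def by (intro frac_le) auto
    then have "\<bar>Im a\<bar> / (norm a)\<^sup>2 \<le> 9 * bweight a" by (simp add: power_mult_distrib)
    moreover have "\<bar>Im (1 / a)\<bar> = \<bar>Im a\<bar> / (norm a)\<^sup>2" by (simp add: Im_divide cmod_power2)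
    ultimately have "real (m a) * \<bar>Im (1 / a)\<bar> \<le> real (m a) * (9 * bweight a)" by (intro mult_left_mono) auto
    then show ?thesis by (simp add: g_def abs_mult mult_ac)
  qed
  have "(\<lambda>a. norm (g a)) summable_on U"
  proof (rule nonneg_bdd_above_summable_on)
    have "(\<Sum>a\<in>D. norm (g a)) \<le> (\<Sum>a\<in>S 1. norm (g a)) + 9 * W" if D: "D \<subseteq> U" "finite D" for D
    proof -
      have "(\<Sum>a\<in>D. norm (g a)) = (\<Sum>a\<in>D \<inter> S 1. norm (g a)) + (\<Sum>a\<in>D - S 1. norm (g a))"
        using D(2) by (rule sum.Int_Diff)
      also have "(\<Sum>a\<in>D \<inter> S 1. norm (g a)) \<le> (\<Sum>a\<in>S 1. norm (g a))" by (intro sum_mono2 finS) auto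
      also have "(\<Sum>a\<in>D - S 1. norm (g a)) \<le> (\<Sum>a\<in>D - S 1. 9 * (real (m a) * bweight a))"
        using D(1) by (intro sum_mono) (auto simp: U_def S_def intro!: gb)
      also have "\<dots> = 9 * (\<Sum>a\<in>D - S 1. real (m a) * bweight a)" by (simp add: sum_distrib_left)
      also have "\<dots> \<le> 9 * W" using D(2) by (intro mult_left_mono W) auto
      finally show ?thesis by simp
    qed
    then show "bdd_above (sum (\<lambda>a. norm (g a)) ` {F. F \<subseteq> U \<and> finite F})" by (intro bdd_aboveI2) auto
  qed auto
  then have "g summable_on U" by (rule abs_summable_summable)
  then have lim: "(sum g \<longlongrightarrow> infsum g U) (finite_subsets_at_top U)"
    using has_sum_infsum unfolding has_sum_def by blast
  \<comment> \<open>Every finite set of nonzero zeros lies in all sufficiently large discs, so an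
    unordered sum is also the limit over discs.\<close>
  have "filterlim S (finite_subsets_at_top U) at_top"
    unfolding filterlim_iff
  proof (intro allI impI)
    fix P assume "eventually P (finite_subsets_at_top U)"
    then obtain X where X: "finite X" "X \<subseteq> U" "\<And>Y. finite Y \<Longrightarrow> X \<subseteq> Y \<Longrightarrow> Y \<subseteq> U \<Longrightarrow> P Y"
      unfolding eventually_finite_subsets_at_top by metis
    have "P (S R)" if R: "(\<Sum>a\<in>X. norm a) < R" for R
    proof (rule X(3)[OF finS])
      show "X \<subseteq> S R"
      proof
        fix a assume a: "a \<in> X"
        then have "norm a \<le> (\<Sum>a\<in>X. norm a)" using X(1) by (intro member_le_sum) auto
        then show "a \<in> S R" using a X(2) R by (auto simp: S_def U_def)
      qed
      show "S R \<subseteq> U" by (auto simp: S_def U_def)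
    qed
    then show "eventually (\<lambda>R. P (S R)) at_top"
      using eventually_gt_at_top[of "\<Sum>a\<in>X. norm a"] by (rule eventually_mono[rotated])
  qed
  from filterlim_compose[OF lim this] have "((\<lambda>R. sum g (S R)) \<longlongrightarrow> infsum g U) at_top" .
  moreover have "sum g (S R) = Im (recip_sum m R)" for R
    unfolding recip_sum_def Im_sum S_def g_def by (rule sum.cong) (simp_all add: Im_divide)
  ultimately show ?thesis by auto
qed

text \<open>Since \<beta> R - \<open>recip_sum m R\<close> is constant for R >= 1, the real parts
  converge together with Re (\<beta> R).\<close>

lemma recip_sum_converges: "\<exists>L. (recip_sum m \<longlongrightarrow> L) at_top"
proof -
  obtain l where l: "((\<lambda>R. Im (recip_sum m R)) \<longlongrightarrow> l) at_top" using Im_recip_sum_converges by blast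
  define b where "b = \<beta> 1 - recip_sum m 1"
  have "((\<lambda>R. Re (\<beta> R) - Re b) \<longlongrightarrow> 0 - Re b) at_top" by (intro tendsto_diff Re_\<beta>_tendsto_0 tendsto_const)
  moreover have "eventually (\<lambda>R. Re (\<beta> R) - Re b = Re (recip_sum m R)) at_top"
    using eventually_ge_at_top[of 1]
  proof eventually_elim
    case (elim R)
    have "recip_sum m R - recip_sum m 1 = \<beta> R - \<beta> 1"
      using recip_sum_diff[OF lf, of 1 R] \<beta>_diff[of 1 R] elim by simp
    then have "recip_sum m R = \<beta> R - b" by (simp add: b_def algebra_simps)
    then show ?case by simp
  qed
  ultimately have "((\<lambda>R. Re (recip_sum m R)) \<longlongrightarrow> 0 - Re b) at_top" by (rule Lim_transform_eventually)
  from tendsto_Complex[OF this l] show ?thesis by auto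
qed

lemma jensen_ratio_bounded:
  "\<bar>ln (jensen f m (of_real x) / jensen f m 0)\<bar> \<le> ln (M * exp B / c)"
proof -
  have j: "c \<le> jensen f m (of_real x)" "jensen f m (of_real x) \<le> M * exp B" for x by (rule jl, rule jensen_upper)
  have pos: "0 < jensen f m (of_real x)" for x by (rule jensen_pos)
  have "ln (jensen f m (of_real x)) \<le> ln (M * exp B)" "ln c \<le> ln (jensen f m (of_real x))" for x
    using j[of x] pos[of x] c by (subst ln_le_cancel_iff; force)+
  note le = this[of x] this[of 0]
  have "ln (jensen f m (of_real x) / jensen f m 0) = ln (jensen f m (of_real x)) - ln (jensen f m 0)"
    using pos[of x] pos[of 0] by (simp add: ln_div)
  moreover have "ln (M * exp B / c) = ln (M * exp B) - ln c" using M c by (subst ln_div) auto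
  ultimately show ?thesis using le unfolding of_real_0 by linarith
qed

end

lemma class_D_zeros_exists:
  assumes D: "f \<in> class_D" and ez: "entire_zeros f m"
  obtains K B M \<delta> c where "class_D_zeros f m K B M \<delta> c"
proof -
  interpret entire_zeros f m by fact
  obtain A B where AB: "\<And>z. norm (f z) \<le> A * exp (B * norm z)" using D by (auto simp: class_D_def exp_type_def)
  have et: "norm (f z) \<le> \<bar>A\<bar> * exp (max B 0 * norm z)" for z
  proof -
    have "A * exp (B * norm z) \<le> \<bar>A\<bar> * exp (max B 0 * norm z)" by (intro mult_mono) (auto intro!: mult_right_mono)
    then show ?thesis using AB[of z] by linarith
  qed
  obtain M where M: "0 < M" "\<And>x::real. norm (f (of_real x)) \<le> M" by (rule class_D_bounded_on_reals[OF D]) blast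
  obtain \<delta> where \<delta>: "0 < \<delta>" "\<And>x::real. \<exists>z. dist z (Complex x 2) \<le> 1 \<and> \<delta> \<le> norm (f z)"
    by (rule class_D_lower_bound[OF D]) blast
  obtain c where c: "0 < c" "\<And>x::real. c \<le> jensen f m (of_real x)"
    by (rule class_D_jensen_lower_bound[OF D ez]) blast
  show thesis by (rule that[of "\<bar>A\<bar>" "max B 0" M \<delta> c], unfold_locales) (use et M \<delta> c in auto)
qed

theorem theorem3:
  fixes m :: "complex \<Rightarrow> nat"
  assumes "locally_finite_mult m"
  shows "(\<exists>f. f \<in> class_D \<and> is_zero_set f m) \<longleftrightarrow>
    ((\<exists>L. ((\<lambda>R::real. \<Sum>a\<in>{a. 0 < m a \<and> 0 < norm a \<and> norm a < R}. of_nat (m a) / a)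
              \<longlongrightarrow> L) at_top)
     \<and> (\<lambda>t. real (count_fn m 0 t)) \<in> O[at_top](\<lambda>t. t)
     \<and> (\<lambda>t. real (count_fn m 0 (t + 1)) - real (count_fn m 0 t)) \<in> o[at_top](\<lambda>t. t)
     \<and> (\<exists>B::real. \<forall>x::real. \<exists>I::real.
          ((\<lambda>T. integral {1..T} (\<lambda>t. (real (count_fn m 0 t) - real (count_fn m (of_real x) t)) / t))
             \<longlongrightarrow> I) at_top
          \<and> \<bar>I\<bar> \<le> B))"
proof (intro iffI conjI)
  assume "\<exists>f. f \<in> class_D \<and> is_zero_set f m"
  then obtain f where f: "f \<in> class_D" "is_zero_set f m" by blast
  then have hol: "f holomorphic_on UNIV" by (simp add: class_D_def)
  have ez: "entire_zeros f m" by unfold_locales (use hol f(2) is_zero_set_iff[OF hol] assms in auto)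
  obtain K B M \<delta> c where "class_D_zeros f m K B M \<delta> c" by (rule class_D_zeros_exists[OF f(1) ez])
  then interpret class_D_zeros f m K B M \<delta> c .
  obtain G where G: "\<And>R. cofactor f m (disc_zeros m R) (G R)" using ex_cofactor[OF finite_dz] by metis
  interpret class_D_cofactors f m K B M \<delta> c G by unfold_locales (rule G)
  show "\<exists>L. ((\<lambda>R::real. \<Sum>a\<in>{a. 0 < m a \<and> 0 < norm a \<and> norm a < R}. of_nat (m a) / a) \<longlongrightarrow> L) at_top"
    using recip_sum_converges unfolding recip_sum_def[abs_def] .
  show "(\<lambda>t. real (count_fn m 0 t)) \<in> O[at_top](\<lambda>t. t)"
  proof (rule bigoI[of _ count_const])
    show "eventually (\<lambda>t. norm (real (count_fn m 0 t)) \<le> count_const * norm t) at_top"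
      using eventually_ge_at_top[of 1] by eventually_elim (use count_le in auto)
  qed
  show iii: "(\<lambda>t. real (count_fn m 0 (t + 1)) - real (count_fn m 0 t)) \<in> o[at_top](\<lambda>t. t)"
    by (rule annulus_count_smallo)
  show "\<exists>B::real. \<forall>x::real. \<exists>I::real.
          ((\<lambda>T. integral {1..T} (\<lambda>t. (real (count_fn m 0 t) - real (count_fn m (of_real x) t)) / t))
             \<longlongrightarrow> I) at_top \<and> \<bar>I\<bar> \<le> B"
  proof (rule exI[of _ "ln (M * exp B / c)"], rule allI)
    fix x :: real
    show "\<exists>I. ((\<lambda>T. integral {1..T} (\<lambda>t. (real (count_fn m 0 t) - real (count_fn m (of_real x) t)) / t))
             \<longlongrightarrow> I) at_top \<and> \<bar>I\<bar> \<le> ln (M * exp B / c)"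
      using count_integral_tendsto[OF iii G cofactor_ratio_tendsto_1, of x] jensen_ratio_bounded[of x]
      by (intro exI[of _ "ln (jensen f m (of_real x) / jensen f m 0)"] conjI)
  qed
next
  assume "(\<exists>L. ((\<lambda>R::real. \<Sum>a\<in>{a. 0 < m a \<and> 0 < norm a \<and> norm a < R}. of_nat (m a) / a)
              \<longlongrightarrow> L) at_top)
     \<and> (\<lambda>t. real (count_fn m 0 t)) \<in> O[at_top](\<lambda>t. t)
     \<and> (\<lambda>t. real (count_fn m 0 (t + 1)) - real (count_fn m 0 t)) \<in> o[at_top](\<lambda>t. t)
     \<and> (\<exists>B::real. \<forall>x::real. \<exists>I::real.
          ((\<lambda>T. integral {1..T} (\<lambda>t. (real (count_fn m 0 t) - real (count_fn m (of_real x) t)) / t))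
             \<longlongrightarrow> I) at_top
          \<and> \<bar>I\<bar> \<le> B)"
  then obtain L B where
    L: "((\<lambda>R::real. \<Sum>a\<in>{a. 0 < m a \<and> 0 < norm a \<and> norm a < R}. of_nat (m a) / a) \<longlongrightarrow> L) at_top"
    and O: "(\<lambda>t. real (count_fn m 0 t)) \<in> O[at_top](\<lambda>t. t)"
    and iii: "(\<lambda>t. real (count_fn m 0 (t + 1)) - real (count_fn m 0 t)) \<in> o[at_top](\<lambda>t. t)"
    and iv: "\<forall>x::real. \<exists>I::real.
      ((\<lambda>T. integral {1..T} (\<lambda>t. (real (count_fn m 0 t) - real (count_fn m (of_real x) t)) / t))
         \<longlongrightarrow> I) at_top \<and> \<bar>I\<bar> \<le> B"
    by (elim conjE exE)
  have "(recip_sum m \<longlongrightarrow> L) at_top" using L by (simp add: recip_sum_def[abs_def])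
  then show "\<exists>f. f \<in> class_D \<and> is_zero_set f m"
    by (rule zero_set_sufficient[OF assms _ O iii spec[OF iv]])
qed

end
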